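(* Let $H_n$ be the ensemble of random matrices of the long-range percolation model described in the context and let $g_n(z)=\frac1N\operatorname{Tr}(H_n-zI)^{-1}$. If $\hat\mu_3=\sup_{i,j}\mathbf{E}\{|a(i,j)|^3\}<\infty$ and $z\in\Lambda_\eta=\{z\in\mathbb{C}: |\operatorname{Im} z|\ge\eta\}$ with $\eta=2v+1$, then in the limit $n\to\infty$, $b_n\to\infty$, $b_n/n\to0$, $$\lim_{n\to\infty}\mathbf{E}\{g_n(z)\}=w_{sc}(z)$$ and $$\mathbf{Var}\{g_n(z)\}=O(b_n^{-1/2}),$$ where $w_{sc}$ is the Stieltjes transform of the semicircle law, i.e. the solution of $w_{sc}(z)=\dfrac{1}{-z-v^2w_{sc}(z)}$ that maps $\mathbb{C}^+=\{\operatorname{Im} z>0\}$ to $\mathbb{C}^+$.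
   Context: Setting. Let $v>0$ and let $\{a(i,j): i\le j,\ i,j\in\mathbb{Z}\}$ be independent real random variables with $\mathbf{E}\{a(i,j)\}=0$ and $\mathbf{E}\{a(i,j)^2\}=v^2$. Let $\psi:\mathbb{R}\to[0,1]$ be a continuous even function, non-increasing on $[0,\infty)$ and vanishing at infinity, with $\int_{\mathbb{R}}\psi(t)\,dt=1$. Let $N=2n+1$ and let $b_n$ be a sequence of integers with $0<b_n\le N$, $b_n\to\infty$ and $b_n/n\to0$ as $n\to\infty$. For each $n$ let $\{d(i,j): -n\le i\le j\le n\}$ be independent Bernoulli random variables, independent of the family $\{a(i,j)\}$ and defined on the same probability space, with $d(i,j)=1$ with probability $\psi((i-j)/b_n)$ and $d(i,j)=0$ with probability $1-\psi((i-j)/b_n)$. Define the real symmetric $N\times N$ random matrix $H_n$, with rows and columns indexed by $\{-n,\dots,n\}$, by $H_n(i,j)=H_n(j,i)=b_n^{-1/2}a(i,j)d(i,j)$ for $i\le j$. For a complex random variable $\zeta$, $\mathbf{Var}\{\zeta\}=\mathbf{E}|\zeta-\mathbf{E}\zeta|^2$. The semicircle law has density $\rho_{sc}(\lambda)=\frac{1}{2\pi v^2}\sqrt{4v^2-\lambda^2}$ for $|\lambda|\le2v$ and $0$ otherwise; its Stieltjes transform is $w_{sc}(z)=\int\frac{\rho_{sc}(\lambda)\,d\lambda}{\lambda-z}$, $z\in\mathbb{C}\setminus\mathbb{R}$. *)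

theory Defs
  imports "HOL-Probability.Probability" "Jordan_Normal_Form.Gauss_Jordan_Elimination"
begin

definition upper_pairs :: "(int \<times> int) set" where
  "upper_pairs = {(i, j). i \<le> j}"

definition upper_pairs_upto :: "nat \<Rightarrow> (int \<times> int) set" where
  "upper_pairs_upto n = {(i, j). - int n \<le> i \<and> i \<le> j \<and> j \<le> int n}"

text \<open>
  The edge variables \<open>d n\<close> form one independent family for each \<open>n\<close>; nothing is assumed about
  the joint law of \<open>d n\<close> and \<open>d m\<close> for different \<open>n\<close> and \<open>m\<close>. Values \<open>a i j\<close> with \<open>i > j\<close> and
  \<open>d n i j\<close> outside \<open>upper_pairs_upto n\<close> are unconstrained and never used.
  The assumption \<open>indep_a_d\<close> is the independence of the two families as a whole, that is, of
  the random elements of the product spaces which they form.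
\<close>

locale long_range_percolation = prob_space M
  for M :: "'w measure" +
  fixes v :: real
    and \<psi> :: "real \<Rightarrow> real"
    and a :: "int \<Rightarrow> int \<Rightarrow> 'w \<Rightarrow> real"
    and b :: "nat \<Rightarrow> int"
    and d :: "nat \<Rightarrow> int \<Rightarrow> int \<Rightarrow> 'w \<Rightarrow> real"
  assumes v_pos: "v > 0"
    and indep_a: "indep_vars (\<lambda>_. borel) (\<lambda>(i, j). a i j) upper_pairs"
    and integrable_a: "\<And>i j. i \<le> j \<Longrightarrow> integrable M (a i j)"
    and mean_a: "\<And>i j. i \<le> j \<Longrightarrow> expectation (a i j) = 0"
    and integrable_a_sq: "\<And>i j. i \<le> j \<Longrightarrow> integrable M (\<lambda>\<omega>. (a i j \<omega>)\<^sup>2)"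
    and second_moment_a: "\<And>i j. i \<le> j \<Longrightarrow> expectation (\<lambda>\<omega>. (a i j \<omega>)\<^sup>2) = v\<^sup>2"
    and psi_range: "\<And>t. \<psi> t \<in> {0..1}"
    and psi_continuous: "continuous_on UNIV \<psi>"
    and psi_even: "\<And>t. \<psi> (- t) = \<psi> t"
    and psi_antimono: "antimono_on {0..} \<psi>"
    and psi_vanishes: "(\<psi> \<longlongrightarrow> 0) at_infinity"
    and psi_integral: "has_bochner_integral lborel \<psi> 1"
    and b_range: "\<And>n. 0 < b n \<and> b n \<le> 2 * int n + 1"
    and b_at_top: "filterlim b at_top sequentially"
    and b_over_n: "(\<lambda>n. real_of_int (b n) / real n) \<longlonglongrightarrow> 0"
    and indep_d: "\<And>n. indep_vars (\<lambda>_. borel) (\<lambda>(i, j). d n i j) (upper_pairs_upto n)"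
    and prob_d_1: "\<And>n i j. (i, j) \<in> upper_pairs_upto n \<Longrightarrow>
      prob {\<omega> \<in> space M. d n i j \<omega> = 1} = \<psi> (real_of_int (i - j) / real_of_int (b n))"
    and prob_d_0: "\<And>n i j. (i, j) \<in> upper_pairs_upto n \<Longrightarrow>
      prob {\<omega> \<in> space M. d n i j \<omega> = 0} = 1 - \<psi> (real_of_int (i - j) / real_of_int (b n))"
    and indep_a_d: "\<And>n. indep_var
      (\<Pi>\<^sub>M p\<in>upper_pairs. borel) (\<lambda>\<omega>. restrict (\<lambda>(i, j). a i j \<omega>) upper_pairs)
      (\<Pi>\<^sub>M p\<in>upper_pairs_upto n. borel) (\<lambda>\<omega>. restrict (\<lambda>(i, j). d n i j \<omega>) (upper_pairs_upto n))"

definition H_entry ::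
  "(int \<Rightarrow> int \<Rightarrow> 'w \<Rightarrow> real) \<Rightarrow> (nat \<Rightarrow> int) \<Rightarrow> (nat \<Rightarrow> int \<Rightarrow> int \<Rightarrow> 'w \<Rightarrow> real) \<Rightarrow>
    nat \<Rightarrow> 'w \<Rightarrow> int \<Rightarrow> int \<Rightarrow> real" where
  "H_entry a b d n \<omega> i j =
    real_of_int (b n) powr (- 1 / 2) * a (min i j) (max i j) \<omega> * d n (min i j) (max i j) \<omega>"

text \<open>
  Matrices are indexed from \<open>0\<close> here, so row and column \<open>k\<close> carry the label \<open>k - n\<close>
  in \<open>{-n..n}\<close>. The real entries are embedded into the complex numbers.
\<close>

definition H_mat ::
  "(int \<Rightarrow> int \<Rightarrow> 'w \<Rightarrow> real) \<Rightarrow> (nat \<Rightarrow> int) \<Rightarrow> (nat \<Rightarrow> int \<Rightarrow> int \<Rightarrow> 'w \<Rightarrow> real) \<Rightarrow>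
    nat \<Rightarrow> 'w \<Rightarrow> complex mat" where
  "H_mat a b d n \<omega> = Matrix.mat (2 * n + 1) (2 * n + 1)
    (\<lambda>(k, l). complex_of_real (H_entry a b d n \<omega> (int k - int n) (int l - int n)))"

definition mat_tr :: "complex mat \<Rightarrow> complex" where
  "mat_tr A = (\<Sum>k<dim_row A. A $$ (k, k))"

text \<open>
  \<open>mat_inverse\<close> returns \<open>None\<close> on a singular matrix; this does not occur for \<open>Im z \<noteq> 0\<close>,
  as \<open>H_mat a b d n \<omega>\<close> is Hermitian.
\<close>

definition g ::
  "(int \<Rightarrow> int \<Rightarrow> 'w \<Rightarrow> real) \<Rightarrow> (nat \<Rightarrow> int) \<Rightarrow> (nat \<Rightarrow> int \<Rightarrow> int \<Rightarrow> 'w \<Rightarrow> real) \<Rightarrow>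
    nat \<Rightarrow> complex \<Rightarrow> 'w \<Rightarrow> complex" where
  "g a b d n z \<omega> = 1 / of_nat (2 * n + 1) *
    mat_tr (the (mat_inverse (H_mat a b d n \<omega> - z \<cdot>\<^sub>m 1\<^sub>m (2 * n + 1))))"

definition complex_variance :: "'w measure \<Rightarrow> ('w \<Rightarrow> complex) \<Rightarrow> real" where
  "complex_variance M X = (\<integral>\<omega>. (cmod (X \<omega> - (\<integral>\<omega>'. X \<omega>' \<partial>M)))\<^sup>2 \<partial>M)"

definition semicircle_density :: "real \<Rightarrow> real \<Rightarrow> real" where
  "semicircle_density v x =
    (if \<bar>x\<bar> \<le> 2 * v then 1 / (2 * pi * v\<^sup>2) * sqrt (4 * v\<^sup>2 - x\<^sup>2) else 0)"

definition w_sc :: "real \<Rightarrow> complex \<Rightarrow> complex" where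
  "w_sc v z =
    (\<integral>x. complex_of_real (semicircle_density v x) / (complex_of_real x - z) \<partial>lborel)"

end

theory Submission
  imports Defs "Jordan_Normal_Form.Determinant"
begin

text \<open>
  Write \<open>G\<close> for the resolvent of \<open>H_n\<close> at \<open>z\<close> and \<open>s i j\<close> for the variance of the entry \<open>(i, j)\<close>,
  that is \<open>v\<^sup>2 * \<psi> ((i - j) / b) / b\<close>. The Schur complement formula expresses \<open>1 / G i i\<close> as
  \<open>h i i - z\<close> minus a quadratic form in row \<open>i\<close> of the matrix, whose coefficients are the resolvent
  entries of the minor without row and column \<open>i\<close> and hence are independent of that row. The form
  concentrates around its conditional mean because no single variance exceeds \<open>v\<^sup>2 / b\<close>, and
  passing from the minor back to \<open>G\<close> costs only \<open>O(1 / b)\<close>. So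
  \<open>G i i = 1 / (- z - (\<Sum>j. s i j * G j j))\<close> holds up to an error whose mean square is \<open>O(b powr (- 1 / 2))\<close>,
  uniformly in \<open>i\<close> (\<open>expected_self_consistent_error\<close>). The rate is dictated by the diagonal terms of
  the form, for which only third moments are available: they are truncated at size 1, the small
  parts are estimated in mean square and the large ones in mean.

  For \<open>\<bar>Im z\<bar> \<ge> 2 * v + 1\<close> this system of equations is a contraction pathwise, in the norm that
  averages squares over \<open>i\<close> (\<open>mean_square_stability\<close>), so no concentration of the local averages
  \<open>\<Sum>j. s i j * G j j\<close> has to be proved beforehand. Comparing \<open>G i i\<close> with the values generated by
  its own mean gives the bound on the variance. Comparing it with the constant \<open>w_sc v z\<close> gives the
  limit of the mean: this constant solves the system exactly in every row whose variances sum to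
  \<open>v\<^sup>2\<close>, and for monotone \<open>\<psi>\<close> and \<open>b / n\<close> tending to 0 the Riemann sums \<open>\<Sum>j. s i j\<close> are close to
  \<open>v\<^sup>2\<close> in all but a vanishing proportion of the rows (\<open>average_row_mass_deviation_tendsto_0\<close>).

  That the semicircle transform satisfies the fixed-point equation is a computation: with
  \<open>z = - v * (q + 1 / q)\<close> and \<open>\<bar>q\<bar> < 1\<close> a trigonometric substitution gives \<open>w_sc v z = q / v\<close>
  (\<open>w_sc_eq_inner_root\<close>), from which the equation, the half-plane property and uniqueness are read off.
\<close>

section \<open>Resolvents of real symmetric matrices\<close>

lemma Im_hermitian_form_real_symmetric:
  fixes h :: "'i \<Rightarrow> 'i \<Rightarrow> real" and x :: "'i \<Rightarrow> complex"
  assumes "\<And>i j. i \<in> I \<Longrightarrow> j \<in> I \<Longrightarrow> h i j = h j i"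
  shows "Im (\<Sum>i\<in>I. \<Sum>j\<in>I. cnj (x i) * (of_real (h i j) * x j)) = 0"
proof -
  let ?Q = "\<Sum>i\<in>I. \<Sum>j\<in>I. cnj (x i) * (of_real (h i j) * x j)"
  have "cnj ?Q = (\<Sum>i\<in>I. \<Sum>j\<in>I. x i * (of_real (h i j) * cnj (x j)))"
    by simp
  also have "\<dots> = (\<Sum>j\<in>I. \<Sum>i\<in>I. x i * (of_real (h i j) * cnj (x j)))"
    by (rule sum.swap)
  also have "\<dots> = ?Q"
    by (intro sum.cong refl) (auto simp: assms mult_ac)
  finally have E: "cnj ?Q = ?Q" .
  have "Im q = 0" if "cnj q = q" for q
    using arg_cong[OF that, of Im] by simp
  from this[OF E] show ?thesis .
qed

text \<open>
  The inverse \<open>G\<close> of \<open>H - z\<close> is handled through its entries on an arbitrary finite index set, so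
  that the resolvent of a minor, whose index set has a gap, is an instance of the same locale.
\<close>

locale resolvent_entries =
  fixes I :: "'i set" and h :: "'i \<Rightarrow> 'i \<Rightarrow> real" and z :: complex and G :: "'i \<Rightarrow> 'i \<Rightarrow> complex"
  assumes fin: "finite I"
    and sym: "\<And>i j. i \<in> I \<Longrightarrow> j \<in> I \<Longrightarrow> h i j = h j i"
    and left_inverse: "\<And>i j. i \<in> I \<Longrightarrow> j \<in> I \<Longrightarrow>
      (\<Sum>k\<in>I. of_real (h i k) * G k j) - z * G i j = of_bool (i = j)"
    and nonreal: "Im z \<noteq> 0"
begin

lemma contract_right:
  assumes "j \<in> I"
  shows "(\<Sum>k\<in>I. f k * ((\<Sum>l\<in>I. of_real (h k l) * G l j) - z * G k j)) = f j"
proof -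
  have "(\<Sum>k\<in>I. f k * ((\<Sum>l\<in>I. of_real (h k l) * G l j) - z * G k j)) = (\<Sum>k\<in>I. if k = j then f k else 0)"
    by (intro sum.cong refl) (simp add: left_inverse assms)
  also have "\<dots> = f j"
    using assms fin by simp
  finally show ?thesis .
qed

text \<open>
  The symmetry of the bilinear form of \<open>H - z\<close>, written in the shape in which its values on
  columns of resolvents are known.
\<close>

lemma bilinear_swap:
  fixes x y :: "'i \<Rightarrow> complex"
  shows "(\<Sum>k\<in>I. x k * ((\<Sum>l\<in>I. of_real (h k l) * y l) - z * y k)) =
    (\<Sum>k\<in>I. y k * ((\<Sum>l\<in>I. of_real (h k l) * x l) - z * x k))"
proof -
  have "(\<Sum>k\<in>I. \<Sum>l\<in>I. x k * (of_real (h k l) * y l)) = (\<Sum>l\<in>I. \<Sum>k\<in>I. x k * (of_real (h k l) * y l))"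
    by (rule sum.swap)
  also have "\<dots> = (\<Sum>l\<in>I. \<Sum>k\<in>I. y l * (of_real (h l k) * x k))"
    by (intro sum.cong refl) (auto simp: sym mult_ac)
  finally show ?thesis
    by (simp add: right_diff_distrib sum_subtractf sum_distrib_left mult_ac)
qed

text \<open>
  The form of \<open>H - z\<close> on the columns \<open>i\<close> and \<open>j\<close> of \<open>G\<close> has two evaluations, one for each factor
  to which \<open>H - z\<close> is applied.
\<close>

lemma G_sym:
  assumes "i \<in> I" "j \<in> I"
  shows "G i j = G j i"
  using bilinear_swap[of "\<lambda>k. G k i" "\<lambda>k. G k j"] contract_right[of j "\<lambda>k. G k i"]
    contract_right[of i "\<lambda>k. G k j"] assms by simp

text \<open>
  The Ward identity. Pairing \<open>(H - z) G\<close> with the conjugate of column \<open>i\<close> of \<open>G\<close> gives the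
  conjugate of \<open>G i i\<close>; in this pairing the \<open>H\<close>-part is real, and the \<open>z\<close>-part is \<open>- z\<close> times the
  squared norm of the column. All size and sign bounds on \<open>G\<close> below follow from it.
\<close>

lemma ward:
  assumes "i \<in> I"
  shows "Im (G i i) = Im z * (\<Sum>k\<in>I. (cmod (G k i))\<^sup>2)"
proof -
  have "cnj (G i i) = (\<Sum>k\<in>I. cnj (G k i) * ((\<Sum>l\<in>I. of_real (h k l) * G l i) - z * G k i))"
    using contract_right[OF assms, of "\<lambda>k. cnj (G k i)"] by simp
  also have "\<dots> = (\<Sum>k\<in>I. \<Sum>l\<in>I. cnj (G k i) * (of_real (h k l) * G l i)) - z * (\<Sum>k\<in>I. cnj (G k i) * G k i)"
    by (simp add: right_diff_distrib sum_subtractf sum_distrib_left mult_ac)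
  also have "(\<Sum>k\<in>I. cnj (G k i) * G k i) = of_real (\<Sum>k\<in>I. (cmod (G k i))\<^sup>2)"
    unfolding of_real_sum complex_norm_square by (intro sum.cong refl mult.commute)
  finally have E: "cnj (G i i) = (\<Sum>k\<in>I. \<Sum>l\<in>I. cnj (G k i) * (of_real (h k l) * G l i)) -
    z * of_real (\<Sum>k\<in>I. (cmod (G k i))\<^sup>2)" .
  have *: "Im u = Im z * s" if "cnj u = Q - z * of_real s" "Im Q = 0" for u Q and s :: real
    using arg_cong[OF that(1), of Im] that(2) by simp
  show ?thesis
    by (rule *[OF E Im_hermitian_form_real_symmetric]) (rule sym)
qed

lemma sum_norm_sq_le:
  assumes "i \<in> I"
  shows "\<bar>Im z\<bar> * (\<Sum>k\<in>I. (cmod (G k i))\<^sup>2) \<le> cmod (G i i)"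
proof -
  have "\<bar>Im z\<bar> * (\<Sum>k\<in>I. (cmod (G k i))\<^sup>2) = \<bar>Im (G i i)\<bar>"
    by (simp add: ward[OF assms] abs_mult sum_nonneg)
  then show ?thesis using abs_Im_le_cmod[of "G i i"] by simp
qed

lemma norm_diag_le:
  assumes "i \<in> I"
  shows "\<bar>Im z\<bar> * cmod (G i i) \<le> 1"
proof -
  have "(cmod (G i i))\<^sup>2 \<le> (\<Sum>k\<in>I. (cmod (G k i))\<^sup>2)"
    using assms fin by (intro member_le_sum) auto
  then have "\<bar>Im z\<bar> * (cmod (G i i))\<^sup>2 \<le> cmod (G i i)"
    using sum_norm_sq_le[OF assms] by (meson abs_ge_zero mult_left_mono order_trans)
  then show ?thesis
    by (cases "G i i = 0") (auto simp: power2_eq_square)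
qed

lemma diag_nonzero:
  assumes "i \<in> I"
  shows "G i i \<noteq> 0"
proof
  assume "G i i = 0"
  then have "(\<Sum>k\<in>I. (cmod (G k i))\<^sup>2) = 0"
    using ward[OF assms] nonreal by simp
  then have "\<forall>k\<in>I. G k i = 0" using fin by (simp add: sum_nonneg_eq_0_iff)
  then have "(\<Sum>k\<in>I. of_real (h i k) * G k i) - z * G i i = 0" using assms by simp
  then show False using left_inverse[OF assms assms] by simp
qed

lemma Im_diag_sign:
  assumes "i \<in> I"
  shows "Im z * Im (G i i) \<ge> 0"
  by (simp add: ward[OF assms] mult.assoc[symmetric] power2_eq_square[symmetric] sum_nonneg)

end

text \<open>
  \<open>G'\<close> is the resolvent of the matrix from which row and column \<open>i\<close> are removed. In the random
  setting it is independent of row \<open>i\<close>, which is why every quantity in row \<open>i\<close> of \<open>G\<close> is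
  expressed through \<open>G'\<close>.
\<close>

locale resolvent_minor = resolvent_entries I h z G + minor: resolvent_entries "I - {i}" h z G'
  for I :: "'i set" and i :: 'i and h z G G' +
  assumes i: "i \<in> I"
begin

abbreviation (input) "J \<equiv> I - {i}"

text \<open>
  The resolvent identity between \<open>G\<close> and \<open>G'\<close>: apply row \<open>j\<close> of \<open>G'\<close> to the equations for column
  \<open>m\<close> of \<open>G\<close>, in which the unknown \<open>G i m\<close> is moved to the right-hand side.
\<close>

lemma off_diagonal:
  assumes j: "j \<in> J" and m: "m \<in> I"
  shows "G j m = (if m = i then 0 else G' j m) - (\<Sum>k\<in>J. G' j k * of_real (h k i)) * G i m"
proof -
  have "G j m = (\<Sum>k\<in>J. G k m * ((\<Sum>l\<in>J. of_real (h k l) * G' l j) - z * G' k j))"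
    using minor.contract_right[OF j, of "\<lambda>k. G k m"] by simp
  also have "\<dots> = (\<Sum>k\<in>J. G' k j * ((\<Sum>l\<in>J. of_real (h k l) * G l m) - z * G k m))"
    by (rule minor.bilinear_swap)
  also have "\<dots> = (\<Sum>k\<in>J. (if k = m then G' j k else 0) - G' j k * of_real (h k i) * G i m)"
  proof (intro sum.cong refl)
    fix k assume k: "k \<in> J"
    have "(\<Sum>l\<in>I. of_real (h k l) * G l m) = of_real (h k i) * G i m + (\<Sum>l\<in>J. of_real (h k l) * G l m)"
      by (rule sum.remove[OF fin i])
    then have *: "(\<Sum>l\<in>J. of_real (h k l) * G l m) - z * G k m = of_bool (k = m) - of_real (h k i) * G i m"
      using left_inverse[of k m] k m by (simp add: algebra_simps)
    show "G' k j * ((\<Sum>l\<in>J. of_real (h k l) * G l m) - z * G k m) =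
      (if k = m then G' j k else 0) - G' j k * of_real (h k i) * G i m"
      unfolding * minor.G_sym[OF k j] by (simp add: algebra_simps)
  qed
  also have "\<dots> = (\<Sum>k\<in>J. if k = m then G' j k else 0) - (\<Sum>k\<in>J. G' j k * of_real (h k i)) * G i m"
    by (simp add: sum_subtractf sum_distrib_right)
  also have "(\<Sum>k\<in>J. if k = m then G' j k else 0) = (if m = i then 0 else G' j m)"
    using m minor.fin by auto
  finally show ?thesis .
qed

lemma schur_complement:
  "G i i * (of_real (h i i) - z - (\<Sum>j\<in>J. \<Sum>k\<in>J. of_real (h i j * h i k) * G' j k)) = 1"
proof -
  have "(\<Sum>k\<in>I. of_real (h i k) * G k i) = of_real (h i i) * G i i + (\<Sum>j\<in>J. of_real (h i j) * G j i)"
    by (rule sum.remove[OF fin i])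
  also have "(\<Sum>j\<in>J. of_real (h i j) * G j i) = (\<Sum>j\<in>J. of_real (h i j) * (- (\<Sum>k\<in>J. G' j k * of_real (h k i)) * G i i))"
    by (intro sum.cong refl) (use off_diagonal i in simp)
  also have "\<dots> = - G i i * (\<Sum>j\<in>J. \<Sum>k\<in>J. of_real (h i j * h k i) * G' j k)"
    by (simp add: sum_distrib_left sum_distrib_right sum_negf mult_ac)
  also have "(\<Sum>j\<in>J. \<Sum>k\<in>J. of_real (h i j * h k i) * G' j k) = (\<Sum>j\<in>J. \<Sum>k\<in>J. of_real (h i j * h i k) * G' j k)"
    by (intro sum.cong refl) (use i sym in auto)
  finally show ?thesis
    using left_inverse[OF i i] by (simp add: algebra_simps)
qed

lemma diag_diff:
  assumes j: "j \<in> J"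
  shows "(G j j - G' j j) * G i i = (G j i)\<^sup>2"
proof -
  have 1: "G j j - G' j j = - (\<Sum>k\<in>J. G' j k * of_real (h k i)) * G i j"
    using off_diagonal[OF j, of j] j by simp
  have 2: "G j i = - (\<Sum>k\<in>J. G' j k * of_real (h k i)) * G i i"
    using off_diagonal[OF j i] by simp
  have "(G j j - G' j j) * G i i = (- (\<Sum>k\<in>J. G' j k * of_real (h k i)) * G i i) * G i j"
    unfolding 1 by (simp add: mult_ac)
  also have "\<dots> = G j i * G i j" unfolding 2[symmetric] ..
  finally show ?thesis using G_sym[of i j] i j by (simp add: power2_eq_square)
qed

text \<open>
  Removing one row changes the whole diagonal by a bounded amount in total, because by
  \<open>diag_diff\<close> the differences are the squares of the entries of one column divided by \<open>G i i\<close>, and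
  the Ward identity controls exactly this ratio. Hence a weighted average of the diagonal of \<open>G\<close>
  may be replaced by that of \<open>G'\<close> at the cost of the largest weight.
\<close>

lemma sum_diag_diff_le:
  "\<bar>Im z\<bar> * (\<Sum>j\<in>J. cmod (G j j - G' j j)) \<le> 1"
proof -
  have "(\<Sum>j\<in>J. cmod (G j j - G' j j)) * cmod (G i i) = (\<Sum>j\<in>J. (cmod (G j i))\<^sup>2)"
    unfolding sum_distrib_right by (intro sum.cong refl) (simp add: diag_diff norm_mult[symmetric] norm_power[symmetric])
  also have "\<dots> \<le> (\<Sum>j\<in>I. (cmod (G j i))\<^sup>2)"
    using fin by (intro sum_mono2) auto
  finally have "\<bar>Im z\<bar> * ((\<Sum>j\<in>J. cmod (G j j - G' j j)) * cmod (G i i)) \<le> cmod (G i i)"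
    using sum_norm_sq_le[OF i] by (meson abs_ge_zero mult_left_mono order_trans)
  then show ?thesis using diag_nonzero[OF i] by simp
qed

end

section \<open>The inverse matrix and its measurability\<close>

definition shifted_mat :: "nat \<Rightarrow> (nat \<Rightarrow> nat \<Rightarrow> real) \<Rightarrow> complex \<Rightarrow> complex mat" where
  "shifted_mat N h z = Matrix.mat N N (\<lambda>(i, j). complex_of_real (h i j)) - z \<cdot>\<^sub>m 1\<^sub>m N"

definition resolvent :: "nat \<Rightarrow> (nat \<Rightarrow> nat \<Rightarrow> real) \<Rightarrow> complex \<Rightarrow> nat \<Rightarrow> nat \<Rightarrow> complex" where
  "resolvent N h z i j = the (mat_inverse (shifted_mat N h z)) $$ (i, j)"

lemma shifted_mat_carrier: "shifted_mat N h z \<in> carrier_mat N N"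
  unfolding shifted_mat_def by auto

lemma shifted_mat_index:
  "i < N \<Longrightarrow> j < N \<Longrightarrow> shifted_mat N h z $$ (i, j) = complex_of_real (h i j) - (if i = j then z else 0)"
  unfolding shifted_mat_def by auto

lemma shifted_mat_row:
  assumes "i < N"
  shows "(\<Sum>j<N. shifted_mat N h z $$ (i, j) * y j) = (\<Sum>j<N. of_real (h i j) * y j) - z * y i"
proof -
  have "(\<Sum>j<N. shifted_mat N h z $$ (i, j) * y j) = (\<Sum>j<N. of_real (h i j) * y j - (if i = j then z * y j else 0))"
    by (intro sum.cong refl) (use assms in \<open>auto simp: shifted_mat_index algebra_simps\<close>)
  also have "\<dots> = (\<Sum>j<N. of_real (h i j) * y j) - z * y i"
    using assms by (simp add: sum_subtractf)
  finally show ?thesis .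
qed

text \<open>
  A kernel vector \<open>y\<close> of \<open>H - z\<close> would satisfy \<open>\<langle>y, H y\<rangle> = z \<langle>y, y\<rangle>\<close> with a real left-hand side.
\<close>

lemma det_shifted_mat_nonzero:
  assumes sym: "\<And>i j. i < N \<Longrightarrow> j < N \<Longrightarrow> h i j = h j i" and z: "Im z \<noteq> 0"
  shows "Determinant.det (shifted_mat N h z) \<noteq> 0"
proof
  assume "Determinant.det (shifted_mat N h z) = 0"
  then obtain x where x: "x \<in> carrier_vec N" "x \<noteq> 0\<^sub>v N" and
    A: "shifted_mat N h z *\<^sub>v x = 0\<^sub>v N"
    using det_0_iff_vec_prod_zero[OF shifted_mat_carrier] by blast
  define y where "y i = vec_index x i" for i
  have row: "(\<Sum>j<N. of_real (h i j) * y j) - z * y i = 0" if i: "i < N" for i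
  proof -
    have "0 = vec_index (shifted_mat N h z *\<^sub>v x) i" using A i by simp
    also have "\<dots> = (\<Sum>j<N. shifted_mat N h z $$ (i, j) * y j)"
      using i x shifted_mat_carrier[of N h z]
      by (auto simp: mult_mat_vec_def scalar_prod_def y_def atLeast0LessThan intro!: sum.cong)
    finally show ?thesis by (simp add: shifted_mat_row[OF i])
  qed
  let ?Q = "\<Sum>i<N. \<Sum>j<N. cnj (y i) * (of_real (h i j) * y j)" and ?S = "\<Sum>i<N. (cmod (y i))\<^sup>2"
  have "0 = (\<Sum>i<N. cnj (y i) * ((\<Sum>j<N. of_real (h i j) * y j) - z * y i))"
    by (simp add: row)
  also have "\<dots> = ?Q - z * (\<Sum>i<N. cnj (y i) * y i)"
    by (simp add: right_diff_distrib sum_subtractf sum_distrib_left mult_ac)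
  also have "(\<Sum>i<N. cnj (y i) * y i) = of_real ?S"
    unfolding of_real_sum complex_norm_square by (intro sum.cong refl mult.commute)
  finally have E: "0 = ?Q - z * of_real ?S" .
  have "?Q = z * of_real ?S" using E[symmetric] by (simp only: right_minus_eq)
  then have "Im ?Q = Im (z * of_real ?S)" by (rule arg_cong)
  moreover have "Im ?Q = 0" by (rule Im_hermitian_form_real_symmetric) (use sym in auto)
  moreover have "Im (z * of_real s) = Im z * s" for s :: real by simp
  ultimately have "Im z * ?S = 0" by metis
  then have "?S = 0" using z by (simp only: mult_eq_0_iff simp_thms)
  then have "\<forall>i<N. y i = 0" by (simp add: sum_nonneg_eq_0_iff)
  then have "x = 0\<^sub>v N" using x(1) unfolding y_def by auto
  with x show False by simp
qed

text \<open>
  The adjugate formula makes the entries of the resolvent rational functions of the entries of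
  the matrix, and with this measurable.
\<close>

lemma
  assumes sym: "\<And>i j. i < N \<Longrightarrow> j < N \<Longrightarrow> h i j = h j i" and z: "Im z \<noteq> 0"
    and ij: "i < N" "j < N"
  shows resolvent_eq_adjugate:
      "resolvent N h z i j = adj_mat (shifted_mat N h z) $$ (i, j) / Determinant.det (shifted_mat N h z)"
    and resolvent_left_inverse:
      "(\<Sum>k<N. of_real (h i k) * resolvent N h z k j) - z * resolvent N h z i j = of_bool (i = j)"
    and dim_row_inverse_shifted_mat: "dim_row (the (mat_inverse (shifted_mat N h z))) = N"
proof -
  let ?A = "shifted_mat N h z" let ?d = "Determinant.det ?A"
  have A: "?A \<in> carrier_mat N N" by (rule shifted_mat_carrier)
  have d: "?d \<noteq> 0" using det_shifted_mat_nonzero[OF sym z] .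
  define C where "C = (1 / ?d) \<cdot>\<^sub>m adj_mat ?A"
  have adj: "adj_mat ?A \<in> carrier_mat N N" by (rule adj_mat(1)[OF A])
  have C: "C \<in> carrier_mat N N" unfolding C_def using adj by auto
  have "?A * C = (1 / ?d) \<cdot>\<^sub>m (?A * adj_mat ?A)"
    unfolding C_def by (rule mult_smult_distrib[OF A adj])
  also have "\<dots> = 1\<^sub>m N" unfolding adj_mat(2)[OF A] using d by auto
  finally have AC: "?A * C = 1\<^sub>m N" .
  have "C * ?A = (1 / ?d) \<cdot>\<^sub>m (adj_mat ?A * ?A)"
    unfolding C_def by (rule mult_smult_assoc_mat[OF adj A])
  also have "\<dots> = 1\<^sub>m N" unfolding adj_mat(3)[OF A] using d by auto
  finally have CA: "C * ?A = 1\<^sub>m N" .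
  have "mat_inverse ?A \<noteq> None"
    using mat_inverse(1)[OF A, of undefined] C A AC CA by (auto simp: Units_def ring_mat_def)
  then obtain B where B: "mat_inverse ?A = Some B" by auto
  have B': "?A * B = 1\<^sub>m N" "B * ?A = 1\<^sub>m N" "B \<in> carrier_mat N N" using mat_inverse(2)[OF A B] by auto
  have "B = B * (?A * C)" using B' AC by simp
  also have "\<dots> = (B * ?A) * C" using assoc_mult_mat[OF B'(3) A C] by simp
  also have "\<dots> = C" using B' C by simp
  finally have "B = C" .
  show "dim_row (the (mat_inverse (shifted_mat N h z))) = N"
    using B B'(3) by simp
  from \<open>B = C\<close> show "resolvent N h z i j = adj_mat ?A $$ (i, j) / ?d"
    using B ij adj by (simp add: resolvent_def C_def)
  have "of_bool (i = j) = (?A * B) $$ (i, j)" using B' ij by simp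
  also have "\<dots> = (\<Sum>k<N. ?A $$ (i, k) * B $$ (k, j))"
    using A B'(3) ij by (auto simp: times_mat_def scalar_prod_def atLeast0LessThan intro!: sum.cong)
  also have "\<dots> = (\<Sum>k<N. of_real (h i k) * B $$ (k, j)) - z * B $$ (i, j)"
    by (rule shifted_mat_row[OF ij(1)])
  finally show "(\<Sum>k<N. of_real (h i k) * resolvent N h z k j) - z * resolvent N h z i j = of_bool (i = j)"
    using B by (simp add: resolvent_def)
qed

lemma resolvent_entries_resolvent:
  assumes "\<And>i j. i < N \<Longrightarrow> j < N \<Longrightarrow> h i j = h j i" "Im z \<noteq> 0"
  shows "resolvent_entries {..<N} h z (resolvent N h z)"
  by unfold_locales (use assms resolvent_left_inverse[of N h z, OF assms] in auto)

lemma borel_measurable_det: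
  fixes A :: "'w \<Rightarrow> complex mat"
  assumes "\<And>\<omega>. A \<omega> \<in> carrier_mat n n"
    and "\<And>i j. i < n \<Longrightarrow> j < n \<Longrightarrow> (\<lambda>\<omega>. A \<omega> $$ (i, j)) \<in> borel_measurable M"
  shows "(\<lambda>\<omega>. Determinant.det (A \<omega>)) \<in> borel_measurable M"
proof -
  have "(\<lambda>\<omega>. \<Sum>p\<in>{p. p permutes {0..<n}}. signof p * (\<Prod>i = 0..<n. A \<omega> $$ (i, p i))) \<in> borel_measurable M"
    by (intro borel_measurable_sum borel_measurable_times borel_measurable_prod borel_measurable_const assms(2))
      (auto simp: permutes_in_image)
  then show ?thesis by (simp add: det_def'[OF assms(1)])
qed

lemma borel_measurable_resolvent:
  assumes sym: "\<And>\<omega> i j. i < N \<Longrightarrow> j < N \<Longrightarrow> h \<omega> i j = h \<omega> j i" and z: "Im z \<noteq> 0"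
    and meas: "\<And>i j. i < N \<Longrightarrow> j < N \<Longrightarrow> (\<lambda>\<omega>. h \<omega> i j) \<in> borel_measurable M"
    and ij: "i < N" "j < N"
  shows "(\<lambda>\<omega>. resolvent N (h \<omega>) z i j) \<in> borel_measurable M"
proof -
  let ?A = "\<lambda>\<omega>. shifted_mat N (h \<omega>) z"
  have A: "(\<lambda>\<omega>. ?A \<omega> $$ (i, j)) \<in> borel_measurable M" if "i < N" "j < N" for i j
    using meas[OF that] by (simp add: shifted_mat_index that)
  have c: "dim_row (?A \<omega>) = N" "dim_col (?A \<omega>) = N" for \<omega> using shifted_mat_carrier[of N "h \<omega>" z] by auto
  have 1: "(\<lambda>\<omega>. Determinant.det (?A \<omega>)) \<in> borel_measurable M"
    by (rule borel_measurable_det[OF shifted_mat_carrier A])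
  have 2: "(\<lambda>\<omega>. Determinant.det (mat_delete (?A \<omega>) j i)) \<in> borel_measurable M"
  proof (rule borel_measurable_det[where n = "N - 1"])
    show "mat_delete (?A \<omega>) j i \<in> carrier_mat (N - 1) (N - 1)" for \<omega>
      by (auto simp: mat_delete_def c)
    show "(\<lambda>\<omega>. mat_delete (?A \<omega>) j i $$ (k, l)) \<in> borel_measurable M" if "k < N - 1" "l < N - 1" for k l
      using that by (auto simp: mat_delete_def c intro!: A)
  qed
  have "(\<lambda>\<omega>. resolvent N (h \<omega>) z i j) = (\<lambda>\<omega>. (-1) ^ (j + i) * Determinant.det (mat_delete (?A \<omega>) j i) / Determinant.det (?A \<omega>))"
    using ij by (intro ext, subst resolvent_eq_adjugate[OF sym z ij]) (auto simp: adj_mat_def c cofactor_def)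
  then show ?thesis using 1 2 by simp
qed

section \<open>Fluctuations of random quadratic forms\<close>

lemma integral_norm_sq_orthogonal_sum:
  fixes Y :: "'p \<Rightarrow> 'a \<Rightarrow> real" and c :: "'p \<Rightarrow> complex"
  assumes int: "\<And>p q. p \<in> P \<Longrightarrow> q \<in> P \<Longrightarrow> integrable M (\<lambda>\<omega>. Y p \<omega> * Y q \<omega>)"
    and orth: "\<And>p q. p \<in> P \<Longrightarrow> q \<in> P \<Longrightarrow> p \<noteq> q \<Longrightarrow> (\<integral>\<omega>. Y p \<omega> * Y q \<omega> \<partial>M) = 0"
    and P: "finite P"
  shows "integrable M (\<lambda>\<omega>. (cmod (\<Sum>p\<in>P. c p * of_real (Y p \<omega>)))\<^sup>2)" (is ?int)
    and "(\<integral>\<omega>. (cmod (\<Sum>p\<in>P. c p * of_real (Y p \<omega>)))\<^sup>2 \<partial>M) =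
      (\<Sum>p\<in>P. (cmod (c p))\<^sup>2 * (\<integral>\<omega>. (Y p \<omega>)\<^sup>2 \<partial>M))" (is ?eq)
proof -
  have expand: "(cmod (\<Sum>p\<in>P. c p * of_real (Y p \<omega>)))\<^sup>2 =
      (\<Sum>p\<in>P. \<Sum>q\<in>P. Re (c p * cnj (c q)) * (Y p \<omega> * Y q \<omega>))" for \<omega>
  proof -
    have "(cmod (\<Sum>p\<in>P. c p * of_real (Y p \<omega>)))\<^sup>2 =
        Re ((\<Sum>p\<in>P. c p * of_real (Y p \<omega>)) * cnj (\<Sum>q\<in>P. c q * of_real (Y q \<omega>)))"
      by (subst complex_norm_square[symmetric]) simp
    also have "\<dots> = (\<Sum>p\<in>P. \<Sum>q\<in>P. Re ((c p * of_real (Y p \<omega>)) * cnj (c q * of_real (Y q \<omega>))))"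
      unfolding cnj_sum sum_product Re_sum ..
    also have "\<dots> = (\<Sum>p\<in>P. \<Sum>q\<in>P. Re (c p * cnj (c q)) * (Y p \<omega> * Y q \<omega>))"
      by (intro sum.cong refl) (simp add: algebra_simps)
    finally show ?thesis .
  qed
  show ?int unfolding expand
    by (intro Bochner_Integration.integrable_sum integrable_mult_right int)
  have "(\<integral>\<omega>. (cmod (\<Sum>p\<in>P. c p * of_real (Y p \<omega>)))\<^sup>2 \<partial>M) =
      (\<Sum>p\<in>P. \<Sum>q\<in>P. Re (c p * cnj (c q)) * (\<integral>\<omega>. Y p \<omega> * Y q \<omega> \<partial>M))"
    unfolding expand using int by (simp add: Bochner_Integration.integral_sum)
  also have "\<dots> = (\<Sum>p\<in>P. \<Sum>q\<in>P. if p = q then (cmod (c p))\<^sup>2 * (\<integral>\<omega>. (Y p \<omega>)\<^sup>2 \<partial>M) else 0)"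
  proof (intro sum.cong refl)
    fix p q assume pq: "p \<in> P" "q \<in> P"
    have "Re (c p * cnj (c p)) = (cmod (c p))\<^sup>2"
      by (subst complex_norm_square[symmetric]) simp
    then show "Re (c p * cnj (c q)) * (\<integral>\<omega>. Y p \<omega> * Y q \<omega> \<partial>M) =
      (if p = q then (cmod (c p))\<^sup>2 * (\<integral>\<omega>. (Y p \<omega>)\<^sup>2 \<partial>M) else 0)"
      using orth[OF pq] by (auto simp: power2_eq_square)
  qed
  also have "\<dots> = (\<Sum>p\<in>P. (cmod (c p))\<^sup>2 * (\<integral>\<omega>. (Y p \<omega>)\<^sup>2 \<partial>M))"
    using P by simp
  finally show ?eq .
qed

lemma sum_off_diagonal_eq_sum_pairs:
  fixes J :: "'i :: linorder set" and f :: "'i \<Rightarrow> 'i \<Rightarrow> 'b :: comm_monoid_add"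
  assumes "finite J"
  shows "(\<Sum>j\<in>J. \<Sum>k\<in>J - {j}. f j k) = (\<Sum>(j, k)\<in>{(j, k). j \<in> J \<and> k \<in> J \<and> j < k}. f j k + f k j)"
proof -
  let ?P = "{(j, k). j \<in> J \<and> k \<in> J \<and> j < k}" and ?Q = "{(j, k). j \<in> J \<and> k \<in> J \<and> k < j}"
  have fin: "finite ?P" "finite ?Q"
    by (rule finite_subset[of _ "J \<times> J"]; use assms in auto)+
  have "(\<Sum>j\<in>J. \<Sum>k\<in>J - {j}. f j k) = (\<Sum>(j, k)\<in>(SIGMA j:J. J - {j}). f j k)"
    using assms by (intro sum.Sigma) auto
  also have "(SIGMA j:J. J - {j}) = ?P \<union> ?Q" by auto
  also have "(\<Sum>(j, k)\<in>?P \<union> ?Q. f j k) = (\<Sum>(j, k)\<in>?P. f j k) + (\<Sum>(j, k)\<in>?Q. f j k)"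
    using fin by (intro sum.union_disjoint) auto
  also have "(\<Sum>(j, k)\<in>?Q. f j k) = (\<Sum>(j, k)\<in>?P. f k j)"
    by (rule sum.reindex_bij_witness[of _ prod.swap prod.swap]) auto
  finally show ?thesis by (simp add: sum.distrib case_prod_unfold)
qed

text \<open>
  With third moments only, the square of a matrix entry need not have a variance. It is cut at
  \<open>\<bar>y\<bar> = 1\<close>: the square of \<open>small_sq y\<close> and \<open>large_sq y\<close> itself are both at most \<open>\<bar>y\<bar> ^ 3\<close>, so that the
  small part can be estimated in mean square and the large part in mean, both by the third moment.
\<close>

definition small_sq :: "real \<Rightarrow> real" where
  "small_sq y = (if \<bar>y\<bar> \<le> 1 then y\<^sup>2 else 0)"

definition large_sq :: "real \<Rightarrow> real" where
  "large_sq y = (if \<bar>y\<bar> \<le> 1 then 0 else y\<^sup>2)"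

lemma small_sq_measurable [measurable]: "small_sq \<in> borel_measurable borel"
  unfolding small_sq_def by measurable

lemma large_sq_measurable [measurable]: "large_sq \<in> borel_measurable borel"
  unfolding large_sq_def by measurable

lemma small_plus_large: "small_sq y + large_sq y = y\<^sup>2"
  by (simp add: small_sq_def large_sq_def)

lemma small_sq_bounds: "0 \<le> small_sq y" "small_sq y \<le> 1" "(small_sq y)\<^sup>2 \<le> \<bar>y\<bar> ^ 3"
proof -
  show "0 \<le> small_sq y" by (simp add: small_sq_def)
  show "small_sq y \<le> 1" by (simp add: small_sq_def abs_square_le_1)
  have "(y\<^sup>2)\<^sup>2 \<le> \<bar>y\<bar> ^ 3" if "\<bar>y\<bar> \<le> 1"
  proof -
    have "(y\<^sup>2)\<^sup>2 = \<bar>y\<bar> ^ 4" by (simp flip: power_mult)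
    also have "\<dots> \<le> \<bar>y\<bar> ^ 3" using that by (intro power_decreasing) auto
    finally show ?thesis .
  qed
  then show "(small_sq y)\<^sup>2 \<le> \<bar>y\<bar> ^ 3" by (simp add: small_sq_def)
qed

lemma large_sq_bounds: "0 \<le> large_sq y" "large_sq y \<le> \<bar>y\<bar> ^ 3"
proof -
  show "0 \<le> large_sq y" by (simp add: large_sq_def)
  have "y\<^sup>2 \<le> \<bar>y\<bar> ^ 3" if "\<not> \<bar>y\<bar> \<le> 1"
  proof -
    have "\<bar>y\<bar> ^ 2 \<le> \<bar>y\<bar> ^ 3" using that by (intro power_increasing) auto
    then show ?thesis by simp
  qed
  then show "large_sq y \<le> \<bar>y\<bar> ^ 3" by (simp add: large_sq_def)
qed

text \<open>
  The parts into which the deviation of the quadratic form \<open>\<Sum>j k. y j * y k * c j k\<close> from its mean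
  is divided: off-diagonal, small diagonal and large diagonal. The last one enters with its first
  power, since it need not have a second moment.
\<close>

definition form_fluctuation ::
  "'i set \<Rightarrow> ('i \<Rightarrow> 'i \<Rightarrow> complex) \<Rightarrow> ('i \<Rightarrow> real) \<Rightarrow> ('i \<Rightarrow> real) \<Rightarrow> ('i \<Rightarrow> real) \<Rightarrow> real" where
  "form_fluctuation J c \<mu> \<nu> y =
    (cmod (\<Sum>j\<in>J. \<Sum>k\<in>J - {j}. of_real (y j * y k) * c j k))\<^sup>2 +
    (cmod (\<Sum>j\<in>J. c j j * of_real (small_sq (y j) - \<mu> j)))\<^sup>2 +
    cmod (\<Sum>j\<in>J. c j j * of_real (large_sq (y j) - \<nu> j))"

context prob_space
begin

text \<open>
  The products \<open>x j * x k\<close> with \<open>j < k\<close> are orthogonal: if two such pairs differ, some index occurs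
  in exactly one of them, and the mean of the corresponding factor vanishes. Exponents of the
  independent factors never exceed 2, so second moments suffice.
\<close>

lemma indep_fourfold_product:
  fixes x :: "nat \<Rightarrow> 'a \<Rightarrow> real"
  assumes J: "finite J" and indep: "indep_vars (\<lambda>_. borel) x J"
    and int1: "\<And>j. j \<in> J \<Longrightarrow> integrable M (x j)"
    and int2: "\<And>j. j \<in> J \<Longrightarrow> integrable M (\<lambda>\<omega>. (x j \<omega>)\<^sup>2)"
    and mean: "\<And>j. j \<in> J \<Longrightarrow> expectation (x j) = 0"
    and jk: "j \<in> J" "k \<in> J" "j < k" "j' \<in> J" "k' \<in> J" "j' < k'"
  shows "integrable M (\<lambda>\<omega>. (x j \<omega> * x k \<omega>) * (x j' \<omega> * x k' \<omega>))"
    and "(j, k) \<noteq> (j', k') \<Longrightarrow> expectation (\<lambda>\<omega>. (x j \<omega> * x k \<omega>) * (x j' \<omega> * x k' \<omega>)) = 0"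
proof -
  \<comment> \<open>the exponent of \<open>x l\<close> in the product\<close>
  define m where "m l = (if l = j then 1 else 0) + (if l = k then 1 else 0) +
    (if l = j' then 1 else 0) + (if l = k' then 1 else 0 :: nat)" for l
  have m: "m l \<le> 2" for l using jk unfolding m_def by auto
  have prod1: "(\<Prod>l\<in>J. y l ^ (if l = i then 1 else 0)) = y i" if "i \<in> J" for i and y :: "nat \<Rightarrow> real"
  proof -
    have "(\<Prod>l\<in>J. y l ^ (if l = i then 1 else 0)) = (\<Prod>l\<in>J. if l = i then y l else 1)"
      by (intro prod.cong) auto
    then show ?thesis using that J by simp
  qed
  have eq: "(x j \<omega> * x k \<omega>) * (x j' \<omega> * x k' \<omega>) = (\<Prod>l\<in>J. x l \<omega> ^ m l)" for \<omega>
    unfolding m_def power_add prod.distrib using jk by (simp add: prod1 del: power_Suc)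
  have ind: "indep_vars (\<lambda>_. borel) (\<lambda>l \<omega>. x l \<omega> ^ m l) J"
    by (rule indep_vars_compose2[OF indep, of "\<lambda>l y. y ^ m l"]) measurable
  have int: "integrable M (\<lambda>\<omega>. x l \<omega> ^ m l)" if "l \<in> J" for l
  proof -
    from m[of l] consider "m l = 0" | "m l = 1" | "m l = 2" by linarith
    then show ?thesis using int1[OF that] int2[OF that] by cases (auto simp del: One_nat_def)
  qed
  show "integrable M (\<lambda>\<omega>. (x j \<omega> * x k \<omega>) * (x j' \<omega> * x k' \<omega>))"
    unfolding eq by (rule indep_vars_integrable[OF J ind int])
  assume ne: "(j, k) \<noteq> (j', k')"
  have "\<exists>l\<in>J. m l = 1"
  proof (cases "j \<noteq> j' \<and> j \<noteq> k'")
    case True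
    then show ?thesis using jk by (intro bexI[of _ j]) (auto simp: m_def)
  next
    case False
    then have "k \<noteq> j' \<and> k \<noteq> k'" using ne jk by auto
    then show ?thesis using jk by (intro bexI[of _ k]) (auto simp: m_def)
  qed
  then obtain l where l: "l \<in> J" "m l = 1" by auto
  have "expectation (\<lambda>\<omega>. x l \<omega> ^ m l) = 0" using mean[OF l(1)] by (simp add: l(2))
  then show "expectation (\<lambda>\<omega>. (x j \<omega> * x k \<omega>) * (x j' \<omega> * x k' \<omega>)) = 0"
    unfolding eq using l J
    by (subst indep_vars_lebesgue_integral[OF J ind int]) (auto simp: prod_zero_iff intro!: bexI[of _ l])
qed

lemma indep_pair_expectation:
  fixes x :: "nat \<Rightarrow> 'a \<Rightarrow> real"
  assumes indep: "indep_vars (\<lambda>_. borel) x J" and "\<And>j. j \<in> J \<Longrightarrow> integrable M (x j)"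
    and jk: "j \<in> J" "k \<in> J" "j \<noteq> k"
  shows "expectation (\<lambda>\<omega>. x j \<omega> * x k \<omega>) = expectation (x j) * expectation (x k)"
    and "integrable M (\<lambda>\<omega>. x j \<omega> * x k \<omega>)"
proof -
  have ind: "indep_vars (\<lambda>_. borel) x {j, k}" by (rule indep_vars_subset[OF indep]) (use jk in auto)
  have "finite {j, k}" by simp
  from indep_vars_lebesgue_integral[OF this ind] indep_vars_integrable[OF this ind] assms
  show "expectation (\<lambda>\<omega>. x j \<omega> * x k \<omega>) = expectation (x j) * expectation (x k)"
    "integrable M (\<lambda>\<omega>. x j \<omega> * x k \<omega>)" by auto
qed

text \<open>
  By orthogonality the second moment is a sum of \<open>\<bar>c j k\<bar>\<^sup>2 * s j * s k\<close> with the variances \<open>s\<close>; one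
  variance is bounded by \<open>\<sigma>\<close>, which leaves the squared norms of the rows of \<open>c\<close>.
\<close>

lemma off_diagonal_form_bound:
  fixes x :: "nat \<Rightarrow> 'a \<Rightarrow> real" and c :: "nat \<Rightarrow> nat \<Rightarrow> complex"
  assumes J: "finite J" and indep: "indep_vars (\<lambda>_. borel) x J"
    and int1: "\<And>j. j \<in> J \<Longrightarrow> integrable M (x j)"
    and int2: "\<And>j. j \<in> J \<Longrightarrow> integrable M (\<lambda>\<omega>. (x j \<omega>)\<^sup>2)"
    and mean: "\<And>j. j \<in> J \<Longrightarrow> expectation (x j) = 0"
    and row: "\<And>j. j \<in> J \<Longrightarrow> (\<Sum>k\<in>J. (cmod (c j k))\<^sup>2) \<le> 1"
    and var: "\<And>j. j \<in> J \<Longrightarrow> expectation (\<lambda>\<omega>. (x j \<omega>)\<^sup>2) \<le> \<sigma>"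
  shows "integrable M (\<lambda>\<omega>. (cmod (\<Sum>j\<in>J. \<Sum>k\<in>J - {j}. of_real (x j \<omega> * x k \<omega>) * c j k))\<^sup>2)"
    and "expectation (\<lambda>\<omega>. (cmod (\<Sum>j\<in>J. \<Sum>k\<in>J - {j}. of_real (x j \<omega> * x k \<omega>) * c j k))\<^sup>2)
      \<le> 2 * \<sigma> * (\<Sum>j\<in>J. expectation (\<lambda>\<omega>. (x j \<omega>)\<^sup>2))"
proof -
  define P where "P = {(j, k). j \<in> J \<and> k \<in> J \<and> j < k}"
  define s where "s j = expectation (\<lambda>\<omega>. (x j \<omega>)\<^sup>2)" for j
  have s0: "0 \<le> s j" for j unfolding s_def by simp
  define Y where "Y p \<omega> = x (fst p) \<omega> * x (snd p) \<omega>" for p \<omega>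
  define C where "C p = c (fst p) (snd p) + c (snd p) (fst p)" for p
  have fin: "finite P" unfolding P_def by (rule finite_subset[of _ "J \<times> J"]) (use J in auto)
  have eq: "(\<Sum>j\<in>J. \<Sum>k\<in>J - {j}. of_real (x j \<omega> * x k \<omega>) * c j k) = (\<Sum>p\<in>P. C p * of_real (Y p \<omega>))" for \<omega>
    unfolding sum_off_diagonal_eq_sum_pairs[OF J] P_def[symmetric]
    by (intro sum.cong refl) (auto simp: C_def Y_def algebra_simps)
  note four = indep_fourfold_product[OF J indep int1 int2 mean]
  have intY: "integrable M (\<lambda>\<omega>. Y p \<omega> * Y q \<omega>)" if "p \<in> P" "q \<in> P" for p q
    using four(1)[of "fst p" "snd p" "fst q" "snd q"] that unfolding P_def Y_def by auto
  have orth: "expectation (\<lambda>\<omega>. Y p \<omega> * Y q \<omega>) = 0" if "p \<in> P" "q \<in> P" "p \<noteq> q" for p q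
    using four(2)[of "fst p" "snd p" "fst q" "snd q"] that unfolding P_def Y_def by auto
  note main = integral_norm_sq_orthogonal_sum[OF intY orth fin, where c = C]
  show "integrable M (\<lambda>\<omega>. (cmod (\<Sum>j\<in>J. \<Sum>k\<in>J - {j}. of_real (x j \<omega> * x k \<omega>) * c j k))\<^sup>2)"
    unfolding eq by (rule main(1))
  have ind2: "indep_vars (\<lambda>_. borel) (\<lambda>l \<omega>. (x l \<omega>)\<^sup>2) J"
    by (rule indep_vars_compose2[OF indep, of "\<lambda>l y. y\<^sup>2"]) measurable
  have EY: "expectation (\<lambda>\<omega>. (Y p \<omega>)\<^sup>2) = s (fst p) * s (snd p)" if "p \<in> P" for p
    using indep_pair_expectation(1)[OF ind2 int2, of "fst p" "snd p"] that
    unfolding P_def Y_def s_def by (auto simp: power_mult_distrib)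
  have C_le: "(cmod (C p))\<^sup>2 \<le> 2 * (cmod (c (fst p) (snd p)))\<^sup>2 + 2 * (cmod (c (snd p) (fst p)))\<^sup>2" for p
  proof -
    have "cmod (C p) \<le> cmod (c (fst p) (snd p)) + cmod (c (snd p) (fst p))"
      unfolding C_def by (rule norm_triangle_ineq)
    then have "(cmod (C p))\<^sup>2 \<le> (cmod (c (fst p) (snd p)) + cmod (c (snd p) (fst p)))\<^sup>2"
      by (intro power_mono) auto
    also have "\<dots> \<le> 2 * (cmod (c (fst p) (snd p)))\<^sup>2 + 2 * (cmod (c (snd p) (fst p)))\<^sup>2"
      using sum_squares_bound[of "cmod (c (fst p) (snd p))" "cmod (c (snd p) (fst p))"]
      by (simp add: power2_sum)
    finally show ?thesis .
  qed
  have "expectation (\<lambda>\<omega>. (cmod (\<Sum>j\<in>J. \<Sum>k\<in>J - {j}. of_real (x j \<omega> * x k \<omega>) * c j k))\<^sup>2) =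
      (\<Sum>p\<in>P. (cmod (C p))\<^sup>2 * (s (fst p) * s (snd p)))"
    unfolding eq by (subst main(2), assumption+) (auto intro!: sum.cong simp: EY)
  also have "\<dots> \<le> (\<Sum>p\<in>P. (2 * (cmod (c (fst p) (snd p)))\<^sup>2 + 2 * (cmod (c (snd p) (fst p)))\<^sup>2) * (s (fst p) * s (snd p)))"
    by (intro sum_mono mult_right_mono C_le mult_nonneg_nonneg s0)
  also have "\<dots> = (\<Sum>j\<in>J. \<Sum>k\<in>J - {j}. 2 * (cmod (c j k))\<^sup>2 * (s j * s k))"
    unfolding sum_off_diagonal_eq_sum_pairs[OF J] P_def[symmetric]
    by (intro sum.cong refl) (auto simp: algebra_simps)
  also have "\<dots> \<le> (\<Sum>j\<in>J. \<Sum>k\<in>J. 2 * (cmod (c j k))\<^sup>2 * (s j * s k))"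
    by (intro sum_mono sum_mono2) (use J s0 in auto)
  also have "\<dots> \<le> (\<Sum>j\<in>J. \<Sum>k\<in>J. 2 * (cmod (c j k))\<^sup>2 * (s j * \<sigma>))"
    by (intro sum_mono mult_left_mono mult_nonneg_nonneg) (use s0 var in \<open>auto simp: s_def\<close>)
  also have "\<dots> = (\<Sum>j\<in>J. (2 * \<sigma> * s j) * (\<Sum>k\<in>J. (cmod (c j k))\<^sup>2))"
    by (simp add: sum_distrib_left mult_ac)
  also have "\<dots> \<le> (\<Sum>j\<in>J. (2 * \<sigma> * s j) * 1)"
  proof (intro sum_mono mult_left_mono row)
    fix j assume "j \<in> J"
    then have "0 \<le> \<sigma>" by (intro order_trans[OF s0[of j, unfolded s_def] var])
    then show "0 \<le> 2 * \<sigma> * s j" using s0[of j] by simp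
  qed
  finally show "expectation (\<lambda>\<omega>. (cmod (\<Sum>j\<in>J. \<Sum>k\<in>J - {j}. of_real (x j \<omega> * x k \<omega>) * c j k))\<^sup>2)
      \<le> 2 * \<sigma> * (\<Sum>j\<in>J. expectation (\<lambda>\<omega>. (x j \<omega>)\<^sup>2))"
    by (simp add: s_def sum_distrib_left)
qed

lemma form_fluctuation_bound:
  fixes x :: "nat \<Rightarrow> 'a \<Rightarrow> real" and c :: "nat \<Rightarrow> nat \<Rightarrow> complex"
  assumes J: "finite J" and indep: "indep_vars (\<lambda>_. borel) x J"
    and int1: "\<And>j. j \<in> J \<Longrightarrow> integrable M (x j)"
    and int2: "\<And>j. j \<in> J \<Longrightarrow> integrable M (\<lambda>\<omega>. (x j \<omega>)\<^sup>2)"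
    and int3: "\<And>j. j \<in> J \<Longrightarrow> integrable M (\<lambda>\<omega>. \<bar>x j \<omega>\<bar> ^ 3)"
    and mean: "\<And>j. j \<in> J \<Longrightarrow> expectation (x j) = 0"
    and row: "\<And>j. j \<in> J \<Longrightarrow> (\<Sum>k\<in>J. (cmod (c j k))\<^sup>2) \<le> 1"
    and var: "\<And>j. j \<in> J \<Longrightarrow> expectation (\<lambda>\<omega>. (x j \<omega>)\<^sup>2) \<le> \<sigma>"
  defines "\<mu> \<equiv> \<lambda>j. expectation (\<lambda>\<omega>. small_sq (x j \<omega>))" and "\<nu> \<equiv> \<lambda>j. expectation (\<lambda>\<omega>. large_sq (x j \<omega>))"
  shows "integrable M (\<lambda>\<omega>. form_fluctuation J c \<mu> \<nu> (\<lambda>j. x j \<omega>))"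
    and "expectation (\<lambda>\<omega>. form_fluctuation J c \<mu> \<nu> (\<lambda>j. x j \<omega>)) \<le>
      2 * \<sigma> * (\<Sum>j\<in>J. expectation (\<lambda>\<omega>. (x j \<omega>)\<^sup>2)) + 3 * (\<Sum>j\<in>J. expectation (\<lambda>\<omega>. \<bar>x j \<omega>\<bar> ^ 3))"
proof -
  have meas [measurable]: "x j \<in> borel_measurable M" if "j \<in> J" for j
    using int1[OF that] by (rule borel_measurable_integrable)
  define t where "t j = expectation (\<lambda>\<omega>. \<bar>x j \<omega>\<bar> ^ 3)" for j
  have c_diag: "cmod (c j j) \<le> 1" if "j \<in> J" for j
  proof -
    have "(cmod (c j j))\<^sup>2 \<le> (\<Sum>k\<in>J. (cmod (c j k))\<^sup>2)" using that J by (intro member_le_sum) auto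
    with row[OF that] have "(cmod (c j j))\<^sup>2 \<le> 1" by simp
    then show ?thesis by (simp add: abs_square_le_1)
  qed
  have int_small: "integrable M (\<lambda>\<omega>. small_sq (x j \<omega>))" if "j \<in> J" for j
    by (rule integrable_const_bound[of _ 1]) (use that small_sq_bounds in auto)
  have int_large: "integrable M (\<lambda>\<omega>. large_sq (x j \<omega>))" if "j \<in> J" for j
    by (rule Bochner_Integration.integrable_bound[OF int3[OF that]]) (use that large_sq_bounds in auto)
  have int_small2: "integrable M (\<lambda>\<omega>. (small_sq (x j \<omega>))\<^sup>2)" if "j \<in> J" for j
    by (rule Bochner_Integration.integrable_bound[OF int3[OF that]]) (use that small_sq_bounds in auto)

  define Y where "Y j \<omega> = small_sq (x j \<omega>) - \<mu> j" for j \<omega>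
  have indY: "indep_vars (\<lambda>_. borel) Y J"
    unfolding Y_def by (rule indep_vars_compose2[OF indep, of "\<lambda>l y. small_sq y - \<mu> l"]) measurable
  have int1Y: "integrable M (Y j)" if "j \<in> J" for j unfolding Y_def using int_small[OF that] by simp
  have EY: "expectation (Y j) = 0" if "j \<in> J" for j
    unfolding Y_def \<mu>_def using int_small[OF that] by (simp add: prob_space)
  have varY: "integrable M (\<lambda>\<omega>. Y j \<omega> * Y j \<omega>)" "expectation (\<lambda>\<omega>. (Y j \<omega>)\<^sup>2) \<le> t j" if "j \<in> J" for j
  proof -
    have Y2: "Y j \<omega> * Y j \<omega> = (small_sq (x j \<omega>))\<^sup>2 - 2 * \<mu> j * small_sq (x j \<omega>) + (\<mu> j)\<^sup>2" for \<omega>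
      by (simp add: Y_def power2_eq_square algebra_simps)
    show "integrable M (\<lambda>\<omega>. Y j \<omega> * Y j \<omega>)"
      unfolding Y2 using int_small[OF that] int_small2[OF that] by simp
    have "expectation (\<lambda>\<omega>. (Y j \<omega>)\<^sup>2) = expectation (\<lambda>\<omega>. (small_sq (x j \<omega>))\<^sup>2) - (\<mu> j)\<^sup>2"
      unfolding power2_eq_square[of "Y j _"] Y2
      using int_small[OF that] int_small2[OF that]
      by (simp add: prob_space \<mu>_def power2_eq_square)
    also have "\<dots> \<le> expectation (\<lambda>\<omega>. (small_sq (x j \<omega>))\<^sup>2)" by simp
    also have "\<dots> \<le> t j" unfolding t_def
      by (intro integral_mono int_small2 int3 that small_sq_bounds)
    finally show "expectation (\<lambda>\<omega>. (Y j \<omega>)\<^sup>2) \<le> t j" .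
  qed
  have intYY: "integrable M (\<lambda>\<omega>. Y p \<omega> * Y q \<omega>)" if "p \<in> J" "q \<in> J" for p q
    using that indep_pair_expectation(2)[OF indY int1Y] varY(1) by (cases "p = q") auto
  have orthY: "expectation (\<lambda>\<omega>. Y p \<omega> * Y q \<omega>) = 0" if "p \<in> J" "q \<in> J" "p \<noteq> q" for p q
    using that indep_pair_expectation(1)[OF indY int1Y] EY by auto
  note small = integral_norm_sq_orthogonal_sum[OF intYY orthY J, where c = "\<lambda>j. c j j"]
  have small_le: "expectation (\<lambda>\<omega>. (cmod (\<Sum>j\<in>J. c j j * of_real (Y j \<omega>)))\<^sup>2) \<le> (\<Sum>j\<in>J. t j)"
  proof (subst small(2), assumption+, intro sum_mono)
    fix j assume j: "j \<in> J"
    have "(cmod (c j j))\<^sup>2 * expectation (\<lambda>\<omega>. (Y j \<omega>)\<^sup>2) \<le> 1 * t j"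
      using c_diag[OF j] varY(2)[OF j] by (intro mult_mono) (auto simp: abs_square_le_1)
    then show "(cmod (c j j))\<^sup>2 * expectation (\<lambda>\<omega>. (Y j \<omega>)\<^sup>2) \<le> t j" by simp
  qed

  define W where "W j \<omega> = large_sq (x j \<omega>) - \<nu> j" for j \<omega>
  have nu0: "0 \<le> \<nu> j" for j unfolding \<nu>_def by (simp add: large_sq_bounds)
  have nu_le: "\<nu> j \<le> t j" if "j \<in> J" for j
    unfolding \<nu>_def t_def by (intro integral_mono int_large int3 that large_sq_bounds)
  have intW: "integrable M (\<lambda>\<omega>. cmod (\<Sum>j\<in>J. c j j * of_real (W j \<omega>)))"
    unfolding W_def by (intro integrable_norm Bochner_Integration.integrable_sum integrable_mult_right
      integrable_of_real Bochner_Integration.integrable_diff int_large integrable_const)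
  have W_le: "cmod (\<Sum>j\<in>J. c j j * of_real (W j \<omega>)) \<le> (\<Sum>j\<in>J. large_sq (x j \<omega>) + \<nu> j)" for \<omega>
  proof (rule order_trans[OF norm_sum sum_mono])
    fix j assume j: "j \<in> J"
    have "cmod (c j j * of_real (W j \<omega>)) \<le> 1 * \<bar>W j \<omega>\<bar>"
      unfolding norm_mult norm_of_real using c_diag[OF j] by (intro mult_right_mono) auto
    also have "\<dots> \<le> large_sq (x j \<omega>) + \<nu> j"
      unfolding W_def mult_1_left using nu0[of j] large_sq_bounds(1)[of "x j \<omega>"]
      by (simp add: abs_le_iff)
    finally show "cmod (c j j * of_real (W j \<omega>)) \<le> large_sq (x j \<omega>) + \<nu> j" .
  qed
  have "expectation (\<lambda>\<omega>. cmod (\<Sum>j\<in>J. c j j * of_real (W j \<omega>))) \<le>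
      expectation (\<lambda>\<omega>. \<Sum>j\<in>J. large_sq (x j \<omega>) + \<nu> j)"
    by (intro integral_mono intW W_le) (use int_large in auto)
  also have "\<dots> = (\<Sum>j\<in>J. 2 * \<nu> j)"
    using int_large by (simp add: Bochner_Integration.integral_sum prob_space \<nu>_def)
  also have "\<dots> \<le> (\<Sum>j\<in>J. 2 * t j)" by (intro sum_mono) (use nu_le in auto)
  finally have large_le: "expectation (\<lambda>\<omega>. cmod (\<Sum>j\<in>J. c j j * of_real (W j \<omega>))) \<le> 2 * (\<Sum>j\<in>J. t j)"
    by (simp add: sum_distrib_left)

  have off: "integrable M (\<lambda>\<omega>. (cmod (\<Sum>j\<in>J. \<Sum>k\<in>J - {j}. of_real (x j \<omega> * x k \<omega>) * c j k))\<^sup>2)"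
    "expectation (\<lambda>\<omega>. (cmod (\<Sum>j\<in>J. \<Sum>k\<in>J - {j}. of_real (x j \<omega> * x k \<omega>) * c j k))\<^sup>2)
      \<le> 2 * \<sigma> * (\<Sum>j\<in>J. expectation (\<lambda>\<omega>. (x j \<omega>)\<^sup>2))"
    by (rule off_diagonal_form_bound[where \<sigma> = \<sigma>]; fact)+
  have eq: "form_fluctuation J c \<mu> \<nu> (\<lambda>j. x j \<omega>) =
    (cmod (\<Sum>j\<in>J. \<Sum>k\<in>J - {j}. of_real (x j \<omega> * x k \<omega>) * c j k))\<^sup>2 +
    (cmod (\<Sum>j\<in>J. c j j * of_real (Y j \<omega>)))\<^sup>2 + cmod (\<Sum>j\<in>J. c j j * of_real (W j \<omega>))" for \<omega>
    unfolding form_fluctuation_def Y_def W_def ..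
  show "integrable M (\<lambda>\<omega>. form_fluctuation J c \<mu> \<nu> (\<lambda>j. x j \<omega>))"
    unfolding eq by (intro Bochner_Integration.integrable_add off(1) small(1) intW)
  have "expectation (\<lambda>\<omega>. form_fluctuation J c \<mu> \<nu> (\<lambda>j. x j \<omega>)) =
    expectation (\<lambda>\<omega>. (cmod (\<Sum>j\<in>J. \<Sum>k\<in>J - {j}. of_real (x j \<omega> * x k \<omega>) * c j k))\<^sup>2) +
    expectation (\<lambda>\<omega>. (cmod (\<Sum>j\<in>J. c j j * of_real (Y j \<omega>)))\<^sup>2) +
    expectation (\<lambda>\<omega>. cmod (\<Sum>j\<in>J. c j j * of_real (W j \<omega>)))"
    unfolding eq using off(1) small(1) intW
    by (subst Bochner_Integration.integral_add) (auto intro: Bochner_Integration.integrable_add)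
  then show "expectation (\<lambda>\<omega>. form_fluctuation J c \<mu> \<nu> (\<lambda>j. x j \<omega>)) \<le>
      2 * \<sigma> * (\<Sum>j\<in>J. expectation (\<lambda>\<omega>. (x j \<omega>)\<^sup>2)) + 3 * (\<Sum>j\<in>J. expectation (\<lambda>\<omega>. \<bar>x j \<omega>\<bar> ^ 3))"
    using off(2) small_le large_le unfolding t_def by linarith
qed

text \<open>
  A bound which holds for every frozen value of \<open>Y\<close> survives averaging over an independent \<open>Y\<close>.
\<close>

lemma nn_integral_indep_le:
  assumes indep: "indep_var S X T Y"
    and F [measurable]: "F \<in> borel_measurable (S \<Otimes>\<^sub>M T)"
    and le: "\<And>y. y \<in> space T \<Longrightarrow> (\<integral>\<^sup>+\<omega>. F (X \<omega>, y) \<partial>M) \<le> B"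
  shows "(\<integral>\<^sup>+\<omega>. F (X \<omega>, Y \<omega>) \<partial>M) \<le> (B :: ennreal)"
proof -
  have X [measurable]: "random_variable S X" and Y [measurable]: "random_variable T Y"
    using indep by (auto dest: indep_var_rv1 indep_var_rv2)
  interpret DX: prob_space "distr M S X" by (rule prob_space_distr) fact
  interpret DY: prob_space "distr M T Y" by (rule prob_space_distr) fact
  interpret P: pair_prob_space "distr M S X" "distr M T Y" ..
  have eq: "distr M S X \<Otimes>\<^sub>M distr M T Y = distr M (S \<Otimes>\<^sub>M T) (\<lambda>\<omega>. (X \<omega>, Y \<omega>))"
    using indep unfolding indep_var_distribution_eq by simp
  have "(\<integral>\<^sup>+\<omega>. F (X \<omega>, Y \<omega>) \<partial>M) = (\<integral>\<^sup>+p. F p \<partial>(distr M S X \<Otimes>\<^sub>M distr M T Y))"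
    unfolding eq by (subst nn_integral_distr) auto
  also have "\<dots> = (\<integral>\<^sup>+y. \<integral>\<^sup>+x. F (x, y) \<partial>distr M S X \<partial>distr M T Y)"
    by (subst P.nn_integral_snd) auto
  also have "\<dots> \<le> (\<integral>\<^sup>+y. B \<partial>distr M T Y)"
  proof (rule nn_integral_mono)
    fix y assume "y \<in> space (distr M T Y)"
    then have y: "y \<in> space T" by simp
    then have "(\<integral>\<^sup>+x. F (x, y) \<partial>distr M S X) = (\<integral>\<^sup>+\<omega>. F (X \<omega>, y) \<partial>M)"
      by (subst nn_integral_distr) auto
    then show "(\<integral>\<^sup>+x. F (x, y) \<partial>distr M S X) \<le> B" using le[OF y] by simp
  qed
  also have "\<dots> = B" using DY.emeasure_space_1 by simp
  finally show ?thesis .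
qed

end

section \<open>The self-consistent equation for the diagonal of the resolvent\<close>

text \<open>
  If \<open>Im u\<close> has the sign of \<open>Im z\<close>, the two imaginary parts in \<open>- z - u\<close> do not cancel. This makes
  \<open>u \<mapsto> 1 / (- z - u)\<close> a contraction when \<open>\<bar>Im z\<bar>\<close> is large.
\<close>

lemma norm_inverse_shift_le:
  assumes "Im z * Im u \<ge> 0" "\<bar>Im z\<bar> \<ge> 1"
  shows "\<bar>Im z\<bar> \<le> cmod (- z - u)" and "- z - u \<noteq> 0"
proof -
  have "\<bar>Im z\<bar> \<le> \<bar>Im (- z - u)\<bar>"
    using assms by (auto simp: abs_if zero_le_mult_iff split: if_splits)
  also have "\<dots> \<le> cmod (- z - u)" by (rule abs_Im_le_cmod)
  finally show *: "\<bar>Im z\<bar> \<le> cmod (- z - u)" .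
  then show "- z - u \<noteq> 0" using assms by auto
qed

lemma norm_inverse_shift_diff_le:
  assumes "Im z * Im u \<ge> 0" "Im z * Im w \<ge> 0" "\<bar>Im z\<bar> \<ge> 1"
  shows "cmod (1 / (- z - u) - 1 / (- z - w)) \<le> cmod (u - w) / \<bar>Im z\<bar>\<^sup>2"
proof -
  note u = norm_inverse_shift_le[OF assms(1,3)] and w = norm_inverse_shift_le[OF assms(2,3)]
  have "1 / (- z - u) - 1 / (- z - w) = (u - w) / ((- z - u) * (- z - w))"
    using u(2) w(2) by (simp add: diff_frac_eq)
  then have "cmod (1 / (- z - u) - 1 / (- z - w)) = cmod (u - w) / (cmod (- z - u) * cmod (- z - w))"
    by (simp add: norm_divide norm_mult)
  also have "\<dots> \<le> cmod (u - w) / \<bar>Im z\<bar>\<^sup>2"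
    unfolding power2_eq_square using u w assms by (intro frac_le mult_mono mult_pos_pos) auto
  finally show ?thesis .
qed

lemma (in resolvent_entries) Im_weighted_diag_sign:
  assumes "\<And>j. j \<in> I \<Longrightarrow> 0 \<le> s j"
  shows "Im z * Im (\<Sum>j\<in>I. of_real (s j) * G j j) \<ge> 0"
proof -
  have "Im z * Im (\<Sum>j\<in>I. of_real (s j) * G j j) = (\<Sum>j\<in>I. s j * (Im z * Im (G j j)))"
    by (simp add: sum_distrib_left mult_ac)
  also have "\<dots> \<ge> 0" by (intro sum_nonneg mult_nonneg_nonneg assms Im_diag_sign)
  finally show ?thesis .
qed

text \<open>
  An a priori bound on \<open>k\<close> allows part of its majorant to enter the square linearly. It is used
  with the large diagonal part as \<open>\<gamma>\<close>.
\<close>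

lemma sq_le_of_le_add:
  fixes k :: real
  assumes "0 \<le> k" "k \<le> 2" "k \<le> \<alpha> + \<gamma>" "0 \<le> \<gamma>"
  shows "k\<^sup>2 \<le> \<alpha>\<^sup>2 + 4 * \<gamma>"
proof -
  have "k\<^sup>2 \<le> k * (\<alpha> + \<gamma>)" using assms by (simp add: power2_eq_square mult_left_mono)
  also have "\<dots> \<le> k * \<alpha> + 2 * \<gamma>" using assms by (simp add: distrib_left mult_right_mono)
  also have "k * \<alpha> \<le> k\<^sup>2 / 2 + \<alpha>\<^sup>2 / 2" using sum_squares_bound[of k \<alpha>] by simp
  finally show ?thesis by simp
qed

lemma sq_sum4_le:
  fixes a b c d :: real
  shows "(a + b + c + d)\<^sup>2 \<le> 4 * (a\<^sup>2 + b\<^sup>2 + c\<^sup>2 + d\<^sup>2)"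
proof -
  have "4 * (a\<^sup>2 + b\<^sup>2 + c\<^sup>2 + d\<^sup>2) - (a + b + c + d)\<^sup>2 =
    (a - b)\<^sup>2 + (a - c)\<^sup>2 + (a - d)\<^sup>2 + (b - c)\<^sup>2 + (b - d)\<^sup>2 + (c - d)\<^sup>2"
    by (simp add: power2_eq_square algebra_simps)
  moreover have "\<dots> \<ge> 0" by simp
  ultimately show ?thesis by linarith
qed

text \<open>
  By the Schur complement, \<open>1 / G i i\<close> is \<open>h i i - z\<close> minus the quadratic form of row \<open>i\<close> in \<open>G'\<close>.
  Replacing this form by its mean, and \<open>G'\<close> in the mean by \<open>G\<close>, gives \<open>- z - U\<close> with
  \<open>U = (\<Sum>j. s j * G j j)\<close>; the error \<open>e\<close> consists of \<open>h i i\<close>, the fluctuation of the form and a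
  deterministic remainder \<open>r\<close> of size \<open>2 * \<sigma>\<close>.
\<close>

lemma (in resolvent_minor) self_consistent_error:
  fixes s \<mu> \<nu> :: "'i \<Rightarrow> real"
  assumes Imz: "\<bar>Im z\<bar> \<ge> 1"
    and s: "\<And>j. j \<in> I \<Longrightarrow> 0 \<le> s j" "\<And>j. j \<in> I \<Longrightarrow> s j \<le> \<sigma>"
    and split: "\<And>j. j \<in> J \<Longrightarrow> s j = \<mu> j + \<nu> j"
  shows "(cmod (G i i - 1 / (- z - (\<Sum>j\<in>I. of_real (s j) * G j j))))\<^sup>2 \<le>
    4 * (h i i)\<^sup>2 + 16 * \<sigma>\<^sup>2 + 4 * form_fluctuation J G' \<mu> \<nu> (h i)"
proof -
  define U where "U = (\<Sum>j\<in>I. of_real (s j) * G j j)"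
  define off where "off = (\<Sum>j\<in>J. \<Sum>k\<in>J - {j}. of_real (h i j * h i k) * G' j k)"
  define d1 where "d1 = (\<Sum>j\<in>J. G' j j * of_real (small_sq (h i j) - \<mu> j))"
  define d2 where "d2 = (\<Sum>j\<in>J. G' j j * of_real (large_sq (h i j) - \<nu> j))"
  define r where "r = of_real (s i) * G i i + (\<Sum>j\<in>J. of_real (s j) * (G j j - G' j j))"
  define e where "e = of_real (h i i) - off - d1 - d2 + r"
  have U0: "Im z * Im U \<ge> 0" unfolding U_def by (rule Im_weighted_diag_sign[OF s(1)])
  note sh = norm_inverse_shift_le[OF U0 Imz]
  have G1: "cmod (G i i) \<le> 1"
    using norm_diag_le[OF i] mult_right_mono[OF Imz norm_ge_zero[of "G i i"]] by linarith
  have "(\<Sum>j\<in>J. \<Sum>k\<in>J. of_real (h i j * h i k) * G' j k) =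
      (\<Sum>j\<in>J. of_real (h i j * h i j) * G' j j + (\<Sum>k\<in>J - {j}. of_real (h i j * h i k) * G' j k))"
    by (intro sum.cong refl sum.remove minor.fin)
  also have "\<dots> = (\<Sum>j\<in>J. of_real ((h i j)\<^sup>2) * G' j j) + off"
    unfolding off_def by (simp add: sum.distrib power2_eq_square)
  also have "(\<Sum>j\<in>J. of_real ((h i j)\<^sup>2) * G' j j) = d1 + d2 + (\<Sum>j\<in>J. of_real (s j) * G' j j)"
    unfolding d1_def d2_def sum.distrib[symmetric]
  proof (intro sum.cong refl)
    fix j assume "j \<in> J"
    then have "(h i j)\<^sup>2 = (small_sq (h i j) - \<mu> j) + (large_sq (h i j) - \<nu> j) + s j"
      using small_plus_large[of "h i j"] split[of j] by simp
    then show "of_real ((h i j)\<^sup>2) * G' j j = G' j j * of_real (small_sq (h i j) - \<mu> j) +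
      G' j j * of_real (large_sq (h i j) - \<nu> j) + of_real (s j) * G' j j"
      by (simp only: of_real_add) (simp add: algebra_simps)
  qed
  finally have Q: "(\<Sum>j\<in>J. \<Sum>k\<in>J. of_real (h i j * h i k) * G' j k) =
      d1 + d2 + (\<Sum>j\<in>J. of_real (s j) * G' j j) + off" .
  have "U = of_real (s i) * G i i + (\<Sum>j\<in>J. of_real (s j) * G j j)"
    unfolding U_def by (rule sum.remove[OF fin i])
  then have U: "U = r + (\<Sum>j\<in>J. of_real (s j) * G' j j)"
    unfolding r_def by (simp add: right_diff_distrib sum_subtractf)
  have one: "G i i * (- z - U + e) = 1"
    using schur_complement unfolding Q U e_def by (simp add: algebra_simps)
  have "G i i - 1 / (- z - U) = - (G i i * e) / (- z - U)"
    using one sh(2) by (simp add: field_simps)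
  then have "cmod (G i i - 1 / (- z - U)) = cmod (G i i) * cmod e / cmod (- z - U)"
    by (simp add: norm_mult norm_divide)
  also have "\<dots> \<le> 1 * cmod e / 1"
    using G1 sh(1) Imz by (intro frac_le mult_mono) auto
  finally have k1: "cmod (G i i - 1 / (- z - U)) \<le> cmod e" by simp
  have "cmod (1 / (- z - U)) \<le> 1" using order_trans[OF Imz sh(1)] by (simp add: norm_divide divide_le_eq)
  then have k2: "cmod (G i i - 1 / (- z - U)) \<le> 2"
    using norm_triangle_ineq4[of "G i i" "1 / (- z - U)"] G1 by linarith
  have "cmod r \<le> s i * cmod (G i i) + (\<Sum>j\<in>J. s j * cmod (G j j - G' j j))"
    unfolding r_def using s(1) i
    by (intro order_trans[OF norm_triangle_ineq] add_mono order_trans[OF norm_sum] sum_mono) (auto simp: norm_mult)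
  also have "\<dots> \<le> \<sigma> * 1 + (\<Sum>j\<in>J. \<sigma> * cmod (G j j - G' j j))"
    using s i G1 order_trans[OF s] by (intro add_mono mult_mono sum_mono) auto
  also have "(\<Sum>j\<in>J. \<sigma> * cmod (G j j - G' j j)) = \<sigma> * (\<Sum>j\<in>J. cmod (G j j - G' j j))"
    by (simp add: sum_distrib_left)
  also have "\<dots> \<le> \<sigma> * 1"
  proof (rule mult_left_mono)
    have "1 * (\<Sum>j\<in>J. cmod (G j j - G' j j)) \<le> \<bar>Im z\<bar> * (\<Sum>j\<in>J. cmod (G j j - G' j j))"
      using Imz by (intro mult_right_mono sum_nonneg) auto
    then show "(\<Sum>j\<in>J. cmod (G j j - G' j j)) \<le> 1" using sum_diag_diff_le by simp
    show "0 \<le> \<sigma>" using order_trans[OF s] i by blast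
  qed
  finally have r: "cmod r \<le> 2 * \<sigma>" by simp
  have "cmod e \<le> (\<bar>h i i\<bar> + cmod off + cmod d1 + cmod r) + cmod d2"
    unfolding e_def
    using norm_triangle_ineq[of "of_real (h i i) - off - d1 - d2" r]
      norm_triangle_ineq4[of "of_real (h i i) - off - d1" d2]
      norm_triangle_ineq4[of "of_real (h i i) - off" d1] norm_triangle_ineq4[of "of_real (h i i)" off]
    by simp
  with k1 have "cmod (G i i - 1 / (- z - U)) \<le> (\<bar>h i i\<bar> + cmod off + cmod d1 + cmod r) + cmod d2" by simp
  from sq_le_of_le_add[OF norm_ge_zero k2 this norm_ge_zero]
  have "(cmod (G i i - 1 / (- z - U)))\<^sup>2 \<le> (\<bar>h i i\<bar> + cmod off + cmod d1 + cmod r)\<^sup>2 + 4 * cmod d2" .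
  also have "\<dots> \<le> 4 * (\<bar>h i i\<bar>\<^sup>2 + (cmod off)\<^sup>2 + (cmod d1)\<^sup>2 + (cmod r)\<^sup>2) + 4 * cmod d2"
    by (intro add_right_mono sq_sum4_le)
  also have "(cmod r)\<^sup>2 \<le> 4 * \<sigma>\<^sup>2"
    using power_mono[OF r norm_ge_zero, of 2] by (simp add: power_mult_distrib)
  finally show ?thesis
    unfolding U_def form_fluctuation_def off_def d1_def d2_def by simp
qed

text \<open>
  Row and column \<open>i\<close> are set to zero instead of being deleted, which keeps the index range. The
  matrix is then block diagonal, and its resolvent coincides with that of the minor away from \<open>i\<close>.
\<close>

definition zero_row_col :: "nat \<Rightarrow> (nat \<Rightarrow> nat \<Rightarrow> real) \<Rightarrow> nat \<Rightarrow> nat \<Rightarrow> real" where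
  "zero_row_col i h k l = (if k = i \<or> l = i then 0 else h k l)"

lemma resolvent_minor_zero_row_col:
  assumes sym: "\<And>i j. i < N \<Longrightarrow> j < N \<Longrightarrow> h i j = h j i" and z: "Im z \<noteq> 0" and i: "i < N"
  shows "resolvent_minor {..<N} i h z (resolvent N h z) (resolvent N (zero_row_col i h) z)"
proof -
  interpret G: resolvent_entries "{..<N}" h z "resolvent N h z"
    by (rule resolvent_entries_resolvent[OF sym z])
  have sym': "zero_row_col i h k l = zero_row_col i h l k" if "k < N" "l < N" for k l
    using sym[OF that] by (auto simp: zero_row_col_def)
  interpret G': resolvent_entries "{..<N}" "zero_row_col i h" z "resolvent N (zero_row_col i h) z"
    by (rule resolvent_entries_resolvent[OF sym' z])
  show ?thesis
  proof unfold_locales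
    fix k l assume kl: "k \<in> {..<N} - {i}" "l \<in> {..<N} - {i}"
    have "(\<Sum>m<N. of_real (zero_row_col i h k m) * resolvent N (zero_row_col i h) z m l) =
        (\<Sum>m\<in>{..<N} - {i}. of_real (h k m) * resolvent N (zero_row_col i h) z m l)"
      using kl by (intro sum.mono_neutral_cong_right) (auto simp: zero_row_col_def)
    then show "(\<Sum>m\<in>{..<N} - {i}. of_real (h k m) * resolvent N (zero_row_col i h) z m l) -
        z * resolvent N (zero_row_col i h) z k l = of_bool (k = l)"
      using G'.left_inverse[of k l] kl by simp
  qed (use sym z i in auto)
qed

lemma resolvent_cong:
  assumes "\<And>i j. i < N \<Longrightarrow> j < N \<Longrightarrow> h i j = h' i j"
  shows "resolvent N h z = resolvent N h' z"
proof -
  have "shifted_mat N h z = shifted_mat N h' z"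
    unfolding shifted_mat_def using assms by (intro arg_cong2[where f = "(-)"] cong_mat) auto
  then show ?thesis unfolding resolvent_def by simp
qed

text \<open>
  A symmetric random matrix with independent centred entries and an arbitrary variance profile.
  The errors are governed by bounds \<open>\<sigma>\<close> for the single variances, \<open>S\<close> for their row sums and \<open>\<tau>\<close> for
  the row sums of the absolute third moments.
\<close>

locale centered_symmetric_matrix = prob_space M for M :: "'w measure" +
  fixes N :: nat and X :: "nat \<Rightarrow> nat \<Rightarrow> 'w \<Rightarrow> real" and \<sigma> S \<tau> :: real
  assumes X_sym: "\<And>i j \<omega>. X i j \<omega> = X j i \<omega>"
    and indep_X: "indep_vars (\<lambda>_. borel) (\<lambda>(i, j). X i j) {(i, j). i \<le> j \<and> j < N}"
    and int1: "\<And>i j. i < N \<Longrightarrow> j < N \<Longrightarrow> integrable M (X i j)"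
    and int2: "\<And>i j. i < N \<Longrightarrow> j < N \<Longrightarrow> integrable M (\<lambda>\<omega>. (X i j \<omega>)\<^sup>2)"
    and int3: "\<And>i j. i < N \<Longrightarrow> j < N \<Longrightarrow> integrable M (\<lambda>\<omega>. \<bar>X i j \<omega>\<bar> ^ 3)"
    and mean_X: "\<And>i j. i < N \<Longrightarrow> j < N \<Longrightarrow> expectation (X i j) = 0"
    and var_le: "\<And>i j. i < N \<Longrightarrow> j < N \<Longrightarrow> expectation (\<lambda>\<omega>. (X i j \<omega>)\<^sup>2) \<le> \<sigma>"
    and row_var_le: "\<And>i. i < N \<Longrightarrow> (\<Sum>j<N. expectation (\<lambda>\<omega>. (X i j \<omega>)\<^sup>2)) \<le> S"
    and row_third_le: "\<And>i. i < N \<Longrightarrow> (\<Sum>j<N. expectation (\<lambda>\<omega>. \<bar>X i j \<omega>\<bar> ^ 3)) \<le> \<tau>"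
begin

definition s :: "nat \<Rightarrow> nat \<Rightarrow> real" where
  "s i j = expectation (\<lambda>\<omega>. (X i j \<omega>)\<^sup>2)"

abbreviation G :: "complex \<Rightarrow> 'w \<Rightarrow> nat \<Rightarrow> nat \<Rightarrow> complex" where
  "G z \<omega> \<equiv> resolvent N (\<lambda>i j. X i j \<omega>) z"

abbreviation K :: real where
  "K \<equiv> 4 * \<sigma> + 16 * \<sigma>\<^sup>2 + 8 * \<sigma> * S + 12 * \<tau>"

lemma s_nonneg: "0 \<le> s i j" unfolding s_def by simp

lemma s_sym: "s i j = s j i"
  unfolding s_def using X_sym by metis

lemma entries_measurable: "i < N \<Longrightarrow> j < N \<Longrightarrow> X i j \<in> borel_measurable M"
  using int1 by (rule borel_measurable_integrable)

lemma G_measurable: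
  assumes "Im z \<noteq> 0" "i < N" "j < N"
  shows "(\<lambda>\<omega>. G z \<omega> i j) \<in> borel_measurable M"
  by (rule borel_measurable_resolvent) (use assms X_sym entries_measurable in auto)

lemma G_entries: "Im z \<noteq> 0 \<Longrightarrow> resolvent_entries {..<N} (\<lambda>i j. X i j \<omega>) z (G z \<omega>)"
  by (rule resolvent_entries_resolvent) (rule X_sym)

lemma indep_row:
  assumes i: "i < N"
  shows "indep_vars (\<lambda>_. borel) (\<lambda>j. X i j) {..<N}"
proof -
  let ?e = "\<lambda>j. (min i j, max i j)"
  have "indep_vars (\<lambda>j. PiM {?e j} (\<lambda>_. borel)) (\<lambda>j \<omega>. restrict (\<lambda>p. (\<lambda>(i, j). X i j) p \<omega>) {?e j}) {..<N}"
    by (rule indep_vars_restrict[OF indep_X])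
      (use i in \<open>auto simp: disjoint_family_on_def min_def max_def split: if_splits\<close>)
  from indep_vars_compose2[OF this, of "\<lambda>j w. w (?e j)" "\<lambda>_. borel"]
  have "indep_vars (\<lambda>_. borel) (\<lambda>j \<omega>. restrict (\<lambda>p. (\<lambda>(i, j). X i j) p \<omega>) {?e j} (?e j)) {..<N}"
    by (auto intro!: measurable_component_singleton)
  moreover have "restrict (\<lambda>p. (\<lambda>(i, j). X i j) p \<omega>) {?e j} (?e j) = X i j \<omega>" for j \<omega>
    using X_sym by (auto simp: min_def max_def)
  ultimately show ?thesis by simp
qed

text \<open>
  The minor depends only on the entries outside row \<open>i\<close>, hence is independent of row \<open>i\<close>. Thus
  \<open>form_fluctuation_bound\<close> applies with the entries of its resolvent as constants: its rows have
  norm at most 1 by the Ward identity.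
\<close>

lemma minor_fluctuation:
  fixes z :: complex and i :: nat
  assumes z: "\<bar>Im z\<bar> \<ge> 1" and i: "i < N"
  defines "J \<equiv> {..<N} - {i}"
    and "\<mu> \<equiv> \<lambda>j. expectation (\<lambda>\<omega>. small_sq (X i j \<omega>))"
    and "\<nu> \<equiv> \<lambda>j. expectation (\<lambda>\<omega>. large_sq (X i j \<omega>))"
  defines "\<Phi> \<equiv> \<lambda>\<omega>. form_fluctuation J (resolvent N (zero_row_col i (\<lambda>k l. X k l \<omega>)) z) \<mu> \<nu> (\<lambda>j. X i j \<omega>)"
  shows "integrable M \<Phi>" and "expectation \<Phi> \<le> 2 * \<sigma> * S + 3 * \<tau>"
proof -
  let ?e = "\<lambda>j. (min i j, max i j)"
  let ?Z = "\<lambda>(i, j). X i j"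
  \<comment> \<open>the entries in row \<open>i\<close> off the diagonal, and the entries that determine the minor\<close>
  define A where "A = ?e ` J"
  define B where "B = {(k, l). k \<le> l \<and> l < N \<and> k \<noteq> i \<and> l \<noteq> i}"
  define hB :: "(nat \<times> nat \<Rightarrow> real) \<Rightarrow> nat \<Rightarrow> nat \<Rightarrow> real"
    where "hB w = zero_row_col i (\<lambda>k l. w (min k l, max k l))" for w
  let ?R = "\<lambda>\<omega>. restrict (\<lambda>p. ?Z p \<omega>) A" and ?W = "\<lambda>\<omega>. restrict (\<lambda>p. ?Z p \<omega>) B"
  let ?PA = "PiM A (\<lambda>_. borel :: real measure)" and ?PB = "PiM B (\<lambda>_. borel :: real measure)"
  have Imz: "Im z \<noteq> 0" using z by auto
  have J: "finite J" "\<And>j. j \<in> J \<Longrightarrow> j < N" unfolding J_def by auto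
  have ind: "indep_var ?PA ?R ?PB ?W"
    by (rule indep_var_restrict[OF indep_X])
      (use i in \<open>auto simp: A_def B_def J_def min_def max_def split: if_splits\<close>)
  have eA: "?e j \<in> A" if "j \<in> J" for j using that unfolding A_def by auto
  have eB: "(min k l, max k l) \<in> B" if "k < N" "l < N" "k \<noteq> i" "l \<noteq> i" for k l
    using that unfolding B_def by (auto simp: min_def max_def)
  have R_e: "?R \<omega> (?e j) = X i j \<omega>" if "j \<in> J" for j \<omega>
    using eA[OF that] X_sym by (auto simp: min_def max_def)
  have hB_sym: "hB w k l = hB w l k" for w k l
    by (simp add: hB_def zero_row_col_def min.commute max.commute disj_commute)
  have hB_W: "resolvent N (hB (?W \<omega>)) z = resolvent N (zero_row_col i (\<lambda>k l. X k l \<omega>)) z" for \<omega>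
  proof (rule resolvent_cong)
    fix k l assume "k < N" "l < N"
    then show "hB (?W \<omega>) k l = zero_row_col i (\<lambda>k l. X k l \<omega>) k l"
      using eB[of k l] X_sym by (auto simp: hB_def zero_row_col_def min_def max_def)
  qed
  define F where "F p = ennreal (form_fluctuation J (resolvent N (hB (snd p)) z) \<mu> \<nu> (\<lambda>j. fst p (?e j)))"
    for p :: "(nat \<times> nat \<Rightarrow> real) \<times> (nat \<times> nat \<Rightarrow> real)"
  have F_RW: "F (?R \<omega>, ?W \<omega>) = ennreal (\<Phi> \<omega>)" for \<omega>
    unfolding F_def \<Phi>_def fst_conv snd_conv hB_W form_fluctuation_def
    by (intro arg_cong[where f = ennreal] arg_cong2[where f = "(+)"] arg_cong[where f = cmod]
      arg_cong[where f = "\<lambda>x. (cmod x)\<^sup>2"] sum.cong refl) (use R_e in auto)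
  have mr [measurable]: "(\<lambda>p. fst p (?e j)) \<in> borel_measurable (?PA \<Otimes>\<^sub>M ?PB)" if "j \<in> J" for j
    using measurable_compose[OF measurable_fst measurable_component_singleton[OF eA[OF that]]] .
  have mG [measurable]: "(\<lambda>p. resolvent N (hB (snd p)) z j k) \<in> borel_measurable (?PA \<Otimes>\<^sub>M ?PB)"
    if "j \<in> J" "k \<in> J" for j k
  proof (rule borel_measurable_resolvent[OF hB_sym Imz])
    fix k l assume kl: "k < N" "l < N"
    show "(\<lambda>p. hB (snd p) k l) \<in> borel_measurable (?PA \<Otimes>\<^sub>M ?PB)"
    proof (cases "k = i \<or> l = i")
      case True
      then show ?thesis by (simp add: hB_def zero_row_col_def)
    next
      case False
      then have "(\<lambda>p. snd p (min k l, max k l)) \<in> borel_measurable (?PA \<Otimes>\<^sub>M ?PB)"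
        using measurable_compose[OF measurable_snd measurable_component_singleton[OF eB]] kl by auto
      then show ?thesis using False by (simp add: hB_def zero_row_col_def)
    qed
  qed (use that J in auto)
  have F_meas: "F \<in> borel_measurable (?PA \<Otimes>\<^sub>M ?PB)"
    unfolding F_def form_fluctuation_def by measurable
  have F_le: "(\<integral>\<^sup>+\<omega>. F (?R \<omega>, w) \<partial>M) \<le> ennreal (2 * \<sigma> * S + 3 * \<tau>)" for w
  proof -
    interpret W: resolvent_entries "{..<N}" "hB w" z "resolvent N (hB w) z"
      by (rule resolvent_entries_resolvent[OF hB_sym Imz])
    have row: "(\<Sum>k\<in>J. (cmod (resolvent N (hB w) z j k))\<^sup>2) \<le> 1" if j: "j \<in> J" for j
    proof -
      have jN: "j \<in> {..<N}" using j J by auto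
      let ?T = "\<Sum>k<N. (cmod (resolvent N (hB w) z k j))\<^sup>2"
      have "(\<Sum>k\<in>J. (cmod (resolvent N (hB w) z j k))\<^sup>2) = (\<Sum>k\<in>J. (cmod (resolvent N (hB w) z k j))\<^sup>2)"
        using jN J(2) by (intro sum.cong refl) (simp add: W.G_sym)
      also have "\<dots> \<le> ?T" by (intro sum_mono2) (auto simp: J_def)
      also have "?T \<le> \<bar>Im z\<bar> * ?T" using mult_right_mono[OF z, of ?T] by (simp add: sum_nonneg)
      also have "\<dots> \<le> cmod (resolvent N (hB w) z j j)" by (rule W.sum_norm_sq_le[OF jN])
      also have "\<dots> \<le> 1"
        using W.norm_diag_le[OF jN] mult_right_mono[OF z norm_ge_zero[of "resolvent N (hB w) z j j"]] by linarith
      finally show ?thesis .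
    qed
    have indJ: "indep_vars (\<lambda>_. borel) (\<lambda>j. X i j) J"
      by (rule indep_vars_subset[OF indep_row[OF i]]) (auto simp: J_def)
    note ff = form_fluctuation_bound[of J "\<lambda>j. X i j" "resolvent N (hB w) z" \<sigma>, OF J(1) indJ, folded \<mu>_def \<nu>_def]
    let ?f = "\<lambda>\<omega>. form_fluctuation J (resolvent N (hB w) z) \<mu> \<nu> (\<lambda>j. X i j \<omega>)"
    have intf: "integrable M ?f" by (rule ff(1)) (use i J in \<open>auto intro: int1 int2 int3 mean_X var_le row\<close>)
    have "expectation ?f \<le> 2 * \<sigma> * (\<Sum>j\<in>J. expectation (\<lambda>\<omega>. (X i j \<omega>)\<^sup>2)) + 3 * (\<Sum>j\<in>J. expectation (\<lambda>\<omega>. \<bar>X i j \<omega>\<bar> ^ 3))"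
      by (rule ff(2)) (use i J in \<open>auto intro: int1 int2 int3 mean_X var_le row\<close>)
    also have "\<dots> \<le> 2 * \<sigma> * S + 3 * \<tau>"
    proof (intro add_mono mult_left_mono)
      have "(\<Sum>j\<in>J. expectation (\<lambda>\<omega>. (X i j \<omega>)\<^sup>2)) \<le> (\<Sum>j<N. expectation (\<lambda>\<omega>. (X i j \<omega>)\<^sup>2))"
        by (intro sum_mono2) (auto simp: J_def)
      then show "(\<Sum>j\<in>J. expectation (\<lambda>\<omega>. (X i j \<omega>)\<^sup>2)) \<le> S" using row_var_le[OF i] by simp
      have "(\<Sum>j\<in>J. expectation (\<lambda>\<omega>. \<bar>X i j \<omega>\<bar> ^ 3)) \<le> (\<Sum>j<N. expectation (\<lambda>\<omega>. \<bar>X i j \<omega>\<bar> ^ 3))"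
        by (intro sum_mono2) (auto simp: J_def)
      then show "(\<Sum>j\<in>J. expectation (\<lambda>\<omega>. \<bar>X i j \<omega>\<bar> ^ 3)) \<le> \<tau>" using row_third_le[OF i] by simp
      show "0 \<le> 2 * \<sigma>" using order_trans[OF s_nonneg[of i i, unfolded s_def] var_le[OF i i]] by simp
    qed simp
    finally have E: "expectation ?f \<le> 2 * \<sigma> * S + 3 * \<tau>" .
    have "F (?R \<omega>, w) = ennreal (?f \<omega>)" for \<omega>
      unfolding F_def fst_conv snd_conv form_fluctuation_def
      by (intro arg_cong[where f = ennreal] arg_cong2[where f = "(+)"] arg_cong[where f = cmod]
        arg_cong[where f = "\<lambda>x. (cmod x)\<^sup>2"] sum.cong refl) (use R_e in auto)
    then have "(\<integral>\<^sup>+\<omega>. F (?R \<omega>, w) \<partial>M) = (\<integral>\<^sup>+\<omega>. ennreal (?f \<omega>) \<partial>M)" by simp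
    also have "\<dots> = ennreal (expectation ?f)"
      by (rule nn_integral_eq_integral[OF intf]) (simp add: form_fluctuation_def)
    finally show ?thesis using E by (simp add: ennreal_leI)
  qed
  have Phi0: "0 \<le> \<Phi> \<omega>" for \<omega> by (simp add: \<Phi>_def form_fluctuation_def)
  have nn: "(\<integral>\<^sup>+\<omega>. ennreal (\<Phi> \<omega>) \<partial>M) \<le> ennreal (2 * \<sigma> * S + 3 * \<tau>)"
    using nn_integral_indep_le[OF ind F_meas F_le] unfolding F_RW .
  have "(\<lambda>\<omega>. F (?R \<omega>, ?W \<omega>)) \<in> borel_measurable M"
    using ind by (intro measurable_compose[OF _ F_meas] measurable_Pair) (auto dest: indep_var_rv1 indep_var_rv2)
  then have "(\<lambda>\<omega>. enn2real (F (?R \<omega>, ?W \<omega>))) \<in> borel_measurable M" by measurable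
  then have meas: "\<Phi> \<in> borel_measurable M" unfolding F_RW using Phi0 by simp
  show int: "integrable M \<Phi>"
  proof (rule integrableI_bounded[OF meas])
    show "(\<integral>\<^sup>+\<omega>. ennreal (norm (\<Phi> \<omega>)) \<partial>M) < \<infinity>"
      using nn Phi0 by (simp add: le_less_trans)
  qed
  have "ennreal (expectation \<Phi>) \<le> ennreal (2 * \<sigma> * S + 3 * \<tau>)"
    using nn nn_integral_eq_integral[OF int] Phi0 by simp
  moreover have "0 \<le> 2 * \<sigma> * S + 3 * \<tau>"
  proof -
    have "0 \<le> \<sigma>" using order_trans[OF s_nonneg[of i i, unfolded s_def] var_le[OF i i]] by simp
    moreover have "0 \<le> S" using row_var_le[OF i] by (rule order_trans[rotated]) (simp add: sum_nonneg)
    moreover have "0 \<le> \<tau>" using row_third_le[OF i] by (rule order_trans[rotated]) (simp add: sum_nonneg)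
    ultimately show ?thesis by simp
  qed
  ultimately show "expectation \<Phi> \<le> 2 * \<sigma> * S + 3 * \<tau>" by simp
qed

lemma expected_self_consistent_error:
  assumes z: "\<bar>Im z\<bar> \<ge> 1" and i: "i < N"
  shows "expectation (\<lambda>\<omega>. (cmod (G z \<omega> i i - 1 / (- z - (\<Sum>j<N. of_real (s i j) * G z \<omega> j j))))\<^sup>2) \<le> K"
proof -
  have Imz: "Im z \<noteq> 0" using z by auto
  define \<mu> where "\<mu> j = expectation (\<lambda>\<omega>. small_sq (X i j \<omega>))" for j
  define \<nu> where "\<nu> j = expectation (\<lambda>\<omega>. large_sq (X i j \<omega>))" for j
  define \<Phi> where "\<Phi> \<omega> = form_fluctuation ({..<N} - {i})
    (resolvent N (zero_row_col i (\<lambda>k l. X k l \<omega>)) z) \<mu> \<nu> (\<lambda>j. X i j \<omega>)" for \<omega>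
  have Phi: "integrable M \<Phi>" "expectation \<Phi> \<le> 2 * \<sigma> * S + 3 * \<tau>"
    using minor_fluctuation[OF z i] unfolding \<Phi>_def[abs_def] \<mu>_def[abs_def] \<nu>_def[abs_def] by auto
  have split: "s i j = \<mu> j + \<nu> j" if j: "j < N" for j
  proof -
    note [measurable] = entries_measurable[OF i j]
    have "integrable M (\<lambda>\<omega>. small_sq (X i j \<omega>))"
      by (rule integrable_const_bound[of _ 1]) (use small_sq_bounds in auto)
    moreover have "integrable M (\<lambda>\<omega>. large_sq (X i j \<omega>))"
      by (rule Bochner_Integration.integrable_bound[OF int3[OF i j]]) (use large_sq_bounds in auto)
    ultimately show ?thesis
      unfolding s_def \<mu>_def \<nu>_def small_plus_large[symmetric] by simp
  qed
  have pointwise: "(cmod (G z \<omega> i i - 1 / (- z - (\<Sum>j<N. of_real (s i j) * G z \<omega> j j))))\<^sup>2 \<le>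
    4 * (X i i \<omega>)\<^sup>2 + 16 * \<sigma>\<^sup>2 + 4 * \<Phi> \<omega>" for \<omega>
  proof -
    interpret R: resolvent_minor "{..<N}" i "\<lambda>k l. X k l \<omega>" z "G z \<omega>"
      "resolvent N (zero_row_col i (\<lambda>k l. X k l \<omega>)) z"
      by (rule resolvent_minor_zero_row_col[OF X_sym Imz i])
    show ?thesis unfolding \<Phi>_def
    proof (rule R.self_consistent_error[OF z s_nonneg])
      show "s i j \<le> \<sigma>" if "j \<in> {..<N}" for j using var_le[OF i] that by (simp add: s_def)
    qed (use split in auto)
  qed
  have "expectation (\<lambda>\<omega>. (cmod (G z \<omega> i i - 1 / (- z - (\<Sum>j<N. of_real (s i j) * G z \<omega> j j))))\<^sup>2) \<le>
    expectation (\<lambda>\<omega>. 4 * (X i i \<omega>)\<^sup>2 + 16 * \<sigma>\<^sup>2 + 4 * \<Phi> \<omega>)"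
    using int2[OF i i] Phi(1) pointwise order_trans[OF zero_le_power2 pointwise]
    by (intro integral_mono') auto
  also have "\<dots> = 4 * s i i + 16 * \<sigma>\<^sup>2 + 4 * expectation \<Phi>"
    using int2[OF i i] Phi(1) by (simp add: prob_space s_def)
  also have "\<dots> \<le> K" using Phi(2) var_le[OF i i] by (simp add: s_def)
  finally show ?thesis .
qed

end

section \<open>Mean-square stability of the self-consistent equation\<close>

lemma weighted_norm_sum_sq_le:
  fixes w :: "'i \<Rightarrow> real" and x :: "'i \<Rightarrow> complex"
  assumes "\<And>j. j \<in> I \<Longrightarrow> 0 \<le> w j"
  shows "(cmod (\<Sum>j\<in>I. of_real (w j) * x j))\<^sup>2 \<le> (\<Sum>j\<in>I. w j) * (\<Sum>j\<in>I. w j * (cmod (x j))\<^sup>2)"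
proof -
  have "cmod (\<Sum>j\<in>I. of_real (w j) * x j) \<le> (\<Sum>j\<in>I. sqrt (w j) * (sqrt (w j) * cmod (x j)))"
    using assms by (intro order_trans[OF norm_sum] sum_mono) (auto simp: norm_mult mult.assoc[symmetric])
  then have "(cmod (\<Sum>j\<in>I. of_real (w j) * x j))\<^sup>2 \<le> (\<Sum>j\<in>I. sqrt (w j) * (sqrt (w j) * cmod (x j)))\<^sup>2"
    by (intro power_mono) auto
  also have "\<dots> \<le> (\<Sum>j\<in>I. (sqrt (w j))\<^sup>2) * (\<Sum>j\<in>I. (sqrt (w j) * cmod (x j))\<^sup>2)"
    by (rule Cauchy_Schwarz_ineq_sum)
  also have "\<dots> = (\<Sum>j\<in>I. w j) * (\<Sum>j\<in>I. w j * (cmod (x j))\<^sup>2)"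
    using assms by (simp add: power_mult_distrib)
  finally show ?thesis .
qed

lemma norm_average_sq_le:
  fixes x :: "nat \<Rightarrow> complex"
  assumes "N > 0"
  shows "(cmod (1 / of_nat N * (\<Sum>i<N. x i)))\<^sup>2 \<le> 1 / real N * (\<Sum>i<N. (cmod (x i))\<^sup>2)"
proof -
  have "(cmod (\<Sum>i<N. x i))\<^sup>2 \<le> real N * (\<Sum>i<N. (cmod (x i))\<^sup>2)"
    using weighted_norm_sum_sq_le[of "{..<N}" "\<lambda>_. 1" x] by simp
  then have "(cmod (\<Sum>i<N. x i))\<^sup>2 / (real N)\<^sup>2 \<le> real N * (\<Sum>i<N. (cmod (x i))\<^sup>2) / (real N)\<^sup>2"
    by (intro divide_right_mono) auto
  then show ?thesis using assms
    by (simp add: norm_mult norm_divide power_divide power2_eq_square)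
qed

lemma (in prob_space) expectation_norm_sq_diff:
  fixes Y :: "'a \<Rightarrow> complex"
  assumes int: "integrable M Y" and int2: "integrable M (\<lambda>\<omega>. (cmod (Y \<omega> - c))\<^sup>2)"
  shows "expectation (\<lambda>\<omega>. (cmod (Y \<omega> - c))\<^sup>2) =
    expectation (\<lambda>\<omega>. (cmod (Y \<omega> - expectation Y))\<^sup>2) + (cmod (expectation Y - c))\<^sup>2"
proof -
  define e where "e = expectation Y"
  have expand: "(cmod (Y \<omega> - e))\<^sup>2 =
    (cmod (Y \<omega> - c))\<^sup>2 - 2 * Re (cnj (e - c) * (Y \<omega> - c)) + (cmod (e - c))\<^sup>2" for \<omega>
    by (simp only: cmod_power2) (simp add: power2_eq_square algebra_simps)
  have i1: "integrable M (\<lambda>\<omega>. cnj (e - c) * (Y \<omega> - c))" using int by simp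
  have "expectation (\<lambda>\<omega>. Re (cnj (e - c) * (Y \<omega> - c))) = Re (expectation (\<lambda>\<omega>. cnj (e - c) * (Y \<omega> - c)))"
    by (rule integral_Re[OF i1])
  also have "expectation (\<lambda>\<omega>. cnj (e - c) * (Y \<omega> - c)) = cnj (e - c) * (e - c)"
    using int by (simp add: e_def prob_space)
  also have "Re \<dots> = (cmod (e - c))\<^sup>2"
    by (metis Re_complex_of_real complex_norm_square mult.commute)
  finally have i2: "expectation (\<lambda>\<omega>. Re (cnj (e - c) * (Y \<omega> - c))) = (cmod (e - c))\<^sup>2" .
  have i3: "integrable M (\<lambda>\<omega>. Re (cnj (e - c) * (Y \<omega> - c)))" using i1 by (rule integrable_Re)
  have "expectation (\<lambda>\<omega>. (cmod (Y \<omega> - e))\<^sup>2) =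
    expectation (\<lambda>\<omega>. (cmod (Y \<omega> - c))\<^sup>2) - 2 * expectation (\<lambda>\<omega>. Re (cnj (e - c) * (Y \<omega> - c))) + (cmod (e - c))\<^sup>2"
  proof -
    have "expectation (\<lambda>\<omega>. f \<omega> - 2 * h \<omega> + q) = expectation f - 2 * expectation h + q"
      if "integrable M f" "integrable M h" for q and f h :: "'a \<Rightarrow> real"
      using that by (simp add: prob_space)
    from this[OF int2 i3] show ?thesis unfolding expand .
  qed
  then have "expectation (\<lambda>\<omega>. (cmod (Y \<omega> - e))\<^sup>2) = expectation (\<lambda>\<omega>. (cmod (Y \<omega> - c))\<^sup>2) - (cmod (e - c))\<^sup>2"
    unfolding i2 by simp
  then show ?thesis unfolding e_def by simp
qed

context centered_symmetric_matrix
begin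

lemma norm_G_diag_le:
  assumes "\<bar>Im z\<bar> \<ge> 1" "i < N"
  shows "cmod (G z \<omega> i i) \<le> 1"
proof -
  interpret R: resolvent_entries "{..<N}" "\<lambda>i j. X i j \<omega>" z "G z \<omega>"
    by (rule G_entries) (use assms in auto)
  show ?thesis
    using R.norm_diag_le[of i] mult_right_mono[OF assms(1) norm_ge_zero[of "G z \<omega> i i"]] assms(2) by simp
qed

lemma integrable_G_diag:
  assumes z: "\<bar>Im z\<bar> \<ge> 1" and i: "i < N"
  shows "integrable M (\<lambda>\<omega>. G z \<omega> i i)" and "integrable M (\<lambda>\<omega>. (cmod (G z \<omega> i i - c))\<^sup>2)"
proof -
  have Imz: "Im z \<noteq> 0" using z by auto
  note [measurable] = G_measurable[OF Imz i i]
  show "integrable M (\<lambda>\<omega>. G z \<omega> i i)"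
    by (rule integrable_const_bound[of _ 1]) (use norm_G_diag_le[OF z i] in auto)
  have "(cmod (G z \<omega> i i - c))\<^sup>2 \<le> (1 + cmod c)\<^sup>2" for \<omega>
    using norm_triangle_ineq4[of "G z \<omega> i i" c] norm_G_diag_le[OF z i, of \<omega>] by (intro power_mono) auto
  then show "integrable M (\<lambda>\<omega>. (cmod (G z \<omega> i i - c))\<^sup>2)"
    by (intro integrable_const_bound[of _ "(1 + cmod c)\<^sup>2"]) auto
qed

text \<open>
  The stability estimate which carries the proof. For any reference values \<open>m\<close>, the diagonal of
  \<open>G\<close> at \<open>i\<close> is compared with \<open>1 / (- z - (\<Sum>j. s i j * m j))\<close>. The two denominators differ by an
  average of \<open>G j j - m j\<close>, up to the self-consistent error; by Cauchy-Schwarz the mean square of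
  this average is at most \<open>S\<close> times the average of the mean squares. Summation over \<open>i\<close> uses that
  column sums of \<open>s\<close> are at most \<open>S\<close> too, and yields the factor \<open>2 * S\<^sup>2 / \<bar>Im z\<bar> ^ 4 \<le> 1 / 2\<close>. Working with
  the sum over \<open>i\<close> rather than with a supremum makes rows near the boundary harmless.
\<close>

lemma mean_square_stability:
  assumes z: "\<bar>Im z\<bar> \<ge> 1" and contraction: "4 * S\<^sup>2 \<le> \<bar>Im z\<bar> ^ 4"
    and m: "\<And>j. j < N \<Longrightarrow> Im z * Im (m j) \<ge> 0"
  shows "(\<Sum>i<N. expectation (\<lambda>\<omega>. (cmod (G z \<omega> i i - t i))\<^sup>2)) \<le>
    (\<Sum>j<N. expectation (\<lambda>\<omega>. (cmod (G z \<omega> j j - m j))\<^sup>2)) / 2 + 4 * real N * K +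
    4 * (\<Sum>i<N. (cmod (1 / (- z - (\<Sum>j<N. of_real (s i j) * m j)) - t i))\<^sup>2)"
proof -
  define \<eta> where "\<eta> = \<bar>Im z\<bar>"
  have eta: "\<eta> \<ge> 1" "4 * S\<^sup>2 \<le> \<eta> ^ 4" using z contraction unfolding \<eta>_def by auto
  have Imz: "Im z \<noteq> 0" using z by auto
  define U where "U \<omega> i = (\<Sum>j<N. of_real (s i j) * G z \<omega> j j)" for \<omega> i
  define u where "u i = (\<Sum>j<N. of_real (s i j) * m j)" for i
  define \<kappa> where "\<kappa> \<omega> i = (cmod (G z \<omega> i i - 1 / (- z - U \<omega> i)))\<^sup>2" for \<omega> i
  define D where "D \<omega> j = (cmod (G z \<omega> j j - m j))\<^sup>2" for \<omega> j
  have u0: "Im z * Im (u i) \<ge> 0" for i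
  proof -
    have "Im z * Im (u i) = (\<Sum>j<N. s i j * (Im z * Im (m j)))"
      unfolding u_def by (simp add: sum_distrib_left mult_ac)
    also have "\<dots> \<ge> 0" by (intro sum_nonneg mult_nonneg_nonneg s_nonneg m) auto
    finally show ?thesis .
  qed
  have U0: "Im z * Im (U \<omega> i) \<ge> 0" for \<omega> i
  proof -
    interpret R: resolvent_entries "{..<N}" "\<lambda>i j. X i j \<omega>" z "G z \<omega>" by (rule G_entries[OF Imz])
    show ?thesis unfolding U_def by (rule R.Im_weighted_diag_sign[OF s_nonneg])
  qed
  have S_row: "(\<Sum>j<N. s i j) \<le> S" if "i < N" for i using row_var_le[OF that] by (simp add: s_def)
  have S0: "0 \<le> S" if "i < N" for i using S_row[OF that] by (rule order_trans[rotated]) (simp add: sum_nonneg s_nonneg)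
  have pointwise: "(cmod (G z \<omega> i i - t i))\<^sup>2 \<le> 2 * S / \<eta> ^ 4 * (\<Sum>j<N. s i j * D \<omega> j) + 4 * \<kappa> \<omega> i +
      4 * (cmod (1 / (- z - u i) - t i))\<^sup>2" if i: "i < N" for \<omega> i
  proof -
    let ?x = "cmod (1 / (- z - U \<omega> i) - 1 / (- z - u i))" and ?y = "cmod (G z \<omega> i i - 1 / (- z - U \<omega> i))"
      and ?w = "cmod (1 / (- z - u i) - t i)"
    have "G z \<omega> i i - t i = (1 / (- z - U \<omega> i) - 1 / (- z - u i)) + (G z \<omega> i i - 1 / (- z - U \<omega> i)) + (1 / (- z - u i) - t i)"
      by simp
    also have "cmod \<dots> \<le> ?x + ?y + ?w"
      by (intro order_trans[OF norm_triangle_ineq] add_right_mono norm_triangle_ineq)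
    finally have "cmod (G z \<omega> i i - t i) \<le> ?x + ?y + ?w" .
    then have "(cmod (G z \<omega> i i - t i))\<^sup>2 \<le> (?x + ?y + ?w)\<^sup>2" by (intro power_mono) auto
    \<comment> \<open>the averaged term gets the smaller weight, because its coefficient must leave a contraction\<close>
    also have "\<dots> \<le> 2 * ?x\<^sup>2 + 4 * ?y\<^sup>2 + 4 * ?w\<^sup>2"
    proof -
      have "2 * x\<^sup>2 + 4 * y\<^sup>2 + 4 * w\<^sup>2 = (x + y + w)\<^sup>2 + (x - y - w)\<^sup>2 + 2 * (y - w)\<^sup>2" for x y w :: real
        by (simp add: power2_eq_square algebra_simps)
      then show ?thesis by simp
    qed
    also have "?x\<^sup>2 \<le> S / \<eta> ^ 4 * (\<Sum>j<N. s i j * D \<omega> j)"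
    proof -
      have "?x \<le> cmod (U \<omega> i - u i) / \<eta>\<^sup>2"
        unfolding \<eta>_def by (rule norm_inverse_shift_diff_le[OF U0 u0 z])
      then have "?x\<^sup>2 \<le> (cmod (U \<omega> i - u i) / \<eta>\<^sup>2)\<^sup>2" by (intro power_mono) auto
      also have "\<dots> = (cmod (U \<omega> i - u i))\<^sup>2 / \<eta> ^ 4" by (simp add: power_divide flip: power_mult)
      also have "U \<omega> i - u i = (\<Sum>j<N. of_real (s i j) * (G z \<omega> j j - m j))"
        unfolding U_def u_def by (simp add: right_diff_distrib sum_subtractf)
      also have "(cmod (\<Sum>j<N. of_real (s i j) * (G z \<omega> j j - m j)))\<^sup>2 \<le> (\<Sum>j<N. s i j) * (\<Sum>j<N. s i j * D \<omega> j)"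
        unfolding D_def by (rule weighted_norm_sum_sq_le[OF s_nonneg])
      also have "\<dots> \<le> S * (\<Sum>j<N. s i j * D \<omega> j)"
        by (intro mult_right_mono S_row i sum_nonneg mult_nonneg_nonneg s_nonneg) (simp add: D_def)
      finally show ?thesis using eta by (simp add: divide_right_mono)
    qed
    finally show ?thesis unfolding \<kappa>_def by (simp add: mult.assoc)
  qed
  have int_D: "integrable M (\<lambda>\<omega>. D \<omega> j)" if "j < N" for j
    unfolding D_def by (rule integrable_G_diag(2)[OF z that])
  have int_\<kappa>: "integrable M (\<lambda>\<omega>. \<kappa> \<omega> i)" if i: "i < N" for i
  proof -
    have [measurable]: "(\<lambda>\<omega>. G z \<omega> j j) \<in> borel_measurable M" if "j < N" for j
      by (rule G_measurable[OF Imz that that])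
    have m1: "(\<lambda>\<omega>. U \<omega> i) \<in> borel_measurable M" unfolding U_def by (intro borel_measurable_sum borel_measurable_times) auto
    have m2: "(\<lambda>\<omega>. \<kappa> \<omega> i) \<in> borel_measurable M" unfolding \<kappa>_def using m1 i by measurable
    have "\<kappa> \<omega> i \<le> 2\<^sup>2" for \<omega>
      unfolding \<kappa>_def
    proof (intro power_mono)
      have "cmod (1 / (- z - U \<omega> i)) \<le> 1"
        using order_trans[OF z norm_inverse_shift_le(1)[OF U0 z]] by (simp add: norm_divide divide_le_eq)
      then show "cmod (G z \<omega> i i - 1 / (- z - U \<omega> i)) \<le> 2"
        using norm_triangle_ineq4[of "G z \<omega> i i" "1 / (- z - U \<omega> i)"] norm_G_diag_le[OF z i, of \<omega>] by linarith
    qed auto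
    moreover have "0 \<le> \<kappa> \<omega> i" for \<omega> by (simp add: \<kappa>_def)
    ultimately show ?thesis by (intro integrable_const_bound[OF _ m2, of "2\<^sup>2"]) auto
  qed
  have E_\<kappa>: "expectation (\<lambda>\<omega>. \<kappa> \<omega> i) \<le> K" if "i < N" for i
    unfolding \<kappa>_def U_def by (rule expected_self_consistent_error[OF z that])
  let ?c = "2 * S / \<eta> ^ 4"
  have E_row: "expectation (\<lambda>\<omega>. (cmod (G z \<omega> i i - t i))\<^sup>2) \<le>
      ?c * (\<Sum>j<N. s i j * expectation (\<lambda>\<omega>. D \<omega> j)) + 4 * K + 4 * (cmod (1 / (- z - u i) - t i))\<^sup>2"
    if i: "i < N" for i
  proof -
    have int_sum: "integrable M (\<lambda>\<omega>. \<Sum>j<N. s i j * D \<omega> j)"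
      by (intro Bochner_Integration.integrable_sum integrable_mult_right int_D) auto
    have "expectation (\<lambda>\<omega>. (cmod (G z \<omega> i i - t i))\<^sup>2) \<le>
        expectation (\<lambda>\<omega>. ?c * (\<Sum>j<N. s i j * D \<omega> j) + 4 * \<kappa> \<omega> i + 4 * (cmod (1 / (- z - u i) - t i))\<^sup>2)"
      by (intro integral_mono integrable_G_diag(2)[OF z i] Bochner_Integration.integrable_add
        integrable_mult_right int_sum int_\<kappa>[OF i] integrable_const pointwise[OF i])
    also have "\<dots> = ?c * expectation (\<lambda>\<omega>. \<Sum>j<N. s i j * D \<omega> j) + 4 * expectation (\<lambda>\<omega>. \<kappa> \<omega> i) +
        4 * (cmod (1 / (- z - u i) - t i))\<^sup>2"
    proof -
      have "expectation (\<lambda>\<omega>. a * f \<omega> + 4 * h \<omega> + q) = a * expectation f + 4 * expectation h + q"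
        if "integrable M f" "integrable M h" for a q and f h :: "'w \<Rightarrow> real"
        using that by (simp add: prob_space)
      from this[OF int_sum int_\<kappa>[OF i]] show ?thesis .
    qed
    also have "expectation (\<lambda>\<omega>. \<Sum>j<N. s i j * D \<omega> j) = (\<Sum>j<N. s i j * expectation (\<lambda>\<omega>. D \<omega> j))"
      using int_D by (subst Bochner_Integration.integral_sum) auto
    also have "?c * (\<Sum>j<N. s i j * expectation (\<lambda>\<omega>. D \<omega> j)) + 4 * expectation (\<lambda>\<omega>. \<kappa> \<omega> i) +
        4 * (cmod (1 / (- z - u i) - t i))\<^sup>2 \<le>
        ?c * (\<Sum>j<N. s i j * expectation (\<lambda>\<omega>. D \<omega> j)) + 4 * K + 4 * (cmod (1 / (- z - u i) - t i))\<^sup>2"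
      by (intro add_right_mono add_left_mono mult_left_mono E_\<kappa> i) simp
    finally show ?thesis .
  qed
  have "(\<Sum>i<N. expectation (\<lambda>\<omega>. (cmod (G z \<omega> i i - t i))\<^sup>2)) \<le>
      (\<Sum>i<N. ?c * (\<Sum>j<N. s i j * expectation (\<lambda>\<omega>. D \<omega> j)) + 4 * K + 4 * (cmod (1 / (- z - u i) - t i))\<^sup>2)"
    by (intro sum_mono E_row) auto
  also have "\<dots> = ?c * (\<Sum>i<N. \<Sum>j<N. s i j * expectation (\<lambda>\<omega>. D \<omega> j)) + 4 * real N * K +
      4 * (\<Sum>i<N. (cmod (1 / (- z - u i) - t i))\<^sup>2)"
    by (simp only: sum.distrib sum_distrib_left[symmetric] sum_constant card_lessThan)
      (simp add: algebra_simps)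
  also have "(\<Sum>i<N. \<Sum>j<N. s i j * expectation (\<lambda>\<omega>. D \<omega> j)) = (\<Sum>j<N. (\<Sum>i<N. s j i) * expectation (\<lambda>\<omega>. D \<omega> j))"
    by (subst sum.swap) (simp add: sum_distrib_right s_sym)
  also have "?c * \<dots> \<le> ?c * (\<Sum>j<N. S * expectation (\<lambda>\<omega>. D \<omega> j))"
  proof (cases "N = 0")
    case False
    then have "0 \<le> S" using S0[of 0] by simp
    then show ?thesis using eta
      by (intro mult_left_mono sum_mono mult_right_mono S_row) (auto simp: D_def)
  qed simp
  also have "\<dots> = (2 * S\<^sup>2 / \<eta> ^ 4) * (\<Sum>j<N. expectation (\<lambda>\<omega>. D \<omega> j))"
    by (simp add: sum_distrib_left[symmetric] power2_eq_square)
  also have "\<dots> \<le> (1 / 2) * (\<Sum>j<N. expectation (\<lambda>\<omega>. D \<omega> j))"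
    using eta by (intro mult_right_mono sum_nonneg) (auto simp: divide_le_eq D_def)
  finally show ?thesis unfolding u_def D_def by simp
qed

text \<open>
  The reference values are the means \<open>m i\<close> of the diagonal entries. Among all constants the mean
  minimises the mean-square deviation, so the left-hand side of \<open>mean_square_stability\<close> dominates
  the sum on its right-hand side, which is then absorbed.
\<close>

lemma sum_variance_G_diag_le:
  assumes z: "\<bar>Im z\<bar> \<ge> 1" and contraction: "4 * S\<^sup>2 \<le> \<bar>Im z\<bar> ^ 4"
  shows "(\<Sum>i<N. expectation (\<lambda>\<omega>. (cmod (G z \<omega> i i - expectation (\<lambda>\<omega>. G z \<omega> i i)))\<^sup>2)) \<le> 8 * real N * K"
proof -
  define m where "m i = expectation (\<lambda>\<omega>. G z \<omega> i i)" for i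
  define c where "c i = 1 / (- z - (\<Sum>j<N. of_real (s i j) * m j))" for i
  have "Im z * Im (m j) \<ge> 0" if j: "j < N" for j
  proof -
    have "Im z * Im (m j) = expectation (\<lambda>\<omega>. Im z * Im (G z \<omega> j j))"
      unfolding m_def using integrable_G_diag(1)[OF z j] by (simp add: integral_Im)
    also have "\<dots> \<ge> 0"
    proof (intro Bochner_Integration.integral_nonneg)
      fix \<omega>
      interpret R: resolvent_entries "{..<N}" "\<lambda>i j. X i j \<omega>" z "G z \<omega>" by (rule G_entries) (use z in auto)
      show "0 \<le> Im z * Im (G z \<omega> j j)" using R.Im_diag_sign j by simp
    qed
    finally show ?thesis .
  qed
  from mean_square_stability[OF z contraction, of m c, OF this, folded c_def]
  have "(\<Sum>i<N. expectation (\<lambda>\<omega>. (cmod (G z \<omega> i i - c i))\<^sup>2)) \<le>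
    (\<Sum>j<N. expectation (\<lambda>\<omega>. (cmod (G z \<omega> j j - m j))\<^sup>2)) / 2 + 4 * real N * K"
    by (simp only: diff_self norm_zero zero_power2 sum.neutral_const mult_zero_right add_0_right)
  moreover have "(\<Sum>j<N. expectation (\<lambda>\<omega>. (cmod (G z \<omega> j j - m j))\<^sup>2)) \<le>
    (\<Sum>i<N. expectation (\<lambda>\<omega>. (cmod (G z \<omega> i i - c i))\<^sup>2))"
  proof (intro sum_mono)
    fix i assume "i \<in> {..<N}"
    then have i: "i < N" by simp
    from expectation_norm_sq_diff[OF integrable_G_diag(1)[OF z i] integrable_G_diag(2)[OF z i, of "c i"]]
    show "expectation (\<lambda>\<omega>. (cmod (G z \<omega> i i - m i))\<^sup>2) \<le> expectation (\<lambda>\<omega>. (cmod (G z \<omega> i i - c i))\<^sup>2)"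
      unfolding m_def by (simp only: le_add_same_cancel1 zero_le_power2)
  qed
  ultimately show ?thesis unfolding m_def by linarith
qed

text \<open>
  Both the reference values and the targets are the constant \<open>w\<close>. What remains is the amount by
  which \<open>w\<close> fails to solve the self-consistent equation of row \<open>i\<close>.
\<close>

lemma sum_mean_square_distance_le:
  assumes z: "\<bar>Im z\<bar> \<ge> 1" and contraction: "4 * S\<^sup>2 \<le> \<bar>Im z\<bar> ^ 4" and w: "Im z * Im w \<ge> 0"
  shows "(\<Sum>i<N. expectation (\<lambda>\<omega>. (cmod (G z \<omega> i i - w))\<^sup>2)) \<le> 8 * real N * K +
    8 * (\<Sum>i<N. (cmod (1 / (- z - of_real (\<Sum>j<N. s i j) * w) - w))\<^sup>2)"
  using mean_square_stability[OF z contraction, of "\<lambda>_. w" "\<lambda>_. w"] w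
  by (simp add: sum_distrib_right)

definition trace_avg :: "complex \<Rightarrow> 'w \<Rightarrow> complex" where
  "trace_avg z \<omega> = 1 / of_nat N * (\<Sum>i<N. G z \<omega> i i)"

lemma integrable_trace_avg:
  assumes z: "\<bar>Im z\<bar> \<ge> 1"
  shows "integrable M (trace_avg z)"
  unfolding trace_avg_def[abs_def]
  by (intro integrable_mult_right Bochner_Integration.integrable_sum integrable_G_diag(1)[OF z]) auto

lemma expectation_average_diff_sq_le:
  assumes z: "\<bar>Im z\<bar> \<ge> 1" and N: "N > 0"
  shows "expectation (\<lambda>\<omega>. (cmod (trace_avg z \<omega> - 1 / of_nat N * (\<Sum>i<N. c i)))\<^sup>2) \<le>
      1 / real N * (\<Sum>i<N. expectation (\<lambda>\<omega>. (cmod (G z \<omega> i i - c i))\<^sup>2))"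
    and "integrable M (\<lambda>\<omega>. (cmod (trace_avg z \<omega> - 1 / of_nat N * (\<Sum>i<N. c i)))\<^sup>2)"
proof -
  have le: "(cmod (trace_avg z \<omega> - 1 / of_nat N * (\<Sum>i<N. c i)))\<^sup>2 \<le>
    1 / real N * (\<Sum>i<N. (cmod (G z \<omega> i i - c i))\<^sup>2)" for \<omega>
    using norm_average_sq_le[OF N, of "\<lambda>i. G z \<omega> i i - c i"]
    by (simp add: trace_avg_def sum_subtractf right_diff_distrib)
  have int: "integrable M (\<lambda>\<omega>. 1 / real N * (\<Sum>i<N. (cmod (G z \<omega> i i - c i))\<^sup>2))"
    by (intro integrable_mult_right Bochner_Integration.integrable_sum integrable_G_diag(2)[OF z]) auto
  have meas: "trace_avg z \<in> borel_measurable M"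
    using integrable_trace_avg[OF z] by (rule borel_measurable_integrable)
  show int2: "integrable M (\<lambda>\<omega>. (cmod (trace_avg z \<omega> - 1 / of_nat N * (\<Sum>i<N. c i)))\<^sup>2)"
  proof (rule Bochner_Integration.integrable_bound[OF int])
    show "AE \<omega> in M. norm ((cmod (trace_avg z \<omega> - 1 / of_nat N * (\<Sum>i<N. c i)))\<^sup>2) \<le>
        norm (1 / real N * (\<Sum>i<N. (cmod (G z \<omega> i i - c i))\<^sup>2))"
      by (intro AE_I2) (simp only: real_norm_def abs_power2, rule order_trans[OF le abs_ge_self])
  qed (use meas in measurable)
  have "expectation (\<lambda>\<omega>. (cmod (trace_avg z \<omega> - 1 / of_nat N * (\<Sum>i<N. c i)))\<^sup>2) \<le>
    expectation (\<lambda>\<omega>. 1 / real N * (\<Sum>i<N. (cmod (G z \<omega> i i - c i))\<^sup>2))"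
    by (intro integral_mono int int2 le)
  also have "\<dots> = 1 / real N * (\<Sum>i<N. expectation (\<lambda>\<omega>. (cmod (G z \<omega> i i - c i))\<^sup>2))"
    using integrable_G_diag(2)[OF z] by (simp add: Bochner_Integration.integral_sum)
  finally show "expectation (\<lambda>\<omega>. (cmod (trace_avg z \<omega> - 1 / of_nat N * (\<Sum>i<N. c i)))\<^sup>2) \<le>
      1 / real N * (\<Sum>i<N. expectation (\<lambda>\<omega>. (cmod (G z \<omega> i i - c i))\<^sup>2))" .
qed

lemma complex_variance_trace_avg_le:
  assumes z: "\<bar>Im z\<bar> \<ge> 1" and contraction: "4 * S\<^sup>2 \<le> \<bar>Im z\<bar> ^ 4" and N: "N > 0"
  shows "complex_variance M (trace_avg z) \<le> 8 * K"
proof -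
  let ?m = "\<lambda>i. expectation (\<lambda>\<omega>. G z \<omega> i i)"
  have "expectation (trace_avg z) = 1 / of_nat N * (\<Sum>i<N. ?m i)"
    unfolding trace_avg_def[abs_def] using integrable_G_diag(1)[OF z]
    by (simp add: Bochner_Integration.integral_sum)
  then have "complex_variance M (trace_avg z) \<le>
      1 / real N * (\<Sum>i<N. expectation (\<lambda>\<omega>. (cmod (G z \<omega> i i - ?m i))\<^sup>2))"
    using expectation_average_diff_sq_le(1)[OF z N, of ?m] unfolding complex_variance_def by simp
  also have "\<dots> \<le> 1 / real N * (8 * real N * K)"
    by (intro mult_left_mono sum_variance_G_diag_le z contraction) auto
  finally show ?thesis using N by simp
qed

lemma norm_expectation_trace_avg_diff_sq_le:
  assumes z: "\<bar>Im z\<bar> \<ge> 1" and contraction: "4 * S\<^sup>2 \<le> \<bar>Im z\<bar> ^ 4" and N: "N > 0"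
    and w: "Im z * Im w \<ge> 0"
  shows "(cmod (expectation (trace_avg z) - w))\<^sup>2 \<le> 8 * K +
    8 * (1 / real N * (\<Sum>i<N. (cmod (1 / (- z - of_real (\<Sum>j<N. s i j) * w) - w))\<^sup>2))"
proof -
  have avg: "1 / of_nat N * (\<Sum>i<N. w) = w" using N by simp
  have "(cmod (expectation (trace_avg z) - w))\<^sup>2 \<le> expectation (\<lambda>\<omega>. (cmod (trace_avg z \<omega> - w))\<^sup>2)"
    using expectation_norm_sq_diff[OF integrable_trace_avg[OF z], of w]
      expectation_average_diff_sq_le(2)[OF z N, of "\<lambda>_. w", unfolded avg] by simp
  also have "\<dots> \<le> 1 / real N * (\<Sum>i<N. expectation (\<lambda>\<omega>. (cmod (G z \<omega> i i - w))\<^sup>2))"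
    using expectation_average_diff_sq_le(1)[OF z N, of "\<lambda>_. w", unfolded avg] .
  also have "\<dots> \<le> 1 / real N * (8 * real N * K +
    8 * (\<Sum>i<N. (cmod (1 / (- z - of_real (\<Sum>j<N. s i j) * w) - w))\<^sup>2))"
    by (intro mult_left_mono sum_mean_square_distance_le z contraction w) auto
  also have "\<dots> = 8 * K + 8 * (1 / real N * (\<Sum>i<N. (cmod (1 / (- z - of_real (\<Sum>j<N. s i j) * w) - w))\<^sup>2))"
    using N by (simp add: distrib_left)
  finally show ?thesis .
qed

end

section \<open>The Stieltjes transform of the semicircle law\<close>

text \<open>
  The two solutions of \<open>z = - v * (q + 1 / q)\<close> have product 1. Neither lies on the unit circle,
  where \<open>q + 1 / q\<close> is real, so one of them lies strictly inside.
\<close>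

lemma joukowski_inner_root:
  fixes z :: complex and v :: real
  assumes "v > 0" "Im z \<noteq> 0"
  obtains q where "q \<noteq> 0" "cmod q < 1" "z = - of_real v * (q + 1 / q)"
proof -
  define u where "u = - z / of_real v"
  define s where "s = csqrt (u\<^sup>2 - 4)"
  define q1 where "q1 = (u + s) / 2"
  define q2 where "q2 = (u - s) / 2"
  have prod: "q1 * q2 = 1"
    unfolding q1_def q2_def s_def by (simp add: algebra_simps power2_eq_square[symmetric])
  then have nz: "q1 \<noteq> 0" "q2 \<noteq> 0" by auto
  have sum: "q1 + q2 = u" unfolding q1_def q2_def by (simp add: field_simps)
  have inv: "q2 = 1 / q1" "q1 = 1 / q2" using prod nz by (simp_all add: field_simps)
  have z: "z = - of_real v * (q1 + q2)"
    unfolding sum u_def using assms by simp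
  have nprod: "cmod q1 * cmod q2 = 1" using prod by (metis norm_mult norm_one)
  have "cmod q1 \<noteq> 1"
  proof
    assume a: "cmod q1 = 1"
    then have "q1 * cnj q1 = 1" by (simp flip: complex_norm_square)
    then have "q1 * q2 = q1 * cnj q1" using prod by simp
    then have "q2 = cnj q1" using nz by simp
    then have "Im (q1 + q2) = 0" by simp
    then have "Im z = 0" unfolding z by simp
    with assms show False by simp
  qed
  then consider "cmod q1 < 1" | "cmod q1 > 1" by linarith
  then show thesis
  proof cases
    case 1
    then show ?thesis using that[of q1] nz z inv(1) by simp
  next
    case 2
    moreover have "cmod q1 * cmod q2 \<ge> cmod q1 * 1" if "cmod q2 \<ge> 1"
      using that by (intro mult_left_mono) auto
    ultimately have "cmod q2 < 1" using nprod by linarith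
    then show ?thesis using that[of q2] nz z inv(2) by (simp add: add.commute)
  qed
qed

text \<open>
  The truncated generating function of the Chebyshev polynomials of the second kind, with the
  exact remainder.
\<close>

lemma chebyshev_generating_partial_sum:
  fixes q :: complex and t :: real
  shows "(1 - 2 * q * of_real (cos t) + q\<^sup>2) * (\<Sum>k<n. q ^ k * of_real (sin (real (Suc k) * t))) =
    of_real (sin t) - q ^ n * of_real (sin (real (Suc n) * t)) + q ^ Suc n * of_real (sin (real n * t))"
proof (induction n)
  case 0
  then show ?case by simp
next
  case (Suc n)
  have "sin (real (Suc (Suc n)) * t) + sin (real n * t) = 2 * cos t * sin (real (Suc n) * t)"
    using sin_add[of "real (Suc n) * t" t] sin_diff[of "real (Suc n) * t" t]
    by (simp add: algebra_simps)
  then have "sin (real (Suc (Suc n)) * t) = 2 * cos t * sin (real (Suc n) * t) - sin (real n * t)"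
    by simp
  note * = this
  have "complex_of_real (sin (real (Suc (Suc n)) * t)) =
     2 * of_real (cos t) * of_real (sin (real (Suc n) * t)) - of_real (sin (real n * t))"
    unfolding * by simp
  note ** = this
  show ?case
    unfolding sum.lessThan_Suc distrib_left Suc.IH **
    by (simp add: algebra_simps power2_eq_square)
qed

lemma integral_sin_sin:
  "((\<lambda>t. sin t * sin (real (Suc k) * t)) has_integral (if k = 0 then pi / 2 else 0)) {0..pi}"
proof (cases "k = 0")
  case True
  have "((\<lambda>t. sin t * sin t) has_integral ((pi - sin pi * cos pi) / 2 - (0 - sin 0 * cos 0) / 2)) {0..pi}"
  proof (rule fundamental_theorem_of_calculus)
    fix t :: real
    have "1 - cos t * cos t + sin t * sin t = 2 * (sin t * sin t)"
      using sin_cos_squared_add[of t] by (simp add: power2_eq_square)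
    then show "((\<lambda>t. (t - sin t * cos t) / 2) has_vector_derivative sin t * sin t) (at t within {0..pi})"
      by (auto intro!: derivative_eq_intros simp: has_real_derivative_iff_has_vector_derivative[symmetric])
  qed auto
  then show ?thesis using True by simp
next
  case False
  define m where "m = real (Suc k)"
  have m: "m - 1 \<noteq> 0" "m + 1 \<noteq> 0" using False unfolding m_def by auto
  let ?F = "\<lambda>t. (sin ((m - 1) * t) / (m - 1) - sin ((m + 1) * t) / (m + 1)) / 2"
  have "((\<lambda>t. sin t * sin (m * t)) has_integral (?F pi - ?F 0)) {0..pi}"
  proof (rule fundamental_theorem_of_calculus)
    fix t :: real
    have "(cos ((m - 1) * t) - cos ((m + 1) * t)) / 2 = sin t * sin (m * t)"
      by (simp add: algebra_simps cos_add cos_diff)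
    then show "(?F has_vector_derivative sin t * sin (m * t)) (at t within {0..pi})"
      using m by (auto intro!: derivative_eq_intros simp: has_real_derivative_iff_has_vector_derivative[symmetric])
  qed auto
  moreover have "sin ((m - 1) * pi) = 0" "sin ((m + 1) * pi) = 0"
    unfolding m_def using sin_npi[of k] sin_npi[of "k + 2"] by (auto simp: algebra_simps)
  ultimately show ?thesis using False by (simp add: m_def)
qed

text \<open>
  The denominator factors as \<open>(1 - q * cis t) * (1 - q * cis (- t))\<close>.
\<close>

lemma norm_poisson_denominator_ge:
  fixes q :: complex
  assumes "cmod q < 1"
  shows "(1 - cmod q)\<^sup>2 \<le> cmod (1 - 2 * q * of_real (cos t) + q\<^sup>2)"
proof -
  have "(1 - q * cis t) * (1 - q * cis (- t)) = 1 - q * (cis t + cis (- t)) + q\<^sup>2 * (cis t * cis (- t))"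
    by (simp add: algebra_simps power2_eq_square)
  also have "cis t * cis (- t) = 1" by (simp add: cis_mult)
  also have "cis t + cis (- t) = 2 * of_real (cos t)" by (simp add: complex_eq_iff)
  finally have "1 - 2 * q * of_real (cos t) + q\<^sup>2 = (1 - q * cis t) * (1 - q * cis (- t))"
    by (simp add: mult_ac)
  moreover have "1 - cmod q \<le> cmod (1 - q * cis s)" for s
    using norm_triangle_ineq2[of 1 "q * cis s"] by (simp add: norm_mult)
  ultimately show ?thesis using assms
    by (simp add: norm_mult power2_eq_square mult_mono)
qed

text \<open>
  Expanding \<open>sin t / (1 - 2 * q * cos t + q\<^sup>2)\<close> in the generating function leaves
  \<open>\<Sum>k. q ^ k * sin t * sin ((k + 1) * t)\<close>, of which only \<open>k = 0\<close> contributes to the integral. The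
  remainder after \<open>n\<close> terms is of order \<open>q ^ n\<close> uniformly in \<open>t\<close>.
\<close>

lemma integral_sin_sq_over_poisson_denominator:
  fixes q :: complex
  assumes q: "cmod q < 1"
  shows "((\<lambda>t. of_real ((sin t)\<^sup>2) / (1 - 2 * q * of_real (cos t) + q\<^sup>2)) has_integral of_real (pi / 2)) {0..pi}"
    (is "(?f has_integral _) _")
proof -
  let ?D = "\<lambda>t. 1 - 2 * q * of_real (cos t) + q\<^sup>2"
  define c where "c = (1 - cmod q)\<^sup>2"
  have c: "c > 0" using q by (simp add: c_def)
  have Dc: "c \<le> cmod (?D t)" for t unfolding c_def by (rule norm_poisson_denominator_ge[OF q])
  then have D: "?D t \<noteq> 0" for t using c by (metis norm_zero not_less)
  let ?s = "\<lambda>n t. \<Sum>k<n. q ^ k * of_real (sin t * sin (real (Suc k) * t))"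
  have "continuous_on {0..pi} ?f" by (intro continuous_intros) (use D in auto)
  then have int_f: "?f integrable_on {0..pi}" by (rule integrable_continuous_interval)
  have int_s: "(?s (Suc n) has_integral of_real (pi / 2)) {0..pi}" for n
  proof -
    have "(?s (Suc n) has_integral (\<Sum>k<Suc n. q ^ k * of_real (if k = 0 then pi / 2 else 0))) {0..pi}"
      by (intro has_integral_sum has_integral_mult_right has_integral_of_real integral_sin_sin) auto
    also have "(\<Sum>k<Suc n. q ^ k * of_real (if k = 0 then pi / 2 else 0)) = (of_real (pi / 2) :: complex)"
      by (simp add: sum.lessThan_Suc_shift del: sum.lessThan_Suc)
    finally show ?thesis .
  qed
  have bound: "cmod (?f t - ?s n t) \<le> 2 * cmod q ^ n / c" for n t
  proof -
    define S where "S = (\<Sum>k<n. q ^ k * of_real (sin (real (Suc k) * t)))"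
    have s: "?s n t = of_real (sin t) * S"
      unfolding S_def by (simp add: sum_distrib_left mult_ac)
    define r where "r = q ^ n * of_real (sin (real (Suc n) * t)) - q ^ Suc n * of_real (sin (real n * t))"
    have "?D t * S = of_real (sin t) - r"
      unfolding S_def r_def chebyshev_generating_partial_sum by simp
    then have "S = (of_real (sin t) - r) / ?D t" using D[of t] by (simp add: field_simps)
    moreover have "x\<^sup>2 / D - x * ((x - r) / D) = x * r / D" for x D :: complex
      by (simp add: diff_divide_distrib[symmetric] algebra_simps power2_eq_square)
    ultimately have "?f t - ?s n t = of_real (sin t) * r / ?D t"
      unfolding s by simp
    then have "cmod (?f t - ?s n t) = \<bar>sin t\<bar> * cmod r / cmod (?D t)"
      by (simp add: norm_mult norm_divide)
    also have "\<dots> \<le> 1 * (2 * cmod q ^ n) / c"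
    proof (intro frac_le mult_mono)
      have "cmod r \<le> cmod q ^ n * \<bar>sin (real (Suc n) * t)\<bar> + cmod q ^ Suc n * \<bar>sin (real n * t)\<bar>"
        unfolding r_def by (rule order_trans[OF norm_triangle_ineq4]) (simp add: norm_mult norm_power)
      also have "\<dots> \<le> cmod q ^ n * 1 + cmod q ^ Suc n * 1"
        by (intro add_mono mult_left_mono) auto
      also have "cmod q ^ Suc n \<le> cmod q ^ n" using q by (intro power_decreasing) auto
      finally show "cmod r \<le> 2 * cmod q ^ n" by simp
    qed (use c Dc in auto)
    finally show ?thesis by simp
  qed
  have "cmod (integral {0..pi} ?f - of_real (pi / 2)) \<le> 2 * cmod q ^ Suc n / c * pi" for n
  proof -
    have "((\<lambda>t. ?f t - ?s (Suc n) t) has_integral (integral {0..pi} ?f - of_real (pi / 2))) {0..pi}"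
      by (intro has_integral_diff int_s integrable_integral int_f)
    from has_integral_bound_real[OF _ finite.emptyI this bound] c
    show ?thesis by simp
  qed
  moreover have "(\<lambda>n. 2 * cmod q ^ Suc n / c * pi) \<longlonglongrightarrow> 2 * 0 / c * pi"
    by (intro tendsto_intros LIMSEQ_Suc LIMSEQ_power_zero) (use q c in auto)
  ultimately have "cmod (integral {0..pi} ?f - of_real (pi / 2)) \<le> 0"
    by (intro LIMSEQ_le_const[of "\<lambda>n. 2 * cmod q ^ Suc n / c * pi"]) simp_all
  then have *: "integral {0..pi} ?f = of_real (pi / 2)" by simp
  show ?thesis using integrable_integral[OF int_f] unfolding * .
qed

text \<open>
  The substitution \<open>x = - 2 * v * cos t\<close> turns \<open>x - z\<close> into \<open>(v / q) * (1 - 2 * q * cos t + q\<^sup>2)\<close> and the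
  density into a multiple of \<open>sin t\<close>; the Jacobian supplies the second sine.
\<close>

lemma w_sc_eq_inner_root:
  assumes v: "v > 0" and q: "q \<noteq> 0" "cmod q < 1" and z: "z = - of_real v * (q + 1 / q)" and Im: "Im z \<noteq> 0"
  shows "w_sc v z = q / of_real v"
proof -
  let ?S = "{- 2 * v..2 * v}"
  let ?r = "\<lambda>x. 1 / (2 * pi * v\<^sup>2) * sqrt (4 * v\<^sup>2 - x\<^sup>2)"
  let ?F = "\<lambda>x. complex_of_real (?r x) / (complex_of_real x - z)"
  have nz: "complex_of_real x - z \<noteq> 0" for x using Im by (auto simp: complex_eq_iff)
  have cont: "continuous_on ?S ?F"
    by (intro continuous_intros) (use nz v in auto)
  then have "set_integrable lborel ?S ?F" by (rule borel_integrable_atLeastAtMost')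
  then have L: "(LINT x:?S|lborel. ?F x) = integral ?S ?F" by (rule set_borel_integral_eq_integral)
  have "w_sc v z = (LINT x:?S|lborel. ?F x)"
    unfolding w_sc_def set_lebesgue_integral_def
    by (intro Bochner_Integration.integral_cong refl) (auto simp: semicircle_density_def indicator_def)
  note W = this[unfolded L]
  define g where "g t = - 2 * v * cos t" for t
  have "((\<lambda>t. (2 * v * sin t) *\<^sub>R ?F (g t)) has_integral integral {g 0..g pi} ?F) {0..pi}"
  proof (rule has_integral_substitution[where c = "- 2 * v" and d = "2 * v"])
    show "g ` {0..pi} \<subseteq> ?S"
    proof
      fix x assume "x \<in> g ` {0..pi}"
      then obtain t where t: "x = g t" by auto
      have "\<bar>x\<bar> = 2 * v * \<bar>cos t\<bar>" using v by (simp add: t g_def abs_mult)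
      also have "\<dots> \<le> 2 * v * 1" using v by (intro mult_left_mono) auto
      finally show "x \<in> ?S" by auto
    qed
    show "(g has_field_derivative 2 * v * sin t) (at t within {0..pi})" for t
      unfolding g_def by (auto intro!: derivative_eq_intros)
  qed (use v cont in \<open>auto simp: g_def\<close>)
  moreover have "{g 0..g pi} = ?S" by (simp add: g_def)
  ultimately have I1: "((\<lambda>t. (2 * v * sin t) *\<^sub>R ?F (g t)) has_integral integral ?S ?F) {0..pi}" by simp
  let ?D = "\<lambda>t. 1 - 2 * q * of_real (cos t) + q\<^sup>2"
  let ?c = "2 / (of_real pi * of_real v) * q :: complex"
  have "((\<lambda>t. ?c * (of_real ((sin t)\<^sup>2) / ?D t)) has_integral ?c * of_real (pi / 2)) {0..pi}"
    by (rule has_integral_mult_right[OF integral_sin_sq_over_poisson_denominator[OF q(2)]])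
  moreover have "(2 * v * sin t) *\<^sub>R ?F (g t) = ?c * (of_real ((sin t)\<^sup>2) / ?D t)" if t: "t \<in> {0..pi}" for t
  proof -
    have "sin t \<ge> 0" using t by (simp add: sin_ge_zero)
    have "4 * v\<^sup>2 - (g t)\<^sup>2 = (2 * v * sin t)\<^sup>2"
      unfolding g_def by (simp add: power_mult_distrib sin_squared_eq algebra_simps)
    then have "?r (g t) = 1 / (2 * pi * v\<^sup>2) * (2 * v * sin t)"
      using v \<open>sin t \<ge> 0\<close> by simp
    then have r: "?r (g t) = sin t / (pi * v)"
      using v by (simp add: power2_eq_square)
    have d: "complex_of_real (g t) - z = of_real v * ?D t / q"
      unfolding g_def z using q by (simp add: field_simps power2_eq_square)
    show ?thesis unfolding r d using v q
      by (simp add: scaleR_conv_of_real power2_eq_square mult_ac)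
  qed
  ultimately have "((\<lambda>t. (2 * v * sin t) *\<^sub>R ?F (g t)) has_integral ?c * of_real (pi / 2)) {0..pi}"
    by (subst has_integral_cong) auto
  from has_integral_unique[OF I1 this] have "integral ?S ?F = ?c * of_real (pi / 2)" .
  also have "\<dots> = q / of_real v" using v by (simp add: field_simps)
  finally show ?thesis using W by simp
qed

lemma Im_inner_root:
  assumes "v > 0" "q \<noteq> 0" "cmod q < 1" "z = - complex_of_real v * (q + 1 / q)"
  shows "Im z * (cmod q)\<^sup>2 = v * Im q * (1 - (cmod q)\<^sup>2)"
proof -
  have "Im (1 / q) = - Im q / (cmod q)\<^sup>2"
    by (simp add: Im_divide cmod_power2)
  then have "Im z = - v * (Im q - Im q / (cmod q)\<^sup>2)" by (simp add: assms(4))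
  then show ?thesis using assms(2) by (simp add: field_simps)
qed

text \<open>
  In terms of \<open>q = v * w\<close> the fixed-point equation is \<open>z = - v * (q + 1 / q)\<close>. Its two roots \<open>q\<close> and
  \<open>1 / q\<close> have imaginary parts of opposite signs, and \<open>Im_inner_root\<close> shows that the inner one has
  the sign of \<open>Im z\<close>.
\<close>

lemma w_sc_properties:
  assumes v: "v > 0" and z: "Im z \<noteq> 0"
  shows w_sc_fixed_point: "w_sc v z = 1 / (- z - (complex_of_real v)\<^sup>2 * w_sc v z)"
    and Im_w_sc_sign: "Im z * Im (w_sc v z) > 0"
    and w_sc_unique: "w = 1 / (- z - (complex_of_real v)\<^sup>2 * w) \<Longrightarrow> Im z * Im w > 0 \<Longrightarrow> w = w_sc v z"
proof -
  obtain q where q: "q \<noteq> 0" "cmod q < 1" "z = - of_real v * (q + 1 / q)"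
    using joukowski_inner_root[OF v z] .
  have w: "w_sc v z = q / of_real v" by (rule w_sc_eq_inner_root[OF v q z])
  have "- z - (complex_of_real v)\<^sup>2 * w_sc v z = of_real v / q"
    unfolding w using v q(1) by (subst q(3)) (simp add: field_simps power2_eq_square)
  then show "w_sc v z = 1 / (- z - (complex_of_real v)\<^sup>2 * w_sc v z)" unfolding w by simp
  have sq: "0 < (cmod q)\<^sup>2" "(cmod q)\<^sup>2 < 1" using q by (auto simp: power_less_one_iff)
  have "(Im z)\<^sup>2 * (cmod q)\<^sup>2 = v * (1 - (cmod q)\<^sup>2) * (Im z * Im q)"
    using Im_inner_root[OF v q] by (simp add: power2_eq_square mult_ac)
  moreover have "(Im z)\<^sup>2 * (cmod q)\<^sup>2 > 0" using z sq by simp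
  moreover have "v * (1 - (cmod q)\<^sup>2) > 0" using v sq by simp
  ultimately have Iq: "Im z * Im q > 0" by (metis zero_less_mult_pos)
  then show "Im z * Im (w_sc v z) > 0" unfolding w using v by (simp add: zero_less_divide_iff)
  assume f: "w = 1 / (- z - (complex_of_real v)\<^sup>2 * w)" and s: "Im z * Im w > 0"
  then have "w \<noteq> 0" by auto
  define p where "p = of_real v * w"
  have "w * (- z - (complex_of_real v)\<^sup>2 * w) = 1"
    using f \<open>w \<noteq> 0\<close> by (metis div_by_0 nonzero_eq_divide_eq)
  then have "of_real v * (w * (- z - (complex_of_real v)\<^sup>2 * w)) = of_real v" by simp
  then have "of_real v * ((q + 1 / q) * p - p\<^sup>2) = of_real v * 1"
    unfolding p_def q(3) by (simp add: algebra_simps power2_eq_square)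
  then have "(q + 1 / q) * p - p\<^sup>2 = 1" using v by simp
  moreover have "(p - q) * (p - 1 / q) = 1 - ((q + 1 / q) * p - p\<^sup>2)"
    using q(1) by (simp add: field_simps power2_eq_square)
  ultimately have "(p - q) * (p - 1 / q) = 0" by simp
  moreover have "p \<noteq> 1 / q"
  proof
    assume "p = 1 / q"
    then have "Im p = - Im q / (cmod q)\<^sup>2" by (simp add: Im_divide cmod_power2)
    then have "Im z * (v * Im w) * (cmod q)\<^sup>2 = - (Im z * Im q)" using sq(1) by (simp add: p_def)
    moreover have "Im z * (v * Im w) * (cmod q)\<^sup>2 > 0"
      using mult_pos_pos[OF mult_pos_pos[OF v s] sq(1)] by (simp add: mult_ac)
    ultimately show False using Iq by simp
  qed
  ultimately have "p = q" by simp
  then show "w = w_sc v z" unfolding w p_def using v by (simp add: field_simps)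
qed

section \<open>Row sums of the variance profile\<close>

locale even_unimodal_density =
  fixes \<psi> :: "real \<Rightarrow> real"
  assumes range: "\<And>t. \<psi> t \<in> {0..1}"
    and continuous: "continuous_on UNIV \<psi>"
    and even: "\<And>t. \<psi> (- t) = \<psi> t"
    and antimono: "antimono_on {0..} \<psi>"
    and integral_one: "has_bochner_integral lborel \<psi> 1"
begin

text \<open>
  The mass of \<open>\<psi>\<close> on \<open>{0..R}\<close>, with limit \<open>1 / 2\<close>: each row of the matrix sees \<open>\<psi>\<close> on both sides of
  the diagonal, and the two sides are cut off at different distances.
\<close>

definition half_mass :: "real \<Rightarrow> real" where
  "half_mass R = integral {0..R} \<psi>"

lemma nonneg: "0 \<le> \<psi> t" and le_one: "\<psi> t \<le> 1"
  using range[of t] by auto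

lemma decreasing: "0 \<le> s \<Longrightarrow> s \<le> t \<Longrightarrow> \<psi> t \<le> \<psi> s"
  using antimono by (auto simp: monotone_on_def)

lemma integrable_on_interval: "\<psi> integrable_on {a..b}"
  by (rule integrable_continuous_interval) (rule continuous_on_subset[OF continuous], simp)

lemma has_integral_one: "(\<psi> has_integral 1) UNIV"
  using has_integral_integral_lborel[of \<psi>] integral_one by (simp add: has_bochner_integral_iff)

lemma symmetric_integral:
  assumes "0 \<le> R"
  shows "integral {- R..R} \<psi> = 2 * half_mass R"
proof -
  have "integral {- R..R} \<psi> = integral {- R..0} \<psi> + integral {0..R} \<psi>"
    using assms by (intro Henstock_Kurzweil_Integration.integral_combine[symmetric] integrable_on_interval) auto
  also have "integral {- R..0} \<psi> = integral {- R..- 0} (\<lambda>x. \<psi> (- x))" by (simp add: even)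
  also have "\<dots> = integral {0..R} \<psi>" by (rule Henstock_Kurzweil_Integration.integral_reflect_real)
  finally show ?thesis by (simp add: half_mass_def)
qed

lemma half_mass_mono: "0 \<le> R \<Longrightarrow> R \<le> R' \<Longrightarrow> half_mass R \<le> half_mass R'"
  unfolding half_mass_def
  by (intro integral_subset_le integrable_on_interval) (auto simp: nonneg)

lemma half_mass_le: "0 \<le> R \<Longrightarrow> half_mass R \<le> 1 / 2"
proof -
  assume R: "0 \<le> R"
  have "integral {- R..R} \<psi> \<le> integral UNIV \<psi>"
    using has_integral_one by (intro integral_subset_le integrable_on_interval) (auto simp: nonneg)
  also have "integral UNIV \<psi> = 1" using has_integral_one by (rule integral_unique)
  finally show ?thesis using symmetric_integral[OF R] by simp
qed

lemma half_mass_near_half: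
  assumes "e > 0"
  obtains R where "R > 0" "1 - e < 2 * half_mass R"
proof -
  from has_integral_one[unfolded has_integral_alt'[of \<psi>]] assms
  obtain R where R: "R > 0" "\<And>a b. ball 0 R \<subseteq> cbox a b \<Longrightarrow>
      norm (integral (cbox a b) (\<lambda>x. if x \<in> UNIV then \<psi> x else 0) - 1) < e" by blast
  have "ball 0 R \<subseteq> cbox (- R) R" by (auto simp: dist_real_def)
  from R(2)[OF this] have "norm (integral {- R..R} \<psi> - 1) < e" by simp
  then have "1 - e < integral {- R..R} \<psi>" by (simp add: abs_if split: if_splits)
  then show thesis using that[of R] R(1) symmetric_integral[of R] by simp
qed

text \<open>
  By monotonicity the integral over a cell of length \<open>1 / B\<close> lies between the values at its ends.
\<close>

lemma cell_bounds:
  assumes "B > 0"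
  shows "\<psi> (real (Suc m) / B) / B \<le> integral {real m / B..real (Suc m) / B} \<psi>"
    and "integral {real m / B..real (Suc m) / B} \<psi> \<le> \<psi> (real m / B) / B"
    and "half_mass (real (Suc m) / B) = half_mass (real m / B) + integral {real m / B..real (Suc m) / B} \<psi>"
proof -
  have le: "real m / B \<le> real (Suc m) / B" using assms by (simp add: divide_right_mono)
  have const: "integral {real m / B..real (Suc m) / B} (\<lambda>x. c) = c / B" for c :: real
    using le assms by (simp add: field_simps)
  have pos: "0 \<le> x" if "x \<in> {real m / B..real (Suc m) / B}" for x
    using that assms by (auto intro: order_trans[of _ "real m / B"])
  show "\<psi> (real (Suc m) / B) / B \<le> integral {real m / B..real (Suc m) / B} \<psi>"
    unfolding const[symmetric, of "\<psi> (real (Suc m) / B)"]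
    by (intro integral_le integrable_on_interval decreasing integrable_const_ivl) (use pos in auto)
  show "integral {real m / B..real (Suc m) / B} \<psi> \<le> \<psi> (real m / B) / B"
    unfolding const[symmetric, of "\<psi> (real m / B)"]
    by (intro integral_le integrable_on_interval decreasing integrable_const_ivl) (use assms in auto)
  show "half_mass (real (Suc m) / B) = half_mass (real m / B) + integral {real m / B..real (Suc m) / B} \<psi>"
    unfolding half_mass_def
    using le assms by (intro Henstock_Kurzweil_Integration.integral_combine[symmetric] integrable_on_interval) auto
qed

lemma riemann_sum_bounds:
  assumes B: "B > 0"
  shows "(\<Sum>m<M. \<psi> (real (Suc m) / B)) / B \<le> half_mass (real M / B)"
    and "half_mass (real M / B) \<le> (\<Sum>m<M. \<psi> (real m / B)) / B"
proof -
  have 0: "half_mass 0 = 0" by (simp add: half_mass_def)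
  show "(\<Sum>m<M. \<psi> (real (Suc m) / B)) / B \<le> half_mass (real M / B)"
  proof (induction M)
    case (Suc M)
    then show ?case using cell_bounds(1,3)[OF B, of M] by (simp add: add_divide_distrib del: of_nat_Suc)
  qed (simp add: 0)
  show "half_mass (real M / B) \<le> (\<Sum>m<M. \<psi> (real m / B)) / B"
  proof (induction M)
    case (Suc M)
    then show ?case using cell_bounds(2,3)[OF B, of M] by (simp add: add_divide_distrib del: of_nat_Suc)
  qed (simp add: 0)
qed

text \<open>
  The sum of the variances in row \<open>k\<close> of an \<open>N\<close> by \<open>N\<close> matrix with bandwidth \<open>B\<close>, for entries
  \<open>a\<close> of variance 1. It is a Riemann sum of \<open>\<psi>\<close>, close to 1 unless the row is near the boundary.
\<close>

definition row_mass :: "real \<Rightarrow> nat \<Rightarrow> nat \<Rightarrow> real" where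
  "row_mass B N k = (\<Sum>l<N. \<psi> ((real k - real l) / B)) / B"

lemma row_mass_split:
  assumes k: "k < N"
  shows "row_mass B N k = (\<Sum>m<k. \<psi> (real (Suc m) / B)) / B + (\<Sum>m<N - k. \<psi> (real m / B)) / B"
proof -
  have "(\<Sum>l<N. \<psi> ((real k - real l) / B)) =
      (\<Sum>l<k. \<psi> ((real k - real l) / B)) + (\<Sum>l\<in>{k..<N}. \<psi> ((real k - real l) / B))"
    using k sum.atLeastLessThan_concat[of 0 k N "\<lambda>l. \<psi> ((real k - real l) / B)"]
    by (simp add: lessThan_atLeast0)
  also have "(\<Sum>l<k. \<psi> ((real k - real l) / B)) = (\<Sum>m<k. \<psi> (real (Suc m) / B))"
    by (rule sum.reindex_bij_witness[of _ "\<lambda>m. k - Suc m" "\<lambda>l. k - Suc l"]) (auto simp: of_nat_diff)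
  also have "(\<Sum>l\<in>{k..<N}. \<psi> ((real k - real l) / B)) = (\<Sum>m<N - k. \<psi> (real m / B))"
  proof (rule sum.reindex_bij_witness[of _ "\<lambda>m. m + k" "\<lambda>l. l - k"])
    fix l assume "l \<in> {k..<N}"
    then have "(real k - real l) / B = - (real (l - k) / B)" by (simp add: of_nat_diff minus_divide_left)
    then show "\<psi> (real (l - k) / B) = \<psi> ((real k - real l) / B)" by (simp only: even)
  qed auto
  finally show ?thesis unfolding row_mass_def by (simp add: add_divide_distrib)
qed

lemma row_mass_nonneg: "B > 0 \<Longrightarrow> 0 \<le> row_mass B N k"
  unfolding row_mass_def by (simp add: sum_nonneg nonneg)

lemma row_mass_le:
  assumes B: "B > 0" and k: "k < N"
  shows "row_mass B N k \<le> 1 + 1 / B"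
proof -
  obtain M where M: "N - k = Suc M" using k by (metis Suc_pred' zero_less_diff)
  have "(\<Sum>m<N - k. \<psi> (real m / B)) / B = \<psi> 0 / B + (\<Sum>m<M. \<psi> (real (Suc m) / B)) / B"
    unfolding M sum.lessThan_Suc_shift by (simp add: add_divide_distrib)
  also have "\<dots> \<le> 1 / B + 1 / 2"
  proof (rule add_mono)
    show "\<psi> 0 / B \<le> 1 / B" using B le_one[of 0] by (simp add: divide_right_mono)
    show "(\<Sum>m<M. \<psi> (real (Suc m) / B)) / B \<le> 1 / 2"
      by (rule order_trans[OF riemann_sum_bounds(1)[OF B] half_mass_le]) (use B in simp)
  qed
  finally show ?thesis
    unfolding row_mass_split[OF k] using riemann_sum_bounds(1)[OF B, of k] half_mass_le[of "real k / B"] B by simp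
qed

lemma row_mass_ge:
  assumes B: "B > 0" and k: "k < N" and L: "L \<le> k" "L \<le> N - k"
  shows "2 * half_mass (real L / B) - 1 / B \<le> row_mass B N k"
proof -
  have mono: "half_mass (real L / B) \<le> half_mass (real M / B)" if "L \<le> M" for M
    using B that by (intro half_mass_mono divide_right_mono) auto
  have "half_mass (real (Suc k) / B) \<le> (\<psi> 0 + (\<Sum>m<k. \<psi> (real (Suc m) / B))) / B"
    using riemann_sum_bounds(2)[OF B, of "Suc k"] unfolding sum.lessThan_Suc_shift by simp
  also have "\<dots> \<le> 1 / B + (\<Sum>m<k. \<psi> (real (Suc m) / B)) / B"
    using B le_one[of 0] by (simp add: add_divide_distrib divide_right_mono)
  finally show ?thesis
    unfolding row_mass_split[OF k]
    using riemann_sum_bounds(2)[OF B, of "N - k"] mono[of "Suc k"] mono[of "N - k"] L by simp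
qed

text \<open>
  Rows at distance at least \<open>L\<close> from both ends are treated by \<open>row_mass_ge\<close>. There are at most
  \<open>2 * L\<close> other rows, each with deviation at most 1.
\<close>

lemma sum_row_mass_deviation_le:
  assumes B: "B \<ge> 1"
  shows "(\<Sum>k<N. (row_mass B N k - 1)\<^sup>2) \<le> real N * (1 - 2 * half_mass (real L / B) + 1 / B) + 2 * real L"
proof -
  define \<delta> where "\<delta> = 1 - 2 * half_mass (real L / B) + 1 / B"
  \<comment> \<open>\<open>\<delta>\<close> also covers deviations upwards, as the mass of a half-line is at most \<open>1 / 2\<close>\<close>
  have \<delta>: "1 / B \<le> \<delta>" using half_mass_le[of "real L / B"] B by (simp add: \<delta>_def)
  then have \<delta>0: "0 \<le> \<delta>" using B by (meson order_trans divide_nonneg_nonneg zero_le_one)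
  have each: "(row_mass B N k - 1)\<^sup>2 \<le> \<delta> + (if k < L then 1 else 0) + (if N - k < L then 1 else 0)" if k: "k < N" for k
  proof -
    have up: "row_mass B N k \<le> 1 + 1 / B" using B k by (intro row_mass_le) auto
    have "1 / B \<le> 1" using B by (simp add: divide_le_eq)
    then have one: "\<bar>row_mass B N k - 1\<bar> \<le> 1" using up row_mass_nonneg[of B N k] B
      unfolding abs_le_iff by linarith
    have "(row_mass B N k - 1)\<^sup>2 = \<bar>row_mass B N k - 1\<bar> * \<bar>row_mass B N k - 1\<bar>"
      by (simp add: power2_eq_square)
    also have "\<dots> \<le> \<bar>row_mass B N k - 1\<bar> * 1" using one by (intro mult_left_mono) auto
    finally have sq: "(row_mass B N k - 1)\<^sup>2 \<le> \<bar>row_mass B N k - 1\<bar>" by simp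
    show ?thesis
    proof (cases "L \<le> k \<and> L \<le> N - k")
      case True
      then have "2 * half_mass (real L / B) - 1 / B \<le> row_mass B N k" using B k by (intro row_mass_ge) auto
      then have "\<bar>row_mass B N k - 1\<bar> \<le> \<delta>" using up \<delta> by (simp add: \<delta>_def abs_le_iff)
      then show ?thesis using sq True by simp
    next
      case False
      then show ?thesis using sq one \<delta>0 by auto
    qed
  qed
  have "(\<Sum>k<N. (row_mass B N k - 1)\<^sup>2) \<le>
      (\<Sum>k<N. \<delta> + (if k < L then 1 else 0) + (if N - k < L then 1 else 0))"
    by (intro sum_mono each) simp
  also have "\<dots> = real N * \<delta> + real (card {k. k < N \<and> k < L}) + real (card {k. k < N \<and> N - k < L})"
    by (simp add: sum.distrib sum.If_cases Int_def)
  also have "card {k. k < N \<and> k < L} \<le> L"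
    using card_mono[of "{..<L}" "{k. k < N \<and> k < L}"] by auto
  also have "card {k. k < N \<and> N - k < L} \<le> L"
  proof -
    have "inj_on (\<lambda>k. N - k) {k. k < N \<and> N - k < L}" by (auto simp: inj_on_def)
    then show ?thesis
      using card_inj_on_le[of "\<lambda>k. N - k" "{k. k < N \<and> N - k < L}" "{..<L}"] by auto
  qed
  finally show ?thesis by (simp add: \<delta>_def)
qed

text \<open>
  With \<open>L\<close> about \<open>R * B n\<close> the bulk rows contribute \<open>1 - 2 * half_mass R\<close>, which is small for large
  \<open>R\<close>, and for fixed \<open>R\<close> the proportion of the other rows is of order \<open>B n / n\<close>.
\<close>

lemma average_row_mass_deviation_tendsto_0:
  fixes B :: "nat \<Rightarrow> real"
  assumes B: "\<And>n. B n \<ge> 1" and Binf: "filterlim B at_top sequentially"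
    and Bn: "(\<lambda>n. B n / real n) \<longlonglongrightarrow> 0"
  shows "(\<lambda>n. 1 / real (2 * n + 1) * (\<Sum>k<2 * n + 1. (row_mass (B n) (2 * n + 1) k - 1)\<^sup>2)) \<longlonglongrightarrow> 0"
proof (rule LIMSEQ_I)
  fix e :: real assume e: "0 < e"
  obtain R where R: "R > 0" "1 - e / 2 < 2 * half_mass R" using half_mass_near_half[of "e / 2"] e by auto
  define f where "f n = (1 - 2 * half_mass R) + 1 / B n + (2 * (R * (B n / real n)) + 2 / real n)" for n
  have "f \<longlonglongrightarrow> (1 - 2 * half_mass R) + 0 + (2 * (R * 0) + 0)"
    unfolding f_def
    by (intro tendsto_intros Bn tendsto_divide_0[OF tendsto_const] filterlim_at_top_imp_at_infinity
      Binf filterlim_real_sequentially)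
  then have "eventually (\<lambda>n. f n < e) sequentially"
    by (rule order_tendstoD(2)) (use R(2) e in simp)
  then obtain n0 where n0: "\<And>n. n \<ge> n0 \<Longrightarrow> f n < e" by (auto simp: eventually_sequentially)
  show "\<exists>no. \<forall>n\<ge>no. norm (1 / real (2 * n + 1) * (\<Sum>k<2 * n + 1. (row_mass (B n) (2 * n + 1) k - 1)\<^sup>2) - 0) < e"
  proof (intro exI[of _ "max n0 1"] allI impI)
    fix n assume n: "max n0 1 \<le> n"
    define L where "L = nat \<lceil>R * B n\<rceil>"
    let ?N = "2 * n + 1"
    have B1: "B n \<ge> 1" by (rule B)
    have RB: "0 \<le> R * B n" using R(1) B1 by simp
    have L: "R * B n \<le> real L" "real L \<le> R * B n + 1" unfolding L_def using RB by linarith+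
    have "R \<le> real L / B n" using L(1) B1 by (simp add: le_divide_eq)
    then have hm: "half_mass R \<le> half_mass (real L / B n)" using R(1) by (intro half_mass_mono) auto
    let ?s = "\<Sum>k<?N. (row_mass (B n) ?N k - 1)\<^sup>2"
    have "?s \<le> real ?N * (1 - 2 * half_mass (real L / B n) + 1 / B n) + 2 * real L"
      by (rule sum_row_mass_deviation_le[OF B1])
    also have "\<dots> \<le> real ?N * (1 - 2 * half_mass R + 1 / B n) + 2 * (R * B n + 1)"
      using hm L by (intro add_mono mult_left_mono) auto
    finally have "1 / real ?N * ?s \<le> 1 / real ?N * (real ?N * (1 - 2 * half_mass R + 1 / B n) + 2 * (R * B n + 1))"
      by (intro mult_left_mono) auto
    also have "\<dots> = (1 - 2 * half_mass R) + 1 / B n + 2 * (R * B n + 1) / real ?N"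
    proof -
      have "1 / a * (a * x + y) = x + y / a" if "a \<noteq> 0" for a x y :: real
        using that by (simp add: field_simps)
      from this[of "real ?N"] show ?thesis by (simp only: of_nat_eq_0_iff)
    qed
    also have "2 * (R * B n + 1) / real ?N \<le> 2 * (R * B n + 1) / real n"
      using n RB by (intro divide_left_mono) auto
    also have "(1 - 2 * half_mass R) + 1 / B n + 2 * (R * B n + 1) / real n = f n"
      unfolding f_def by (simp add: add_divide_distrib)
    finally have "1 / real ?N * ?s < e" using n0[of n] n by simp
    moreover have "0 \<le> 1 / real ?N * ?s" by (simp add: sum_nonneg)
    ultimately show "norm (1 / real ?N * ?s - 0) < e" by simp
  qed
qed

end

section \<open>The percolation ensemble\<close>

text \<open>
  Two families, each of independent variables, which are independent of each other as families
  form a single independent family, here indexed by a Boolean and the old index. Grouping the two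
  variables with the same old index preserves independence.
\<close>

lemma (in prob_space) indep_vars_combine_pairwise:
  fixes A :: "'p \<Rightarrow> 'a \<Rightarrow> real" and D :: "'p \<Rightarrow> 'a \<Rightarrow> real" and \<phi> :: "'q \<Rightarrow> 'p"
  assumes P: "finite P" "P \<noteq> {}" "P \<subseteq> I"
    and indA: "indep_vars (\<lambda>_. borel) A I" and indD: "indep_vars (\<lambda>_. borel) D P"
    and indAD: "indep_var (PiM I (\<lambda>_. borel)) (\<lambda>\<omega>. restrict (\<lambda>p. A p \<omega>) I)
      (PiM P (\<lambda>_. borel)) (\<lambda>\<omega>. restrict (\<lambda>p. D p \<omega>) P)"
    and \<phi>: "inj_on \<phi> Q" "\<phi> ` Q \<subseteq> P"
    and f: "(\<lambda>(x, y). f x y) \<in> borel_measurable (borel \<Otimes>\<^sub>M borel)"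
  shows "indep_vars (\<lambda>_. borel) (\<lambda>q \<omega>. f (A (\<phi> q) \<omega>) (D (\<phi> q) \<omega>) :: real) Q"
proof -
  define Z where "Z r = (if fst r then A (snd r) else D (snd r))" for r :: "bool \<times> 'p"
  let ?R = "(UNIV :: bool set) \<times> P"
  have R: "finite ?R" "?R \<noteq> {}" using P by auto
  have rvA: "A p \<in> borel_measurable M" if "p \<in> P" for p using indA P that by (auto simp: indep_vars_def)
  have rvD: "D p \<in> borel_measurable M" if "p \<in> P" for p using indD that by (auto simp: indep_vars_def)
  have indZ: "indep_vars (\<lambda>_. borel) Z ?R"
  proof (subst indep_vars_finite[where E = "\<lambda>_. sets borel", OF R(2) R(1)])
    show "random_variable borel (Z r)" if "r \<in> ?R" for r
      using that rvA rvD by (auto simp: Z_def)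
    show "\<forall>C\<in>?R \<rightarrow> sets borel. prob (\<Inter>r\<in>?R. Z r -` C r \<inter> space M) =
        (\<Prod>r\<in>?R. prob (Z r -` C r \<inter> space M))"
    proof
      fix C :: "bool \<times> 'p \<Rightarrow> real set" assume C: "C \<in> ?R \<rightarrow> sets borel"
      let ?EA = "{x \<in> space (PiM I (\<lambda>_. borel)). \<forall>p\<in>P. x p \<in> C (True, p)}"
      let ?ED = "{x \<in> space (PiM P (\<lambda>_. borel)). \<forall>p\<in>P. x p \<in> C (False, p)}"
      have EA: "?EA \<in> sets (PiM I (\<lambda>_. borel))"
      proof (rule sets.sets_Collect_finite_All'[OF _ P(1,2)])
        fix p assume p: "p \<in> P"
        have "(\<lambda>x. x p) \<in> measurable (PiM I (\<lambda>_. borel)) borel"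
          using p P by (intro measurable_component_singleton) auto
        then have "(\<lambda>x. x p) -` C (True, p) \<inter> space (PiM I (\<lambda>_. borel)) \<in> sets (PiM I (\<lambda>_. borel))"
          by (rule measurable_sets) (use p C in auto)
        also have "(\<lambda>x. x p) -` C (True, p) \<inter> space (PiM I (\<lambda>_. borel)) =
            {x \<in> space (PiM I (\<lambda>_. borel)). x p \<in> C (True, p)}" by blast
        finally show "{x \<in> space (PiM I (\<lambda>_. borel)). x p \<in> C (True, p)} \<in> sets (PiM I (\<lambda>_. borel))" .
      qed
      have ED: "?ED \<in> sets (PiM P (\<lambda>_. borel))"
      proof (rule sets.sets_Collect_finite_All'[OF _ P(1,2)])
        fix p assume p: "p \<in> P"
        have "(\<lambda>x. x p) \<in> measurable (PiM P (\<lambda>_. borel)) borel"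
          using p by (intro measurable_component_singleton) auto
        then have "(\<lambda>x. x p) -` C (False, p) \<inter> space (PiM P (\<lambda>_. borel)) \<in> sets (PiM P (\<lambda>_. borel))"
          by (rule measurable_sets) (use p C in auto)
        also have "(\<lambda>x. x p) -` C (False, p) \<inter> space (PiM P (\<lambda>_. borel)) =
            {x \<in> space (PiM P (\<lambda>_. borel)). x p \<in> C (False, p)}" by blast
        finally show "{x \<in> space (PiM P (\<lambda>_. borel)). x p \<in> C (False, p)} \<in> sets (PiM P (\<lambda>_. borel))" .
      qed
      let ?RA = "\<lambda>\<omega>. restrict (\<lambda>p. A p \<omega>) I" and ?RD = "\<lambda>\<omega>. restrict (\<lambda>p. D p \<omega>) P"
      have preA: "?RA -` ?EA \<inter> space M = (\<Inter>p\<in>P. A p -` C (True, p) \<inter> space M)"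
        using P by (auto simp: space_PiM)
      have preD: "?RD -` ?ED \<inter> space M = (\<Inter>p\<in>P. D p -` C (False, p) \<inter> space M)"
        using P by (auto simp: space_PiM)
      have "(\<Inter>r\<in>?R. Z r -` C r \<inter> space M) = (\<lambda>\<omega>. (?RA \<omega>, ?RD \<omega>)) -` (?EA \<times> ?ED) \<inter> space M"
      proof -
        have "(\<lambda>\<omega>. (?RA \<omega>, ?RD \<omega>)) -` (?EA \<times> ?ED) \<inter> space M =
            (?RA -` ?EA \<inter> space M) \<inter> (?RD -` ?ED \<inter> space M)" by blast
        also have "\<dots> = (\<Inter>p\<in>P. A p -` C (True, p) \<inter> space M) \<inter> (\<Inter>p\<in>P. D p -` C (False, p) \<inter> space M)"
          by (simp only: preA preD)
        also have "\<dots> = (\<Inter>r\<in>?R. Z r -` C r \<inter> space M)"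
          unfolding UNIV_bool by (auto simp: Z_def split: if_splits)
        finally show ?thesis by simp
      qed
      then have "prob (\<Inter>r\<in>?R. Z r -` C r \<inter> space M) =
          prob (?RA -` ?EA \<inter> space M) * prob (?RD -` ?ED \<inter> space M)"
        using indep_varD[OF indAD EA ED] by simp
      also have "prob (?RA -` ?EA \<inter> space M) = (\<Prod>p\<in>P. prob (A p -` C (True, p) \<inter> space M))"
        unfolding preA by (rule indep_varsD[OF indA P(2,1,3)]) (use C in auto)
      also have "prob (?RD -` ?ED \<inter> space M) = (\<Prod>p\<in>P. prob (D p -` C (False, p) \<inter> space M))"
        unfolding preD by (rule indep_varsD[OF indD P(2,1)]) (use C in auto)
      also have "(\<Prod>p\<in>P. prob (A p -` C (True, p) \<inter> space M)) * (\<Prod>p\<in>P. prob (D p -` C (False, p) \<inter> space M)) =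
          (\<Prod>r\<in>?R. prob (Z r -` C r \<inter> space M))"
      proof -
        have "(\<Prod>r\<in>?R. prob (Z r -` C r \<inter> space M)) = (\<Prod>c\<in>UNIV. \<Prod>p\<in>P. prob (Z (c, p) -` C (c, p) \<inter> space M))"
          by (subst prod.cartesian_product) (simp add: case_prod_unfold)
        then show ?thesis by (simp add: UNIV_bool Z_def mult.commute)
      qed
      finally show "prob (\<Inter>r\<in>?R. Z r -` C r \<inter> space M) = (\<Prod>r\<in>?R. prob (Z r -` C r \<inter> space M))" .
    qed
    show "sets borel = sigma_sets (space borel) (sets (borel :: real measure))"
      by (rule sets.sigma_sets_eq[symmetric])
    show "Int_stable (sets (borel :: real measure))" by (auto simp: Int_stable_def)
    show "sets (borel :: real measure) \<subseteq> Pow (space borel)" by (rule sets.space_closed)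
  qed auto
  have "indep_vars (\<lambda>q. PiM (UNIV \<times> {\<phi> q}) (\<lambda>_. borel)) (\<lambda>q \<omega>. restrict (\<lambda>r. Z r \<omega>) (UNIV \<times> {\<phi> q})) Q"
    by (rule indep_vars_restrict[OF indZ])
      (use \<phi> in \<open>auto simp: disjoint_family_on_def dest: inj_onD\<close>)
  then have "indep_vars (\<lambda>_. borel) (\<lambda>q \<omega>. (\<lambda>w. f (w (True, \<phi> q)) (w (False, \<phi> q)))
      (restrict (\<lambda>r. Z r \<omega>) (UNIV \<times> {\<phi> q}))) Q"
  proof (rule indep_vars_compose2)
    fix q
    have "(\<lambda>w. (w (True, \<phi> q), w (False, \<phi> q))) \<in> measurable (PiM (UNIV \<times> {\<phi> q}) (\<lambda>_. borel)) (borel \<Otimes>\<^sub>M (borel :: real measure))"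
      by (intro measurable_Pair measurable_component_singleton) auto
    from measurable_compose[OF this f]
    show "(\<lambda>w. f (w (True, \<phi> q)) (w (False, \<phi> q))) \<in> borel_measurable (PiM (UNIV \<times> {\<phi> q}) (\<lambda>_. borel))"
      by simp
  qed
  then show ?thesis by (simp add: Z_def)
qed

context long_range_percolation
begin

abbreviation B :: "nat \<Rightarrow> real" where "B n \<equiv> real_of_int (b n)"

abbreviation \<beta> :: "nat \<Rightarrow> real" where "\<beta> n \<equiv> B n powr (- 1 / 2)"

lemma B_ge_1: "B n \<ge> 1"
  using b_range[of n] by linarith

lemma \<beta>_bounds: "0 < \<beta> n" "\<beta> n \<le> 1" "(\<beta> n)\<^sup>2 = 1 / B n" "1 / B n \<le> \<beta> n" "1 / (B n)\<^sup>2 \<le> \<beta> n"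
proof -
  have B: "B n \<ge> 1" by (rule B_ge_1)
  show "0 < \<beta> n" using B by simp
  show le: "\<beta> n \<le> 1" using powr_mono[of "- 1 / 2" 0 "B n"] B by simp
  have "(\<beta> n)\<^sup>2 = B n powr (- 1)" unfolding power2_eq_square powr_add[symmetric] by simp
  then show sq: "(\<beta> n)\<^sup>2 = 1 / B n" using B by (simp add: powr_minus_divide)
  have "(\<beta> n)\<^sup>2 \<le> \<beta> n * 1" unfolding power2_eq_square using le by (intro mult_left_mono) auto
  then show 1: "1 / B n \<le> \<beta> n" using sq by simp
  have "1 / (B n)\<^sup>2 \<le> 1 / B n" using B by (simp add: power2_eq_square frac_le)
  then show "1 / (B n)\<^sup>2 \<le> \<beta> n" using 1 by linarith
qed

sublocale psi: even_unimodal_density \<psi>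
  by unfold_locales (rule psi_range psi_continuous psi_even psi_antimono psi_integral)+

lemma finite_upper_pairs_upto: "finite (upper_pairs_upto n)"
  by (rule finite_subset[of _ "{- int n..int n} \<times> {- int n..int n}"]) (auto simp: upper_pairs_upto_def)

lemma upper_pairs_upto_subset: "upper_pairs_upto n \<subseteq> upper_pairs"
  by (auto simp: upper_pairs_upto_def upper_pairs_def)

lemma a_measurable: "i \<le> j \<Longrightarrow> a i j \<in> borel_measurable M"
  using integrable_a by (rule borel_measurable_integrable)

lemma d_measurable: "(i, j) \<in> upper_pairs_upto n \<Longrightarrow> d n i j \<in> borel_measurable M"
  using indep_d[of n] by (auto simp: indep_vars_def)

lemma indep_a_d_entry:
  assumes p: "(i, j) \<in> upper_pairs_upto n"
  shows "indep_var borel (a i j) borel (d n i j)"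
proof -
  have p': "(i, j) \<in> upper_pairs" using p upper_pairs_upto_subset by auto
  have 1: "(\<lambda>x. x (i, j)) \<in> measurable (PiM upper_pairs (\<lambda>_. borel :: real measure)) borel"
    by (rule measurable_component_singleton[OF p'])
  have 2: "(\<lambda>x. x (i, j)) \<in> measurable (PiM (upper_pairs_upto n) (\<lambda>_. borel :: real measure)) borel"
    by (rule measurable_component_singleton[OF p])
  from indep_var_compose[OF indep_a_d[of n] 1 2] show ?thesis
    using p p' by (simp add: comp_def)
qed

text \<open>
  \<open>d\<close> is almost surely the indicator of the event that it equals 1, so that all functions which
  fix 0 and 1 have the same mean.
\<close>

lemma d_moment:
  assumes p: "(i, j) \<in> upper_pairs_upto n"
    and f: "f \<in> borel_measurable borel" "f 0 = 0" "f 1 = (1::real)"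
  shows "integrable M (\<lambda>\<omega>. f (d n i j \<omega>))"
    and "expectation (\<lambda>\<omega>. f (d n i j \<omega>)) = \<psi> (real_of_int (i - j) / B n)"
proof -
  note [measurable] = d_measurable[OF p] f(1)
  let ?A1 = "{\<omega> \<in> space M. d n i j \<omega> = 1}" and ?A0 = "{\<omega> \<in> space M. d n i j \<omega> = 0}"
  have "prob (?A1 \<union> ?A0) = prob ?A1 + prob ?A0"
    by (rule finite_measure_Union) auto
  then have "prob (?A1 \<union> ?A0) = 1" using prob_d_1[OF p] prob_d_0[OF p] by simp
  then have ae01: "AE \<omega> in M. \<omega> \<in> ?A1 \<union> ?A0" by (rule AE_prob_1)
  have ae: "AE \<omega> in M. f (d n i j \<omega>) = indicator ?A1 \<omega>"
    using ae01 by eventually_elim (auto simp: f)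
  have "integrable M (indicator ?A1 :: _ \<Rightarrow> real)"
    by (intro integrable_real_indicator) (auto simp: emeasure_eq_measure)
  then show "integrable M (\<lambda>\<omega>. f (d n i j \<omega>))"
    by (subst integrable_cong_AE[OF _ _ ae]) auto
  have "expectation (\<lambda>\<omega>. f (d n i j \<omega>)) = expectation (indicator ?A1)"
    by (rule integral_cong_AE[OF _ _ ae]) auto
  also have "\<dots> = \<psi> (real_of_int (i - j) / B n)" using prob_d_1[OF p] by simp
  finally show "expectation (\<lambda>\<omega>. f (d n i j \<omega>)) = \<psi> (real_of_int (i - j) / B n)" .
qed

lemma product_moment:
  assumes p: "(i, j) \<in> upper_pairs_upto n"
    and f: "f \<in> borel_measurable borel" "f 0 = 0" "f 1 = (1::real)"
    and h: "h \<in> borel_measurable borel" "integrable M (\<lambda>\<omega>. h (a i j \<omega>))"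
  shows "integrable M (\<lambda>\<omega>. h (a i j \<omega>) * f (d n i j \<omega>))"
    and "expectation (\<lambda>\<omega>. h (a i j \<omega>) * f (d n i j \<omega>)) =
      expectation (\<lambda>\<omega>. h (a i j \<omega>)) * \<psi> (real_of_int (i - j) / B n)"
proof -
  have ind: "indep_var borel (\<lambda>\<omega>. h (a i j \<omega>)) borel (\<lambda>\<omega>. f (d n i j \<omega>))"
    using indep_var_compose[OF indep_a_d_entry[OF p] h(1) f(1)] by (simp add: comp_def)
  note d = d_moment[OF p f]
  show "integrable M (\<lambda>\<omega>. h (a i j \<omega>) * f (d n i j \<omega>))"
    by (rule indep_var_integrable[OF ind h(2) d(1)])
  show "expectation (\<lambda>\<omega>. h (a i j \<omega>) * f (d n i j \<omega>)) =
      expectation (\<lambda>\<omega>. h (a i j \<omega>)) * \<psi> (real_of_int (i - j) / B n)"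
    using indep_var_lebesgue_integral[OF ind h(2) d(1)] d(2) by simp
qed

text \<open>
  The entries of the matrix with rows and columns counted from 0.
\<close>

definition X :: "nat \<Rightarrow> nat \<Rightarrow> nat \<Rightarrow> 'w \<Rightarrow> real" where
  "X n k l \<omega> = H_entry a b d n \<omega> (int k - int n) (int l - int n)"

lemma X_sym: "X n k l \<omega> = X n l k \<omega>"
  unfolding X_def H_entry_def by (simp add: min.commute max.commute)

lemma X_eq:
  assumes "k \<le> l"
  shows "X n k l \<omega> = \<beta> n * a (int k - int n) (int l - int n) \<omega> * d n (int k - int n) (int l - int n) \<omega>"
  using assms unfolding X_def H_entry_def by simp

lemma index_pair: "k \<le> l \<Longrightarrow> l < 2 * n + 1 \<Longrightarrow> (int k - int n, int l - int n) \<in> upper_pairs_upto n"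
  unfolding upper_pairs_upto_def by auto

lemma indep_X: "indep_vars (\<lambda>_. borel) (\<lambda>(k, l). X n k l) {(k, l). k \<le> l \<and> l < 2 * n + 1}"
proof -
  let ?\<phi> = "\<lambda>(k, l). (int k - int n, int l - int n)"
  have ne: "upper_pairs_upto n \<noteq> {}" using index_pair[of 0 0 n] by auto
  have ad: "indep_var (PiM upper_pairs (\<lambda>_. borel)) (\<lambda>\<omega>. restrict (\<lambda>p. (\<lambda>(i, j). a i j) p \<omega>) upper_pairs)
      (PiM (upper_pairs_upto n) (\<lambda>_. borel)) (\<lambda>\<omega>. restrict (\<lambda>p. (\<lambda>(i, j). d n i j) p \<omega>) (upper_pairs_upto n))"
    using indep_a_d[of n] by (simp add: case_prod_unfold)
  have "indep_vars (\<lambda>_. borel)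
      (\<lambda>q \<omega>. (\<lambda>x y. \<beta> n * x * y) ((\<lambda>(i, j). a i j) (?\<phi> q) \<omega>) ((\<lambda>(i, j). d n i j) (?\<phi> q) \<omega>))
      {(k, l). k \<le> l \<and> l < 2 * n + 1}"
    by (rule indep_vars_combine_pairwise[OF finite_upper_pairs_upto ne upper_pairs_upto_subset indep_a indep_d ad])
      (auto simp: inj_on_def intro!: index_pair)
  then show ?thesis
    by (rule iffD1[OF indep_vars_cong, rotated -1]) (auto simp: X_eq fun_eq_iff)
qed

lemma X_moments:
  assumes kl: "k < 2 * n + 1" "l < 2 * n + 1"
    and third: "\<And>i j. i \<le> j \<Longrightarrow> integrable M (\<lambda>\<omega>. \<bar>a i j \<omega>\<bar> ^ 3)"
    and \<mu>: "\<And>i j. i \<le> j \<Longrightarrow> expectation (\<lambda>\<omega>. \<bar>a i j \<omega>\<bar> ^ 3) \<le> \<mu>"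
  defines "\<psi>kl \<equiv> \<psi> ((real k - real l) / B n)"
  shows "integrable M (X n k l)" and "expectation (X n k l) = 0"
    and "integrable M (\<lambda>\<omega>. (X n k l \<omega>)\<^sup>2)" and "expectation (\<lambda>\<omega>. (X n k l \<omega>)\<^sup>2) = v\<^sup>2 * (\<psi>kl / B n)"
    and "integrable M (\<lambda>\<omega>. \<bar>X n k l \<omega>\<bar> ^ 3)" and "expectation (\<lambda>\<omega>. \<bar>X n k l \<omega>\<bar> ^ 3) \<le> \<mu> * \<beta> n * (\<psi>kl / B n)"
proof -
  define k' where "k' = min k l" define l' where "l' = max k l"
  have le: "k' \<le> l'" "l' < 2 * n + 1" using kl by (auto simp: k'_def l'_def)
  define i where "i = int k' - int n" define j where "j = int l' - int n"
  have ij: "i \<le> j" using le by (simp add: i_def j_def)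
  have p: "(i, j) \<in> upper_pairs_upto n" unfolding i_def j_def by (rule index_pair[OF le])
  have "X n k l = X n k' l'" unfolding k'_def l'_def using X_sym by (auto simp: min_def max_def fun_eq_iff)
  then have X: "X n k l = (\<lambda>\<omega>. \<beta> n * (a i j \<omega> * d n i j \<omega>))"
    by (auto simp: fun_eq_iff X_eq[OF le(1)] i_def j_def)
  have psi: "\<psi> (real_of_int (i - j) / B n) = \<psi>kl"
  proof (cases "k \<le> l")
    case True
    then have "real_of_int (i - j) = real k - real l" by (simp add: i_def j_def k'_def l'_def)
    then show ?thesis by (simp add: \<psi>kl_def)
  next
    case False
    then have "real_of_int (i - j) / B n = - ((real k - real l) / B n)"
      by (simp add: i_def j_def k'_def l'_def minus_divide_left)
    then show ?thesis unfolding \<psi>kl_def by (simp only: psi_even)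
  qed
  note m1 = product_moment[OF p, of "\<lambda>x. x" "\<lambda>x. x", simplified, OF integrable_a[OF ij], unfolded psi[simplified]]
  note m2 = product_moment[OF p, of "\<lambda>x. x\<^sup>2" "\<lambda>x. x\<^sup>2", simplified, OF integrable_a_sq[OF ij], unfolded psi[simplified]]
  note m3 = product_moment[OF p, of "\<lambda>x. \<bar>x\<bar> ^ 3" "\<lambda>x. \<bar>x\<bar> ^ 3", simplified, OF third[OF ij], unfolded psi[simplified]]
  show "integrable M (X n k l)" unfolding X using m1(1) by simp
  show "expectation (X n k l) = 0" unfolding X using m1(2) mean_a[OF ij] by simp
  have X2: "(X n k l \<omega>)\<^sup>2 = (1 / B n) * ((a i j \<omega>)\<^sup>2 * (d n i j \<omega>)\<^sup>2)" for \<omega>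
    unfolding X power_mult_distrib \<beta>_bounds(3) ..
  show "integrable M (\<lambda>\<omega>. (X n k l \<omega>)\<^sup>2)" unfolding X2 using m2(1) by simp
  show "expectation (\<lambda>\<omega>. (X n k l \<omega>)\<^sup>2) = v\<^sup>2 * (\<psi>kl / B n)"
    unfolding X2 using m2(2) second_moment_a[OF ij] by simp
  have "\<bar>\<beta> n\<bar> ^ 3 = \<beta> n * (\<beta> n)\<^sup>2" by (simp add: power3_eq_cube power2_eq_square)
  also have "\<dots> = \<beta> n / B n" unfolding \<beta>_bounds(3) by simp
  finally have X3: "\<bar>X n k l \<omega>\<bar> ^ 3 = (\<beta> n / B n) * (\<bar>a i j \<omega>\<bar> ^ 3 * \<bar>d n i j \<omega>\<bar> ^ 3)" for \<omega>
    unfolding X abs_mult power_mult_distrib by simp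
  show "integrable M (\<lambda>\<omega>. \<bar>X n k l \<omega>\<bar> ^ 3)" unfolding X3 using m3(1) by simp
  have "expectation (\<lambda>\<omega>. \<bar>X n k l \<omega>\<bar> ^ 3) = (\<beta> n / B n) * (expectation (\<lambda>\<omega>. \<bar>a i j \<omega>\<bar> ^ 3) * \<psi>kl)"
    unfolding X3 using m3(2) by simp
  also have "\<dots> \<le> (\<beta> n / B n) * (\<mu> * \<psi>kl)"
    using \<mu>[OF ij] B_ge_1[of n] psi.nonneg by (intro mult_left_mono mult_right_mono) (auto simp: \<psi>kl_def)
  finally show "expectation (\<lambda>\<omega>. \<bar>X n k l \<omega>\<bar> ^ 3) \<le> \<mu> * \<beta> n * (\<psi>kl / B n)" by (simp add: mult_ac)
qed

lemma g_eq_average: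
  "g a b d n z \<omega> = 1 / of_nat (2 * n + 1) * (\<Sum>k<2 * n + 1. resolvent (2 * n + 1) (\<lambda>k l. X n k l \<omega>) z k k)"
  if z: "Im z \<noteq> 0"
proof -
  let ?N = "2 * n + 1"
  have H: "H_mat a b d n \<omega> - z \<cdot>\<^sub>m 1\<^sub>m ?N = shifted_mat ?N (\<lambda>k l. X n k l \<omega>) z"
    unfolding H_mat_def shifted_mat_def X_def ..
  have "dim_row (the (mat_inverse (shifted_mat ?N (\<lambda>k l. X n k l \<omega>) z))) = ?N"
    by (rule dim_row_inverse_shifted_mat[of ?N "\<lambda>k l. X n k l \<omega>" z 0 0]) (use X_sym z in auto)
  then show ?thesis unfolding g_def H mat_tr_def resolvent_def by simp
qed

lemma centered_symmetric_matrix_X: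
  assumes third: "\<And>i j. i \<le> j \<Longrightarrow> integrable M (\<lambda>\<omega>. \<bar>a i j \<omega>\<bar> ^ 3)"
    and \<mu>: "\<And>i j. i \<le> j \<Longrightarrow> expectation (\<lambda>\<omega>. \<bar>a i j \<omega>\<bar> ^ 3) \<le> \<mu>" "0 \<le> \<mu>"
  shows "centered_symmetric_matrix M (2 * n + 1) (X n) (v\<^sup>2 / B n) (2 * v\<^sup>2) (2 * \<mu> * \<beta> n)"
proof -
  let ?N = "2 * n + 1"
  note mom = X_moments[OF _ _ third \<mu>(1)]
  have B: "B n > 0" using B_ge_1[of n] by linarith
  have row: "(\<Sum>l<?N. \<psi> ((real k - real l) / B n) / B n) \<le> 2" if k: "k < ?N" for k
  proof -
    have "(\<Sum>l<?N. \<psi> ((real k - real l) / B n) / B n) = psi.row_mass (B n) ?N k"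
      unfolding psi.row_mass_def sum_divide_distrib ..
    also have "\<dots> \<le> 1 + 1 / B n" by (rule psi.row_mass_le[OF B k])
    also have "\<dots> \<le> 2" using B_ge_1[of n] by (simp add: divide_le_eq)
    finally show ?thesis .
  qed
  show ?thesis
  proof unfold_locales
    fix k l assume kl: "k < ?N" "l < ?N"
    have "expectation (\<lambda>\<omega>. (X n k l \<omega>)\<^sup>2) = v\<^sup>2 * (\<psi> ((real k - real l) / B n) / B n)"
      by (rule mom(4)) (use kl in auto)
    also have "\<dots> \<le> v\<^sup>2 * (1 / B n)"
      using psi.le_one B by (intro mult_left_mono divide_right_mono) auto
    finally show "expectation (\<lambda>\<omega>. (X n k l \<omega>)\<^sup>2) \<le> v\<^sup>2 / B n" by simp
    show "integrable M (X n k l)" by (rule mom(1)) (use kl in auto)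
    show "expectation (X n k l) = 0" by (rule mom(2)) (use kl in auto)
    show "integrable M (\<lambda>\<omega>. (X n k l \<omega>)\<^sup>2)" by (rule mom(3)) (use kl in auto)
    show "integrable M (\<lambda>\<omega>. \<bar>X n k l \<omega>\<bar> ^ 3)" by (rule mom(5)) (use kl in auto)
  next
    fix k assume k: "k < ?N"
    have "(\<Sum>l<?N. expectation (\<lambda>\<omega>. (X n k l \<omega>)\<^sup>2)) = v\<^sup>2 * (\<Sum>l<?N. \<psi> ((real k - real l) / B n) / B n)"
      unfolding sum_distrib_left by (intro sum.cong refl mom(4)) (use k in auto)
    also have "\<dots> \<le> v\<^sup>2 * 2" by (intro mult_left_mono row k) simp
    finally show "(\<Sum>l<?N. expectation (\<lambda>\<omega>. (X n k l \<omega>)\<^sup>2)) \<le> 2 * v\<^sup>2" by simp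
    have "(\<Sum>l<?N. expectation (\<lambda>\<omega>. \<bar>X n k l \<omega>\<bar> ^ 3)) \<le> (\<Sum>l<?N. \<mu> * \<beta> n * (\<psi> ((real k - real l) / B n) / B n))"
      by (intro sum_mono mom(6)) (use k in auto)
    also have "\<dots> = \<mu> * \<beta> n * (\<Sum>l<?N. \<psi> ((real k - real l) / B n) / B n)"
      by (simp only: sum_distrib_left)
    also have "\<dots> \<le> \<mu> * \<beta> n * 2"
      by (intro mult_left_mono row k mult_nonneg_nonneg \<mu>(2)) simp
    finally show "(\<Sum>l<?N. expectation (\<lambda>\<omega>. \<bar>X n k l \<omega>\<bar> ^ 3)) \<le> 2 * \<mu> * \<beta> n" by simp
  qed (rule X_sym indep_X)+
qed

lemma third_moment_bound:
  assumes "(SUP (i, j)\<in>upper_pairs. \<integral>\<^sup>+\<omega>. ennreal (\<bar>a i j \<omega>\<bar> ^ 3) \<partial>M) < \<infinity>"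
  obtains \<mu> where "0 \<le> \<mu>" "\<And>i j. i \<le> j \<Longrightarrow> integrable M (\<lambda>\<omega>. \<bar>a i j \<omega>\<bar> ^ 3)"
    "\<And>i j. i \<le> j \<Longrightarrow> expectation (\<lambda>\<omega>. \<bar>a i j \<omega>\<bar> ^ 3) \<le> \<mu>"
proof -
  define \<Sigma> where "\<Sigma> = (SUP (i, j)\<in>upper_pairs. \<integral>\<^sup>+\<omega>. ennreal (\<bar>a i j \<omega>\<bar> ^ 3) \<partial>M)"
  have fin: "\<Sigma> < \<infinity>" using assms unfolding \<Sigma>_def .
  have le: "(\<integral>\<^sup>+\<omega>. ennreal (\<bar>a i j \<omega>\<bar> ^ 3) \<partial>M) \<le> \<Sigma>" if "i \<le> j" for i j
    unfolding \<Sigma>_def by (rule SUP_upper2[of "(i, j)"]) (use that in \<open>auto simp: upper_pairs_def\<close>)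
  have int: "integrable M (\<lambda>\<omega>. \<bar>a i j \<omega>\<bar> ^ 3)" if ij: "i \<le> j" for i j
  proof (rule integrableI_bounded)
    show "(\<lambda>\<omega>. \<bar>a i j \<omega>\<bar> ^ 3) \<in> borel_measurable M" using a_measurable[OF ij] by measurable
    show "(\<integral>\<^sup>+\<omega>. ennreal (norm (\<bar>a i j \<omega>\<bar> ^ 3)) \<partial>M) < \<infinity>"
      using le_less_trans[OF le[OF ij] fin] by simp
  qed
  have "expectation (\<lambda>\<omega>. \<bar>a i j \<omega>\<bar> ^ 3) \<le> enn2real \<Sigma>" if ij: "i \<le> j" for i j
  proof -
    have "ennreal (expectation (\<lambda>\<omega>. \<bar>a i j \<omega>\<bar> ^ 3)) \<le> \<Sigma>"
      using le[OF ij] nn_integral_eq_integral[OF int[OF ij]] by simp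
    also have "\<Sigma> = ennreal (enn2real \<Sigma>)" using fin by (simp add: less_top)
    finally show ?thesis by simp
  qed
  with int show thesis by (intro that[of "enn2real \<Sigma>"]) auto
qed

lemma K_le:
  assumes "0 \<le> \<mu>"
  shows "4 * (v\<^sup>2 / B n) + 16 * (v\<^sup>2 / B n)\<^sup>2 + 8 * (v\<^sup>2 / B n) * (2 * v\<^sup>2) + 12 * (2 * \<mu> * \<beta> n) \<le>
    (4 * v\<^sup>2 + 32 * v ^ 4 + 24 * \<mu>) * \<beta> n"
proof -
  have "4 * (v\<^sup>2 / B n) + 16 * (v\<^sup>2 / B n)\<^sup>2 + 8 * (v\<^sup>2 / B n) * (2 * v\<^sup>2) + 12 * (2 * \<mu> * \<beta> n) =
    4 * v\<^sup>2 * (1 / B n) + 16 * v ^ 4 * (1 / (B n)\<^sup>2) + 16 * v ^ 4 * (1 / B n) + 24 * \<mu> * \<beta> n"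
    by (simp add: power_divide power2_eq_square power4_eq_xxxx)
  also have "\<dots> \<le> 4 * v\<^sup>2 * \<beta> n + 16 * v ^ 4 * \<beta> n + 16 * v ^ 4 * \<beta> n + 24 * \<mu> * \<beta> n"
    by (intro add_mono mult_left_mono \<beta>_bounds) (use assms in auto)
  finally show ?thesis by (simp add: algebra_simps)
qed

text \<open>
  Here \<open>\<sigma>\<close> is of order \<open>1 / B n\<close> and \<open>\<tau>\<close> of order \<open>\<beta> n\<close>, while \<open>S = 2 * v\<^sup>2\<close> turns the contraction
  condition into \<open>\<bar>Im z\<bar> \<ge> 2 * v\<close>. For the mean the reference value is the semicircle transform,
  which solves the self-consistent equation exactly when the variances in a row sum to \<open>v\<^sup>2\<close>.
\<close>

lemma variance_and_mean_bounds:
  assumes \<mu>: "0 \<le> \<mu>" "\<And>i j. i \<le> j \<Longrightarrow> integrable M (\<lambda>\<omega>. \<bar>a i j \<omega>\<bar> ^ 3)"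
      "\<And>i j. i \<le> j \<Longrightarrow> expectation (\<lambda>\<omega>. \<bar>a i j \<omega>\<bar> ^ 3) \<le> \<mu>"
    and z: "\<bar>Im z\<bar> \<ge> 2 * v + 1"
  defines "C0 \<equiv> 4 * v\<^sup>2 + 32 * v ^ 4 + 24 * \<mu>"
  shows "complex_variance M (g a b d n z) \<le> 8 * C0 * \<beta> n"
    and "(cmod (expectation (g a b d n z) - w_sc v z))\<^sup>2 \<le> 8 * C0 * \<beta> n +
      8 * v ^ 4 * (1 / real (2 * n + 1) * (\<Sum>k<2 * n + 1. (psi.row_mass (B n) (2 * n + 1) k - 1)\<^sup>2))"
proof -
  have z1: "\<bar>Im z\<bar> \<ge> 1" and Imz: "Im z \<noteq> 0" using z v_pos by auto
  have contraction: "4 * (2 * v\<^sup>2)\<^sup>2 \<le> \<bar>Im z\<bar> ^ 4"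
  proof -
    have "4 * (2 * v\<^sup>2)\<^sup>2 = (2 * v) ^ 4" by (simp add: power2_eq_square power4_eq_xxxx)
    also have "\<dots> \<le> \<bar>Im z\<bar> ^ 4" using z v_pos by (intro power_mono) auto
    finally show ?thesis .
  qed
  define w where "w = w_sc v z"
  have w0: "Im z * Im w > 0" unfolding w_def by (rule Im_w_sc_sign[OF v_pos Imz])
  have wfix: "w = 1 / (- z - of_real (v\<^sup>2) * w)"
    using w_sc_fixed_point[OF v_pos Imz] unfolding w_def by simp
  have sign: "Im z * Im (of_real c * w) \<ge> 0" if "c \<ge> 0" for c
    using mult_nonneg_nonneg[OF that order_less_imp_le[OF w0]] by (simp add: mult_ac)
  have w1: "cmod w \<le> 1"
  proof -
    have "1 \<le> cmod (- z - of_real (v\<^sup>2) * w)"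
      using norm_inverse_shift_le(1)[OF sign z1, of "v\<^sup>2"] z1 by simp
    moreover have "cmod w = 1 / cmod (- z - of_real (v\<^sup>2) * w)" by (subst wfix) (simp add: norm_divide)
    ultimately show ?thesis by (simp add: divide_le_eq)
  qed
  let ?N = "2 * n + 1"
  have N: "?N > 0" by simp
  interpret C: centered_symmetric_matrix M ?N "X n" "v\<^sup>2 / B n" "2 * v\<^sup>2" "2 * \<mu> * \<beta> n"
    by (rule centered_symmetric_matrix_X[OF \<mu>(2,3,1)])
  have g: "g a b d n z = C.trace_avg z"
    unfolding fun_eq_iff C.trace_avg_def g_eq_average[OF Imz] by simp
  note K = K_le[OF \<mu>(1), of n, folded C0_def]
  have K8: "8 * k \<le> 8 * C0 * \<beta> n" if "k \<le> C0 * \<beta> n" for k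
    using that by (simp only: mult.assoc)
  show "complex_variance M (g a b d n z) \<le> 8 * C0 * \<beta> n"
    unfolding g by (rule order_trans[OF C.complex_variance_trace_avg_le[OF z1 contraction N] K8[OF K]])
  have row: "(cmod (1 / (- z - of_real (\<Sum>l<?N. C.s k l) * w) - w))\<^sup>2 \<le>
      v ^ 4 * (psi.row_mass (B n) ?N k - 1)\<^sup>2" if k: "k < ?N" for k
  proof -
    let ?S = "\<Sum>l<?N. C.s k l"
    have S: "?S = v\<^sup>2 * psi.row_mass (B n) ?N k"
      unfolding psi.row_mass_def sum_divide_distrib sum_distrib_left C.s_def
      by (intro sum.cong refl X_moments(4)[OF k _ \<mu>(2,3)]) auto
    have S0: "?S \<ge> 0" by (intro sum_nonneg C.s_nonneg)
    have "cmod (1 / (- z - of_real ?S * w) - w) =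
        cmod (1 / (- z - of_real ?S * w) - 1 / (- z - of_real (v\<^sup>2) * w))"
      using wfix by simp
    also have "\<dots> \<le> cmod (of_real ?S * w - of_real (v\<^sup>2) * w) / \<bar>Im z\<bar>\<^sup>2"
      by (rule norm_inverse_shift_diff_le[OF sign[OF S0] sign z1]) simp
    also have "\<dots> \<le> cmod (of_real ?S * w - of_real (v\<^sup>2) * w) / 1"
      using one_le_power[OF z1, of 2] by (intro divide_left_mono) auto
    also have "of_real ?S * w - of_real (v\<^sup>2) * w = of_real (v\<^sup>2 * (psi.row_mass (B n) ?N k - 1)) * w"
      unfolding S by (simp add: algebra_simps)
    also have "cmod (of_real (v\<^sup>2 * (psi.row_mass (B n) ?N k - 1)) * w) / 1 \<le>
        \<bar>v\<^sup>2 * (psi.row_mass (B n) ?N k - 1)\<bar> * 1"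
      unfolding norm_mult norm_of_real div_by_1 using w1 by (intro mult_left_mono) auto
    finally have "(cmod (1 / (- z - of_real ?S * w) - w))\<^sup>2 \<le> (\<bar>v\<^sup>2 * (psi.row_mass (B n) ?N k - 1)\<bar> * 1)\<^sup>2"
      by (intro power_mono) auto
    then show ?thesis by (simp add: power_mult_distrib flip: power_mult)
  qed
  have "(cmod (expectation (g a b d n z) - w))\<^sup>2 \<le> 8 * C0 * \<beta> n +
      8 * (1 / real ?N * (\<Sum>k<?N. (cmod (1 / (- z - of_real (\<Sum>l<?N. C.s k l) * w) - w))\<^sup>2))"
    unfolding g
    by (rule order_trans[OF C.norm_expectation_trace_avg_diff_sq_le[OF z1 contraction N order_less_imp_le[OF w0]]
      add_right_mono[OF K8[OF K]]])
  also have "\<dots> \<le> 8 * C0 * \<beta> n + 8 * (1 / real ?N * (\<Sum>k<?N. v ^ 4 * (psi.row_mass (B n) ?N k - 1)\<^sup>2))"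
    by (intro add_left_mono mult_left_mono sum_mono row) auto
  also have "\<dots> = 8 * C0 * \<beta> n + 8 * v ^ 4 * (1 / real ?N * (\<Sum>k<?N. (psi.row_mass (B n) ?N k - 1)\<^sup>2))"
    by (simp only: sum_distrib_left[symmetric]) (simp add: mult_ac)
  finally show "(cmod (expectation (g a b d n z) - w_sc v z))\<^sup>2 \<le> 8 * C0 * \<beta> n +
    8 * v ^ 4 * (1 / real ?N * (\<Sum>k<?N. (psi.row_mass (B n) ?N k - 1)\<^sup>2))"
    unfolding w_def .
qed

lemma \<beta>_tendsto_0: "\<beta> \<longlonglongrightarrow> 0"
proof -
  have "filterlim B at_top sequentially"
    using filterlim_compose[OF filterlim_real_of_int_at_top b_at_top] by (simp add: comp_def)
  then show ?thesis by (rule tendsto_neg_powr[rotated]) simp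
qed

lemma mean_tendsto_w_sc:
  assumes sup: "(SUP (i, j)\<in>upper_pairs. \<integral>\<^sup>+\<omega>. ennreal (\<bar>a i j \<omega>\<bar> ^ 3) \<partial>M) < \<infinity>"
    and z: "\<bar>Im z\<bar> \<ge> 2 * v + 1"
  shows "(\<lambda>n. expectation (g a b d n z)) \<longlonglongrightarrow> w_sc v z"
proof -
  obtain \<mu> where \<mu>: "0 \<le> \<mu>" "\<And>i j. i \<le> j \<Longrightarrow> integrable M (\<lambda>\<omega>. \<bar>a i j \<omega>\<bar> ^ 3)"
    "\<And>i j. i \<le> j \<Longrightarrow> expectation (\<lambda>\<omega>. \<bar>a i j \<omega>\<bar> ^ 3) \<le> \<mu>"
    using third_moment_bound[OF sup] by blast
  define C where "C = 8 * (4 * v\<^sup>2 + 32 * v ^ 4 + 24 * \<mu>)"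
  note C = variance_and_mean_bounds(2)[OF \<mu> z, folded C_def]
  have Binf: "filterlim B at_top sequentially"
    using filterlim_compose[OF filterlim_real_of_int_at_top b_at_top] by (simp add: comp_def)
  have "(\<lambda>n. C * \<beta> n + 8 * v ^ 4 * (1 / real (2 * n + 1) *
      (\<Sum>k<2 * n + 1. (psi.row_mass (B n) (2 * n + 1) k - 1)\<^sup>2))) \<longlonglongrightarrow> C * 0 + 8 * v ^ 4 * 0"
    by (intro tendsto_intros \<beta>_tendsto_0
      psi.average_row_mass_deviation_tendsto_0[OF B_ge_1 Binf b_over_n])
  then have lim: "(\<lambda>n. C * \<beta> n + 8 * v ^ 4 * (1 / real (2 * n + 1) *
      (\<Sum>k<2 * n + 1. (psi.row_mass (B n) (2 * n + 1) k - 1)\<^sup>2))) \<longlonglongrightarrow> 0" by simp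
  have "(\<lambda>n. (cmod (expectation (g a b d n z) - w_sc v z))\<^sup>2) \<longlonglongrightarrow> 0"
    by (rule tendsto_sandwich[OF _ _ tendsto_const lim]) (use C in auto)
  then have "(\<lambda>n. sqrt ((cmod (expectation (g a b d n z) - w_sc v z))\<^sup>2)) \<longlonglongrightarrow> sqrt 0"
    by (rule tendsto_real_sqrt)
  then have "(\<lambda>n. cmod (expectation (g a b d n z) - w_sc v z)) \<longlonglongrightarrow> 0" by simp
  then show ?thesis by (simp add: tendsto_norm_zero_iff LIM_zero_iff)
qed

lemma variance_bigo:
  assumes sup: "(SUP (i, j)\<in>upper_pairs. \<integral>\<^sup>+\<omega>. ennreal (\<bar>a i j \<omega>\<bar> ^ 3) \<partial>M) < \<infinity>"
    and z: "\<bar>Im z\<bar> \<ge> 2 * v + 1"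
  shows "(\<lambda>n. complex_variance M (g a b d n z)) \<in> O(\<beta>)"
proof -
  obtain \<mu> where \<mu>: "0 \<le> \<mu>" "\<And>i j. i \<le> j \<Longrightarrow> integrable M (\<lambda>\<omega>. \<bar>a i j \<omega>\<bar> ^ 3)"
    "\<And>i j. i \<le> j \<Longrightarrow> expectation (\<lambda>\<omega>. \<bar>a i j \<omega>\<bar> ^ 3) \<le> \<mu>"
    using third_moment_bound[OF sup] by blast
  define C where "C = 8 * (4 * v\<^sup>2 + 32 * v ^ 4 + 24 * \<mu>)"
  note C = variance_and_mean_bounds(1)[OF \<mu> z, folded C_def]
  have "0 \<le> complex_variance M (g a b d n z)" for n
    unfolding complex_variance_def by simp
  with C show ?thesis
    by (intro bigoI[of _ C] always_eventually allI) simp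
qed

end

theorem theorem2p3:
  fixes M :: "'w measure"
    and v :: real
    and \<psi> :: "real \<Rightarrow> real"
    and a :: "int \<Rightarrow> int \<Rightarrow> 'w \<Rightarrow> real"
    and b :: "nat \<Rightarrow> int"
    and d :: "nat \<Rightarrow> int \<Rightarrow> int \<Rightarrow> 'w \<Rightarrow> real"
    and z :: complex
  assumes "long_range_percolation M v \<psi> a b d"
    and "(SUP (i, j)\<in>upper_pairs. \<integral>\<^sup>+\<omega>. ennreal (\<bar>a i j \<omega>\<bar> ^ 3) \<partial>M) < \<infinity>"
    and "\<bar>Im z\<bar> \<ge> 2 * v + 1"
  shows "(\<lambda>n. \<integral>\<omega>. g a b d n z \<omega> \<partial>M) \<longlonglongrightarrow> w_sc v z \<and>
    (\<lambda>n. complex_variance M (g a b d n z)) \<in> O(\<lambda>n. real_of_int (b n) powr (- 1 / 2)) \<and>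
    (\<forall>\<zeta>. Im \<zeta> \<noteq> 0 \<longrightarrow> w_sc v \<zeta> = 1 / (- \<zeta> - (complex_of_real v)\<^sup>2 * w_sc v \<zeta>)) \<and>
    (\<forall>\<zeta> w. Im \<zeta> > 0 \<longrightarrow>
      (w = w_sc v \<zeta> \<longleftrightarrow> Im w > 0 \<and> w = 1 / (- \<zeta> - (complex_of_real v)\<^sup>2 * w)))"
proof -
  interpret long_range_percolation M v \<psi> a b d by fact
  have fixed: "w_sc v \<zeta> = 1 / (- \<zeta> - (complex_of_real v)\<^sup>2 * w_sc v \<zeta>)" if "Im \<zeta> \<noteq> 0" for \<zeta>
    by (rule w_sc_fixed_point[OF v_pos that])
  have "w = w_sc v \<zeta> \<longleftrightarrow> Im w > 0 \<and> w = 1 / (- \<zeta> - (complex_of_real v)\<^sup>2 * w)" if "Im \<zeta> > 0" for \<zeta> w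
  proof
    assume w: "w = w_sc v \<zeta>"
    have "Im \<zeta> * Im (w_sc v \<zeta>) > 0" using that by (intro Im_w_sc_sign[OF v_pos]) simp
    then have "Im w > 0" using that w by (simp add: zero_less_mult_iff)
    moreover have "w = 1 / (- \<zeta> - (complex_of_real v)\<^sup>2 * w)" unfolding w by (rule fixed) (use that in simp)
    ultimately show "Im w > 0 \<and> w = 1 / (- \<zeta> - (complex_of_real v)\<^sup>2 * w)" by blast
  next
    assume w: "Im w > 0 \<and> w = 1 / (- \<zeta> - (complex_of_real v)\<^sup>2 * w)"
    show "w = w_sc v \<zeta>"
      by (rule w_sc_unique[OF v_pos _ conjunct2[OF w]]) (use that w in auto)
  qed
  with fixed mean_tendsto_w_sc[OF assms(2,3)] variance_bigo[OF assms(2,3)] show ?thesis by blast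
qed

end
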